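(* Let $\Delta_2=\mathrm{conv}(\mathbf 0,e_1,e_2)\subset\mathbb R^2$. Then $\mathrm{Flt}_2^{\mathbb R}(\Delta_2)=2$ and $\mathrm{Flt}_2^{\mathbb Z}(\Delta_2)=\frac{10}{3}$.
   Context: Let $A\in\{\mathbb Z,\mathbb R\}$. A convex body in $\mathbb R^d$ is a nonempty compact convex subset of $\mathbb R^d$. An $A$-unimodular transformation is a map $T:\mathbb R^d\to\mathbb R^d$, $T(x)=Mx+b$ with $M\in \mathrm{GL}_d(\mathbb Z)$ and $b\in A^d$; an $A$-unimodular copy of $X\subset\mathbb R^d$ is a set $T(X)$ for such a $T$. For $u\in(\mathbb Z^d)^*=\mathrm{Hom}(\mathbb Z^d,\mathbb Z)$ (extended linearly to $\mathbb R^d$) and $K\subset\mathbb R^d$, $\mathrm{width}_u(K)=\sup_{x,y\in K}|u(x)-u(y)|$, and the lattice width is $\mathrm{width}(K)=\inf_{u\in(\mathbb Z^d)^*\setminus\{0\}}\mathrm{width}_u(K)$. For a bounded set $X\subset\mathbb R^d$, the generalised flatness constant is $\mathrm{Flt}_d^A(X)=\sup\{\mathrm{width}(K): K\subset\mathbb R^d \text{ a convex body containing no } A\text{-unimodular copy of } X\}$. $e_1,e_2$ is the standard basis of $\mathbb Z^2$. *)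

theory Defs
  imports "HOL-Analysis.Analysis"
begin

definition convex_body :: "(real^'n) set \<Rightarrow> bool" where
  "convex_body K \<longleftrightarrow> K \<noteq> {} \<and> compact K \<and> convex K"

definition int_functional :: "int^'n \<Rightarrow> real^'n \<Rightarrow> real" where
  "int_functional u x = (\<Sum>i\<in>UNIV. real_of_int (u $ i) * x $ i)"

definition width_dir :: "int^'n \<Rightarrow> (real^'n) set \<Rightarrow> real" where
  "width_dir u K = Sup {\<bar>int_functional u x - int_functional u y\<bar> | x y. x \<in> K \<and> y \<in> K}"

definition lattice_width :: "(real^'n) set \<Rightarrow> real" where
  "lattice_width K = Inf {width_dir u K | u. u \<noteq> 0}"

text \<open>A-unimodular transformation T(x) = Mx + b, M in GL_d(Z), b in A^d.
  The coefficient set A is given as a set of reals (\<int> or UNIV = \<real>).\<close>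
definition unimodular_map :: "real set \<Rightarrow> (real^'n \<Rightarrow> real^'n) \<Rightarrow> bool" where
  "unimodular_map A T \<longleftrightarrow> (\<exists>(M::int^'n^'n) (b::real^'n).
      (det M = 1 \<or> det M = -1) \<and> (\<forall>i. b $ i \<in> A) \<and>
      T = (\<lambda>x. (\<chi> i j. real_of_int (M $ i $ j)) *v x + b))"

definition contains_unimodular_copy :: "real set \<Rightarrow> (real^'n) set \<Rightarrow> (real^'n) set \<Rightarrow> bool" where
  "contains_unimodular_copy A K X \<longleftrightarrow> (\<exists>T. unimodular_map A T \<and> T ` X \<subseteq> K)"

text \<open>Generalised flatness constant, as a supremum in the extended reals
  (so that an unbounded set of widths gives \<infinity>).\<close>
definition Flt :: "real set \<Rightarrow> (real^'n) set \<Rightarrow> ereal" where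
  "Flt A X = Sup {ereal (lattice_width K) | K. convex_body K \<and> \<not> contains_unimodular_copy A K X}"

definition Delta2 :: "(real^2) set" where
  "Delta2 = convex hull {0, axis 1 1, axis 2 1}"

end

theory Submission
  imports Defs
begin

text \<open>
  Upper bounds. Three lattice points of a convex body that are the vertices of a unimodular triangle are
  a \<open>\<int>\<close>-copy of \<open>Delta2\<close>, and arbitrary translates of such triangles are the \<open>\<real>\<close>-copies.

  In the real case take coordinates in which \<open>y\<close> is a direction of minimal width \<open>H > 2\<close>. The body contains
  horizontal segments of length more than one, since otherwise it could be separated from its horizontal
  translate and some direction \<open>x + k y\<close> would have width at most \<open>1 + H / 2\<close>. The lowest and the highest
  horizontal unit segment span a parallelogram; a real shear turns it into a rectangle over \<open>[0, 1]\<close>. Outside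
  the rectangle the body consists of two caps inside the strip over \<open>[0, 1]\<close> and two lateral bulges. Without
  a unimodular triangle the caps avoid two specific points, which bounds their heights, and then
  one of the two lattice directions nearest to the sheared \<open>x\<close> has width less than \<open>H\<close>.

  In the integer case one may add lattice points until the body contains \<open>(0, 0)\<close> and \<open>(1, 0)\<close>, so that it
  contains no lattice point of height \<open>1\<close> or \<open>-1\<close>. Its rows at these two heights then lie strictly between
  consecutive lattice points, and a shear puts both rows over \<open>(0, 1)\<close>. Again the body has caps
  and bulges, and one of the lattice directions near \<open>x\<close> has width at most \<open>10 / 3\<close>.

  Lower bounds. These come from slightly shrunk copies of the square \<open>\<bar>x\<bar> + \<bar>y\<bar> \<le> 1\<close> and of the triangle with
  centroid \<open>(4 / 3, 0)\<close> and vertices \<open>(3, 0)\<close>, \<open>(-1 / 3, 5 / 3)\<close>, \<open>(4 / 3, -5 / 3)\<close>.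
\<close>

section \<open>The size of bulges\<close>

text \<open>With equality in both hypotheses \<open>m\<close> is a weighted harmonic mean of \<open>x\<close> and \<open>z\<close>, which is concave; the
  conclusion is its tangent on the diagonal. In the applications a bulge of size \<open>m\<close> lies below a cap of height
  \<open>A\<close> with apex over \<open>x\<close> and above a cap of height \<open>B\<close> with apex over \<open>z\<close>.\<close>

lemma harmonic_bound:
  fixes A B m r s x z :: real
  assumes "0 \<le> A" "0 \<le> B" "0 \<le> x" "0 \<le> z" "0 \<le> s" "0 \<le> r" "0 \<le> m"
    and 1: "m * A \<le> x * s" and 2: "m * B \<le> z * r"
  shows "m * (A + B)\<^sup>2 \<le> (A * x + B * z) * (s + r)"
proof -
  let ?u = "A * x * r" and ?v = "B * z * s" and ?w = "A * B * m"
  \<comment> \<open>The cross term \<open>2 * A * B * m\<close> of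
    \<open>m * (A + B)\<^sup>2\<close> is bounded by multiplying the two hypotheses and using the
    inequality of arithmetic and geometric means; the square terms need one hypothesis each.\<close>
  have "(m * A) * (m * B) \<le> (x * s) * (z * r)"
    using assms by (intro mult_mono[OF 1 2]) auto
  then have "A * B * ((m * A) * (m * B)) \<le> A * B * ((x * s) * (z * r))"
    using assms by (intro mult_left_mono) auto
  then have "?w\<^sup>2 \<le> ?u * ?v"
    by (simp add: power2_eq_square algebra_simps)
  moreover have "4 * (?u * ?v) \<le> (?u + ?v)\<^sup>2"
    using zero_le_power2[of "?u - ?v"] by (simp add: power2_eq_square algebra_simps)
  ultimately have "(2 * ?w)\<^sup>2 \<le> (?u + ?v)\<^sup>2"
    by (simp add: power2_eq_square)
  moreover have "0 \<le> ?u + ?v" using assms by simp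
  ultimately have "2 * ?w \<le> ?u + ?v"
    by (rule power2_le_imp_le)
  moreover have "A * (m * A) \<le> A * (x * s)" "B * (m * B) \<le> B * (z * r)"
    using assms by (auto intro!: mult_left_mono)
  ultimately show ?thesis
    by (simp add: power2_eq_square algebra_simps)
qed

text \<open>Bulges on opposite sides carry the weights \<open>x\<close>, \<open>z\<close> and
  \<open>1 - x\<close>, \<open>1 - z\<close>. In the sum of the two linear bounds the positions of
  the apices cancel.\<close>

lemma harmonic_bound_two:
  fixes A B m n r s r' s' x z \<eta> :: real
  assumes "0 \<le> A" "0 \<le> B" "0 < A + B" "0 \<le> x" "x \<le> 1" "0 \<le> z" "z \<le> 1"
    and "0 \<le> s" "0 \<le> r" "0 \<le> m" "m * A \<le> x * s" "m * B \<le> z * r" "s + r = \<eta>"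
    and "0 \<le> s'" "0 \<le> r'" "0 \<le> n" "n * A \<le> (1 - x) * s'" "n * B \<le> (1 - z) * r'" "s' + r' = \<eta>"
  shows "(m + n) * (A + B) \<le> \<eta>"
proof -
  have "m * (A + B)\<^sup>2 \<le> (A * x + B * z) * (s + r)"
    using assms by (intro harmonic_bound) auto
  moreover have "n * (A + B)\<^sup>2 \<le> (A * (1 - x) + B * (1 - z)) * (s' + r')"
    using assms by (intro harmonic_bound) auto
  ultimately have "m * (A + B)\<^sup>2 + n * (A + B)\<^sup>2 \<le> (A * x + B * z) * \<eta> + (A * (1 - x) + B * (1 - z)) * \<eta>"
    using assms by simp
  then have "((m + n) * (A + B)) * (A + B) \<le> \<eta> * (A + B)"
    by (simp add: power2_eq_square algebra_simps)
  then show ?thesis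
    using assms(3) by (simp only: mult_le_cancel_right_pos)
qed

text \<open>The left side bounds the width in direction \<open>x - f y\<close> when only one side of
  the strip has a bulge. Eliminating \<open>r\<close> by \<open>m * A \<le> \<eta> - r\<close>
  leaves a bound increasing in \<open>m\<close>, and
  \<open>m \<le> \<eta> / (A + B)\<close>.\<close>

lemma real_one_bulge:
  fixes A B m r \<eta> f :: real
  assumes "0 \<le> A" "0 \<le> B" "0 \<le> f" "0 < \<eta>" "\<eta> < 1" "2 < A + B + \<eta>"
    and "f * A \<le> 1 - \<eta>" "f * B \<le> 1 - \<eta>"
    and m: "0 \<le> m" "m * A \<le> \<eta> - r" "m * B \<le> r"
  shows "1 + m + f * r + f * B < A + B + \<eta>"
proof -
  define h where "h = A + B"
  have h: "1 + (1 - \<eta>) < h" using assms unfolding h_def by simp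
  have mh: "m * h \<le> \<eta>" using m unfolding h_def by (simp add: algebra_simps)
  have "f * r \<le> f * (\<eta> - m * A)"
    using assms by (intro mult_left_mono) auto
  then have 1: "m + f * r \<le> f * \<eta> + m * (1 - f * A)"
    by (simp add: algebra_simps)
  have "(m * h) * (1 - f * A) \<le> \<eta> * (1 - f * A)"
    using mh assms by (intro mult_right_mono) auto
  then have "(m + f * r) * h \<le> f * \<eta> * h + \<eta> * (1 - f * A)"
    using mult_right_mono[OF 1, of h] h assms by (simp add: algebra_simps)
  also have "\<dots> = \<eta> * (1 + f * B)"
    by (simp add: h_def algebra_simps)
  finally have 2: "(m + f * r) * h \<le> \<eta> * (1 + f * B)" .
  \<comment> \<open>Total height above two enters here:
    \<open>1 + f * B \<le> 2 - \<eta> < h\<close>.\<close>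
  have "(1 + f * B) * (h + \<eta>) < h * (h + \<eta>)"
    using h assms by (intro mult_strict_right_mono) auto
  then have "(1 + m + f * r + f * B) * h < (h + \<eta>) * h"
    using 2 by (simp add: algebra_simps)
  then show ?thesis
    using h assms(5) by (simp add: h_def mult_less_cancel_right_pos)
qed

text \<open>With \<open>g = 1 - \<eta>\<close> the two bulges add up to at most
  \<open>(1 - g) / (1 + g)\<close>, and the cap bounds give \<open>f \<le> 2 * g / (1 + g)\<close>.
  Since \<open>(1 - g) * (1 + 2 * g) \<le> 1 + g\<close>, the left side is at most 2.\<close>

lemma real_two_bulges:
  fixes A B m n \<eta> f y y' :: real
  assumes "0 \<le> A" "0 \<le> B" "0 \<le> f" "0 < \<eta>" "\<eta> < 1" "2 < A + B + \<eta>"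
    and "f * A \<le> 1 - \<eta>" "f * B \<le> 1 - \<eta>"
    and "(m + n) * (A + B) \<le> \<eta>" "y - y' \<le> \<eta>"
  shows "1 + m + n + f * (y - y') < A + B + \<eta>"
proof -
  define g where "g = 1 - \<eta>"
  define h where "h = A + B"
  have h: "1 + g < h" and g: "0 < g" "g < 1" using assms unfolding h_def g_def by auto
  have "m + n \<le> \<eta> / h" using assms(9) h g by (simp add: h_def field_simps)
  also have "\<dots> \<le> (1 - g) / (1 + g)" using h g by (simp add: g_def frac_le)
  finally have 1: "m + n \<le> (1 - g) / (1 + g)" .
  have "f * (1 + g) \<le> f * h" using h assms by (intro mult_left_mono) auto
  also have "\<dots> \<le> 2 * g" using assms by (simp add: h_def g_def algebra_simps)
  finally have f: "f \<le> 2 * g / (1 + g)" using g by (simp add: field_simps)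
  have "f * (y - y') \<le> f * (1 - g)" using assms by (intro mult_left_mono) (auto simp: g_def)
  also have "\<dots> \<le> 2 * g / (1 + g) * (1 - g)" using f g by (intro mult_right_mono) auto
  finally have "m + n + f * (y - y') \<le> (1 - g) / (1 + g) + 2 * g / (1 + g) * (1 - g)"
    using 1 by simp
  also have "\<dots> = ((1 - g) * (1 + 2 * g)) / (1 + g)"
    by (simp add: add_divide_distrib[symmetric] algebra_simps)
  also have "\<dots> \<le> 1" using g by (simp add: field_simps)
  finally show ?thesis using assms by simp
qed

section \<open>Planar convex sets\<close>

lemma convex_affine_preimage:
  fixes S :: "(real \<times> real) set"
  assumes "convex S"
  shows "convex {(x, y). (a * x + b * y + c, d * x + e * y + g) \<in> S}"
proof (rule convexI)
  fix p q :: "real \<times> real" and u v :: real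
  assume *: "0 \<le> u" "0 \<le> v" "u + v = 1"
    and p: "p \<in> {(x, y). (a * x + b * y + c, d * x + e * y + g) \<in> S}"
    and q: "q \<in> {(x, y). (a * x + b * y + c, d * x + e * y + g) \<in> S}"
  obtain x1 y1 x2 y2 where pq: "p = (x1, y1)" "q = (x2, y2)"
    by (metis surj_pair)
  have "u = 1 - v" using * by simp
  have "u *\<^sub>R (a * x1 + b * y1 + c, d * x1 + e * y1 + g) + v *\<^sub>R (a * x2 + b * y2 + c, d * x2 + e * y2 + g) \<in> S"
    using p q * by (intro convexD[OF assms]) (auto simp: pq)
  then show "u *\<^sub>R p + v *\<^sub>R q \<in> {(x, y). (a * x + b * y + c, d * x + e * y + g) \<in> S}"
    unfolding pq \<open>u = 1 - v\<close> by (simp add: algebra_simps)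
qed

lemma compact_affine_preimage:
  fixes S :: "(real \<times> real) set"
  assumes "compact S" and det: "a * e - b * d \<noteq> 0"
  shows "compact {(x, y). (a * x + b * y + c, d * x + e * y + g) \<in> S}" (is "compact ?T")
proof -
  define D where "D = a * e - b * d"
  have D: "D \<noteq> 0" using det by (simp add: D_def)
  \<comment> \<open>Cramer's rule: the preimage is the image of \<open>S\<close> under this explicit
    continuous inverse.\<close>
  define F :: "real \<times> real \<Rightarrow> real \<times> real" where
    "F = (\<lambda>P. ((e * (fst P - c) - b * (snd P - g)) / D, (a * (snd P - g) - d * (fst P - c)) / D))"
  have inv1: "a * fst (F P) + b * snd (F P) + c = fst P" and inv2: "d * fst (F P) + e * snd (F P) + g = snd P" for P
  proof -
    have "a * fst (F P) + b * snd (F P) = D * (fst P - c) / D"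
      unfolding F_def fst_conv snd_conv times_divide_eq_right add_divide_distrib[symmetric]
      by (simp add: D_def algebra_simps)
    then show "a * fst (F P) + b * snd (F P) + c = fst P" using D by simp
    have "d * fst (F P) + e * snd (F P) = D * (snd P - g) / D"
      unfolding F_def fst_conv snd_conv times_divide_eq_right add_divide_distrib[symmetric]
      by (simp add: D_def algebra_simps)
    then show "d * fst (F P) + e * snd (F P) + g = snd P" using D by simp
  qed
  have inv3: "F (a * x + b * y + c, d * x + e * y + g) = (x, y)" for x y
  proof -
    have "F (a * x + b * y + c, d * x + e * y + g) = (D * x / D, D * y / D)"
      by (simp add: F_def D_def algebra_simps)
    then show ?thesis using D by simp
  qed
  have "?T = F ` S"
  proof (intro equalityI subsetI)
    fix Q assume Q: "Q \<in> ?T"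
    obtain x y where xy: "Q = (x, y)" by (cases Q)
    from Q have "(a * x + b * y + c, d * x + e * y + g) \<in> S" by (simp add: xy)
    then have "F (a * x + b * y + c, d * x + e * y + g) \<in> F ` S" by (rule imageI)
    then show "Q \<in> F ` S" unfolding inv3 xy .
  next
    fix Q assume "Q \<in> F ` S"
    then obtain P where P: "P \<in> S" "Q = F P" by blast
    have "(a * fst (F P) + b * snd (F P) + c, d * fst (F P) + e * snd (F P) + g) \<in> S"
      unfolding inv1 inv2 using P by simp
    then show "Q \<in> ?T" using P by (simp add: case_prod_unfold)
  qed
  moreover have "continuous_on S F" unfolding F_def using D by (intro continuous_intros) auto
  ultimately show ?thesis using compact_continuous_image[of S F] assms(1) by (simp only:)
qed

text \<open>Mostly used in reverse: bounds on the row at level \<open>l\<close> restrict the points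
  of \<open>S\<close> on both sides of it.\<close>

lemma convex_at_level:
  fixes S :: "(real \<times> real) set"
  assumes "convex S" "(x1, y1) \<in> S" "(x2, y2) \<in> S" "y1 \<le> l" "l \<le> y2" "y1 < y2"
  shows "((x1 * (y2 - l) + x2 * (l - y1)) / (y2 - y1), l) \<in> S"
proof -
  define u where "u = (l - y1) / (y2 - y1)"
  have u: "0 \<le> u" "u \<le> 1" using assms by (auto simp: u_def)
  have "(1 - u) *\<^sub>R (x1, y1) + u *\<^sub>R (x2, y2) \<in> S"
    using assms(1-3) u by (intro convexD) auto
  moreover have v: "1 - u = (y2 - l) / (y2 - y1)"
    using assms(6) by (simp add: u_def field_simps)
  have "(1 - u) * x1 + u * x2 = (x1 * (y2 - l) + x2 * (l - y1)) / (y2 - y1)"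
    unfolding v by (simp add: u_def add_divide_distrib mult.commute)
  moreover have "(1 - u) * y1 + u * y2 = l"
    using assms(6) unfolding v by (simp add: u_def divide_simps) (simp add: algebra_simps)
  ultimately show ?thesis by simp
qed

lemma convex_row:
  fixes S :: "(real \<times> real) set"
  assumes "convex S" "(p, y) \<in> S" "(q, y) \<in> S" "p \<le> x" "x \<le> q"
  shows "(x, y) \<in> S"
proof (cases "p = q")
  case False
  define u where "u = (x - p) / (q - p)"
  have u: "0 \<le> u" "u \<le> 1" using assms False by (auto simp: u_def)
  have "(1 - u) *\<^sub>R (p, y) + u *\<^sub>R (q, y) \<in> S"
    using assms(1-3) u by (intro convexD) auto
  moreover have "u * (q - p) = x - p"
    using False by (simp add: u_def)
  then have "(1 - u) * p + u * q = x"
    by (simp add: algebra_simps)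
  moreover have "(1 - u) * y + u * y = y" by (simp add: algebra_simps)
  ultimately show ?thesis by simp
qed (use assms in auto)

section \<open>Translates of unimodular triangles\<close>

text \<open>The unit segments \<open>[0, 1] \<times> {- \<beta>}\<close> and \<open>[0, 1] \<times> {\<alpha>}\<close> are the lowest and the highest one; \<open>A\<close> and \<open>B\<close> are
  the heights of the caps above and below, and \<open>xT\<close>, \<open>xB\<close> the positions of their apices. If a cap is degenerate,
  the row of \<open>S\<close> at its height may be longer than one.\<close>

lemma left_bulge:
  fixes S :: "(real \<times> real) set"
  assumes S: "convex S" and P: "(0, - \<beta>) \<in> S" "(0, \<alpha>) \<in> S" "- \<beta> < \<alpha>"
    and AB: "0 \<le> A" "0 \<le> B" and T: "(xT, \<alpha> + A) \<in> S" "(xB, - \<beta> - B) \<in> S" "0 \<le> xT" "0 \<le> xB"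
    and bd: "\<And>x y. (x, y) \<in> S \<Longrightarrow> - \<beta> - B \<le> y \<and> y \<le> \<alpha> + A"
    and top: "\<And>x. 0 < A \<Longrightarrow> (x, \<alpha>) \<in> S \<Longrightarrow> 0 \<le> x"
    and bot: "\<And>x. 0 < B \<Longrightarrow> (x, - \<beta>) \<in> S \<Longrightarrow> 0 \<le> x"
    and x: "(x, y) \<in> S" "x < 0"
  shows "- \<beta> \<le> y \<and> y \<le> \<alpha> \<and> (- x) * A \<le> xT * (\<alpha> - y) \<and> (- x) * B \<le> xB * (y + \<beta>)"
proof -
  \<comment> \<open>From a higher point the segment to \<open>(0, - \<beta>)\<close> would meet
    height \<open>\<alpha>\<close> at a negative abscissa.\<close>
  have y1: "y \<le> \<alpha>"
  proof (rule ccontr)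
    assume "\<not> y \<le> \<alpha>"
    then have y: "\<alpha> < y" by simp
    then have "0 < A" using bd[OF x(1)] by linarith
    from convex_at_level[OF S P(1) x(1), of \<alpha>] y P(3)
    have "0 \<le> (0 * (y - \<alpha>) + x * (\<alpha> - - \<beta>)) / (y - - \<beta>)"
      by (intro top[OF \<open>0 < A\<close>]) auto
    with x P(3) y show False by (simp add: zero_le_divide_iff zero_le_mult_iff)
  qed
  have y2: "- \<beta> \<le> y"
  proof (rule ccontr)
    assume "\<not> - \<beta> \<le> y"
    then have y: "y < - \<beta>" by simp
    then have "0 < B" using bd[OF x(1)] by linarith
    from convex_at_level[OF S x(1) P(2), of "- \<beta>"] y P(3)
    have "0 \<le> (x * (\<alpha> - - \<beta>) + 0 * (- \<beta> - y)) / (\<alpha> - y)"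
      by (intro bot[OF \<open>0 < B\<close>]) auto
    with x P(3) y show False by (simp add: zero_le_divide_iff zero_le_mult_iff)
  qed
  \<comment> \<open>The segment from the bulge point to the apex of the cap meets height
    \<open>\<alpha>\<close> at a nonnegative abscissa.\<close>
  have 1: "(- x) * A \<le> xT * (\<alpha> - y)"
  proof (cases "A = 0")
    case False
    then have A: "0 < A" using AB by simp
    from convex_at_level[OF S x(1) T(1), of \<alpha>] y1 A
    have "0 \<le> (x * (\<alpha> + A - \<alpha>) + xT * (\<alpha> - y)) / (\<alpha> + A - y)"
      by (intro top[OF A]) auto
    with y1 A show ?thesis by (simp add: zero_le_divide_iff)
  qed (use T y1 in simp)
  have 2: "(- x) * B \<le> xB * (y + \<beta>)"
  proof (cases "B = 0")
    case False
    then have B: "0 < B" using AB by simp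
    from convex_at_level[OF S T(2) x(1), of "- \<beta>"] y2 B
    have "0 \<le> (xB * (y - - \<beta>) + x * (- \<beta> - (- \<beta> - B))) / (y - (- \<beta> - B))"
      by (intro bot[OF B]) auto
    with y2 B show ?thesis by (simp add: zero_le_divide_iff)
  qed (use T y2 in simp)
  from y1 y2 1 2 show ?thesis by blast
qed

lemma right_bulge:
  fixes S :: "(real \<times> real) set"
  assumes S: "convex S" and P: "(1, - \<beta>) \<in> S" "(1, \<alpha>) \<in> S" "- \<beta> < \<alpha>"
    and AB: "0 \<le> A" "0 \<le> B" and T: "(xT, \<alpha> + A) \<in> S" "(xB, - \<beta> - B) \<in> S" "xT \<le> 1" "xB \<le> 1"
    and bd: "\<And>x y. (x, y) \<in> S \<Longrightarrow> - \<beta> - B \<le> y \<and> y \<le> \<alpha> + A"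
    and top: "\<And>x. 0 < A \<Longrightarrow> (x, \<alpha>) \<in> S \<Longrightarrow> x \<le> 1"
    and bot: "\<And>x. 0 < B \<Longrightarrow> (x, - \<beta>) \<in> S \<Longrightarrow> x \<le> 1"
    and x: "(x, y) \<in> S" "1 < x"
  shows "- \<beta> \<le> y \<and> y \<le> \<alpha> \<and> (x - 1) * A \<le> (1 - xT) * (\<alpha> - y) \<and> (x - 1) * B \<le> (1 - xB) * (y + \<beta>)"
proof -
  define S' where "S' = {(x, y). (1 - x, y) \<in> S}"
  have eq: "S' = {(x, y). ((-1) * x + 0 * y + 1, 0 * x + 1 * y + 0) \<in> S}" by (simp add: S'_def)
  have "convex S'" unfolding eq by (intro convex_affine_preimage S)
  then have "- \<beta> \<le> y \<and> y \<le> \<alpha> \<and> (- (1 - x)) * A \<le> (1 - xT) * (\<alpha> - y) \<and> (- (1 - x)) * B \<le> (1 - xB) * (y + \<beta>)"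
    using assms(2-10) x by (intro left_bulge[of S']) (auto simp: S'_def dest: bd top[of "1 - _"] bot[of "1 - _"])
  then show ?thesis by simp
qed

text \<open>Each of the two points lies in the strip or in a bulge. With \<open>H\<close> the total
  height, two points on the inner sides differ by at most
  \<open>1 + f H \<le> 1 + H / 2 < H\<close>; the cases with one or two bulges are the estimates
  above.\<close>

lemma real_core:
  fixes S :: "(real \<times> real) set" and f :: real
  assumes S: "convex S"
    and P: "(0, - \<beta>) \<in> S" "(1, - \<beta>) \<in> S" "(0, \<alpha>) \<in> S" "(1, \<alpha>) \<in> S" "0 < \<alpha> + \<beta>" "\<alpha> + \<beta> < 1"
    and AB: "0 \<le> A" "0 \<le> B" "2 < A + B + (\<alpha> + \<beta>)"
    and T: "(xT, \<alpha> + A) \<in> S" "(xB, - \<beta> - B) \<in> S" "0 \<le> xT" "xT \<le> 1" "0 \<le> xB" "xB \<le> 1"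
    and bd: "\<And>x y. (x, y) \<in> S \<Longrightarrow> - \<beta> - B \<le> y \<and> y \<le> \<alpha> + A"
    and top: "\<And>x. 0 < A \<Longrightarrow> (x, \<alpha>) \<in> S \<Longrightarrow> 0 \<le> x \<and> x \<le> 1"
    and bot: "\<And>x. 0 < B \<Longrightarrow> (x, - \<beta>) \<in> S \<Longrightarrow> 0 \<le> x \<and> x \<le> 1"
    and f: "0 \<le> f" "f \<le> 1 / 2" "f * A \<le> 1 - (\<alpha> + \<beta>)" "f * B \<le> 1 - (\<alpha> + \<beta>)"
    and pq: "(px, py) \<in> S" "(qx, qy) \<in> S"
  shows "(px - f * py) - (qx - f * qy) < A + B + (\<alpha> + \<beta>)"
proof -
  define \<eta> where "\<eta> = \<alpha> + \<beta>"
  have qc: "f * qy - qx \<le> f * (\<alpha> + A)" if "0 \<le> qx"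
  proof -
    have "f * qy \<le> f * (\<alpha> + A)" using f bd[OF pq(2)] by (intro mult_left_mono) auto
    with that show ?thesis by simp
  qed
  have pc: "px - f * py \<le> 1 + f * (\<beta> + B)" if "px \<le> 1"
  proof -
    have "f * (- py) \<le> f * (\<beta> + B)" using f bd[OF pq(1)] by (intro mult_left_mono) auto
    with that show ?thesis by simp
  qed
  show ?thesis
  proof (cases "0 \<le> qx"; cases "px \<le> 1")
    assume "0 \<le> qx" "px \<le> 1"
    have "f * (A + B + \<eta>) \<le> (1 / 2) * (A + B + \<eta>)"
      using f AB P by (intro mult_right_mono) (auto simp: \<eta>_def)
    moreover have "f * (A + B + \<eta>) = f * (\<alpha> + A) + f * (\<beta> + B)"
      by (simp add: \<eta>_def algebra_simps)
    ultimately have 1: "f * (\<alpha> + A) + f * (\<beta> + B) \<le> (1 / 2) * (A + B + \<eta>)"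
      by (simp only:)
    have "(px - f * py) - (qx - f * qy) \<le> 1 + (f * (\<alpha> + A) + f * (\<beta> + B))"
      using qc[OF \<open>0 \<le> qx\<close>] pc[OF \<open>px \<le> 1\<close>] by simp
    also have "\<dots> \<le> 1 + (1 / 2) * (A + B + \<eta>)"
      using 1 by (rule add_left_mono)
    finally have "(px - f * py) - (qx - f * qy) \<le> 1 + (1 / 2) * (A + B + \<eta>)" .
    with AB show ?thesis unfolding \<eta>_def by argo
  next
    assume q: "0 \<le> qx" and "\<not> px \<le> 1"
    then have p: "1 < px" by simp
    have b: "- \<beta> \<le> py \<and> py \<le> \<alpha> \<and> (px - 1) * A \<le> (1 - xT) * (\<alpha> - py) \<and> (px - 1) * B \<le> (1 - xB) * (py + \<beta>)"
      using P pq p T AB top bot bd by (intro right_bulge[OF S]) auto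
    then have "(1 - xT) * (\<alpha> - py) \<le> 1 * (\<alpha> - py)" "(1 - xB) * (py + \<beta>) \<le> 1 * (py + \<beta>)"
      using T by (intro mult_right_mono; auto)+
    then have "1 + (px - 1) + f * (\<alpha> - py) + f * A < B + A + \<eta>"
      using b p P AB f by (intro real_one_bulge) (auto simp: \<eta>_def)
    with qc[OF q] show ?thesis by (simp add: \<eta>_def algebra_simps)
  next
    assume "\<not> 0 \<le> qx" and p: "px \<le> 1"
    then have q: "qx < 0" by simp
    have b: "- \<beta> \<le> qy \<and> qy \<le> \<alpha> \<and> (- qx) * A \<le> xT * (\<alpha> - qy) \<and> (- qx) * B \<le> xB * (qy + \<beta>)"
      using P pq q T AB top bot bd by (intro left_bulge[OF S]) auto
    then have "xT * (\<alpha> - qy) \<le> 1 * (\<alpha> - qy)" "xB * (qy + \<beta>) \<le> 1 * (qy + \<beta>)"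
      using T by (intro mult_right_mono; auto)+
    then have "1 + (- qx) + f * (qy + \<beta>) + f * B < A + B + \<eta>"
      using b q P AB f by (intro real_one_bulge) (auto simp: \<eta>_def)
    with pc[OF p] show ?thesis by (simp add: \<eta>_def algebra_simps)
  next
    assume "\<not> 0 \<le> qx" and "\<not> px \<le> 1"
    then have q: "qx < 0" and p: "1 < px" by auto
    have b: "- \<beta> \<le> qy \<and> qy \<le> \<alpha> \<and> (- qx) * A \<le> xT * (\<alpha> - qy) \<and> (- qx) * B \<le> xB * (qy + \<beta>)"
      using P pq q T AB top bot bd by (intro left_bulge[OF S]) auto
    have b': "- \<beta> \<le> py \<and> py \<le> \<alpha> \<and> (px - 1) * A \<le> (1 - xT) * (\<alpha> - py) \<and> (px - 1) * B \<le> (1 - xB) * (py + \<beta>)"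
      using P pq p T AB top bot bd by (intro right_bulge[OF S]) auto
    have "((- qx) + (px - 1)) * (A + B) \<le> \<eta>"
      by (rule harmonic_bound_two[where x = xT and z = xB and s = "\<alpha> - qy" and r = "qy + \<beta>" and s' = "\<alpha> - py" and r' = "py + \<beta>"])
        (use b b' p q P AB T in \<open>auto simp: \<eta>_def\<close>)
    then have "1 + (- qx) + (px - 1) + f * (qy - py) < A + B + \<eta>"
      using b b' P AB f by (intro real_two_bulges) (auto simp: \<eta>_def)
    then show ?thesis by (simp add: \<eta>_def algebra_simps)
  qed
qed

text \<open>The segment from a bottom corner of the rectangle to a point of the cap must meet height
  \<open>\<alpha>\<close> over \<open>[0, 1]\<close>. Each corner gives one side of the
  strip.\<close>

lemma cap_in_strip:
  fixes S :: "(real \<times> real) set"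
  assumes "convex S" "(c, - \<beta>) \<in> S" "- \<beta> < \<alpha>" "(x, y) \<in> S" "\<alpha> < y"
    and top: "\<And>x. (x, \<alpha>) \<in> S \<Longrightarrow> 0 \<le> x \<and> x \<le> 1"
    and c: "c = 0 \<or> c = 1"
  shows "c = 0 \<Longrightarrow> 0 \<le> x" "c = 1 \<Longrightarrow> x \<le> 1"
proof -
  have *: "0 \<le> (c * (y - \<alpha>) + x * (\<alpha> - - \<beta>)) / (y - - \<beta>) \<and> (c * (y - \<alpha>) + x * (\<alpha> - - \<beta>)) / (y - - \<beta>) \<le> 1"
    using convex_at_level[OF assms(1,2,4), of \<alpha>] assms(3,5) by (intro top) auto
  show "0 \<le> x" if "c = 0"
    using * that assms(3,5) by (simp add: zero_le_divide_iff zero_le_mult_iff)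
  show "x \<le> 1" if "c = 1"
  proof (rule ccontr)
    assume "\<not> x \<le> 1"
    then have "(\<alpha> + \<beta>) < x * (\<alpha> + \<beta>)"
      using mult_strict_right_mono[of 1 x "\<alpha> + \<beta>"] assms(3) by (simp only: mult_1)
    moreover have "y - \<alpha> + x * (\<alpha> + \<beta>) \<le> y + \<beta>"
      using * that assms(3,5) by (simp add: divide_le_eq)
    ultimately show False by argo
  qed
qed

text \<open>The cap contains the triangle over the unit segment with its apex. If both alternatives
  fail, the chord of this triangle at height \<open>g\<close> already covers \<open>f\<close>,
  wherever in \<open>[0, 1]\<close> the apex lies.\<close>

lemma unit_rows_chord:
  fixes S :: "(real \<times> real) set"
  assumes S: "convex S" and P: "(0, \<alpha>) \<in> S" "(1, \<alpha>) \<in> S"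
    and T: "(xT, \<alpha> + A) \<in> S" "0 \<le> xT" "xT \<le> 1" and A: "0 \<le> A" and g: "0 \<le> g"
    and f: "0 \<le> f" "f \<le> 1" and F: "(f, \<alpha> + g) \<notin> S"
  shows "f * A \<le> g \<or> (1 - f) * A \<le> g"
proof (rule ccontr)
  assume "\<not> ?thesis"
  then have 1: "g < f * A" "g < (1 - f) * A" by auto
  have "f * A \<le> 1 * A" using f A by (intro mult_right_mono) auto
  with 1 g have A: "0 < A" "g < A" by auto
  have "((0 * (\<alpha> + A - (\<alpha> + g)) + xT * (\<alpha> + g - \<alpha>)) / (\<alpha> + A - \<alpha>), \<alpha> + g) \<in> S"
    by (rule convex_at_level[OF S P(1) T(1)]) (use A g in auto)
  moreover have "((1 * (\<alpha> + A - (\<alpha> + g)) + xT * (\<alpha> + g - \<alpha>)) / (\<alpha> + A - \<alpha>), \<alpha> + g) \<in> S"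
    by (rule convex_at_level[OF S P(2) T(1)]) (use A g in auto)
  moreover have xg: "xT * g \<le> g" "0 \<le> xT * g"
    using mult_right_mono[OF T(3) g] mult_nonneg_nonneg[OF T(2) g] by (simp_all only: mult_1)
  moreover have "xT * g / A \<le> f"
    using 1 xg by (subst pos_divide_le_eq[OF A(1)]) linarith
  moreover have "f \<le> (A - g + xT * g) / A"
    using 1 xg by (subst pos_le_divide_eq[OF A(1)]) (simp add: left_diff_distrib)
  ultimately have "(f, \<alpha> + g) \<in> S"
    using convex_row[OF S, of "xT * g / A" _ "(A - g + xT * g) / A"] by simp
  with F show False by simp
qed

text \<open>The lattice is generated by \<open>(1, 0)\<close> and \<open>(f, 1)\<close>: the points excluded by \<open>F\<close> are the only possible apices
  in the strip of unimodular triangles over the two unit segments, and \<open>x - f y\<close> and \<open>x + (1 - f) y\<close> are integral.\<close>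

lemma real_sheared:
  fixes S :: "(real \<times> real) set" and f :: real
  assumes S: "convex S"
    and P: "(0, - \<beta>) \<in> S" "(1, - \<beta>) \<in> S" "(0, \<alpha>) \<in> S" "(1, \<alpha>) \<in> S" "0 < \<alpha> + \<beta>"
    and AB: "0 \<le> A" "0 \<le> B" "2 < A + B + (\<alpha> + \<beta>)"
    and T: "(t, \<alpha> + A) \<in> S" "(b, - \<beta> - B) \<in> S"
    and bd: "\<And>x y. (x, y) \<in> S \<Longrightarrow> - \<beta> - B \<le> y \<and> y \<le> \<alpha> + A"
    and top: "\<And>x. 0 < A \<Longrightarrow> (x, \<alpha>) \<in> S \<Longrightarrow> 0 \<le> x \<and> x \<le> 1"
    and bot: "\<And>x. 0 < B \<Longrightarrow> (x, - \<beta>) \<in> S \<Longrightarrow> 0 \<le> x \<and> x \<le> 1"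
    and f: "0 \<le> f" "f \<le> 1"
    and F: "(f, 1 - \<beta>) \<notin> S" "(1 - f, \<alpha> - 1) \<notin> S"
    and pq: "(px, py) \<in> S" "(qx, qy) \<in> S" "A + B + (\<alpha> + \<beta>) \<le> (px - f * py) - (qx - f * qy)"
    and pq': "(px', py') \<in> S" "(qx', qy') \<in> S"
      "A + B + (\<alpha> + \<beta>) \<le> (px' + (1 - f) * py') - (qx' + (1 - f) * qy')"
  shows False
proof -
  define M where "M = {(x, y). (x, - y) \<in> S}"
  have "M = {(x, y). (1 * x + 0 * y + 0, 0 * x + (-1) * y + 0) \<in> S}" by (simp add: M_def)
  then have M: "convex M" by (simp only: convex_affine_preimage[OF S])
  define N where "N = {(x, y). (1 - x, y) \<in> S}"
  have "N = {(x, y). ((-1) * x + 0 * y + 1, 0 * x + 1 * y + 0) \<in> S}" by (simp add: N_def)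
  then have N: "convex N" by (simp only: convex_affine_preimage[OF S])
  \<comment> \<open>Otherwise the rectangle reaches height \<open>1 - \<beta>\<close> and contains
    the excluded point \<open>(f, 1 - \<beta>)\<close>.\<close>
  have \<eta>: "\<alpha> + \<beta> < 1"
  proof (rule ccontr)
    assume "\<not> \<alpha> + \<beta> < 1"
    then have l: "- \<beta> \<le> 1 - \<beta>" "1 - \<beta> \<le> \<alpha>" "- \<beta> < \<alpha>" by auto
    have "(\<alpha> - (1 - \<beta>) + (1 - \<beta> - - \<beta>)) / (\<alpha> - - \<beta>) = 1"
      using l by simp
    then have "(0, 1 - \<beta>) \<in> S" "(1, 1 - \<beta>) \<in> S"
      using convex_at_level[OF S P(1) P(3) l] convex_at_level[OF S P(2) P(4) l] by simp_all
    then have "(f, 1 - \<beta>) \<in> S" using f by (rule convex_row[OF S])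
    with F show False by simp
  qed
  \<comment> \<open>A degenerate cap gets the corner \<open>(0, \<alpha>)\<close> of the rectangle
    as its apex.\<close>
  obtain xT where xT: "(xT, \<alpha> + A) \<in> S" "0 \<le> xT" "xT \<le> 1"
  proof (cases "A = 0")
    case True
    with P show ?thesis by (intro that[of 0]) auto
  next
    case False
    with AB have "0 < A" by simp
    note c = top[OF \<open>0 < A\<close>]
    have "0 \<le> t"
      by (rule cap_in_strip(1)[OF S P(1) _ T(1) _ c]) (use P(5) \<open>0 < A\<close> in auto)
    moreover have "t \<le> 1"
      by (rule cap_in_strip(2)[OF S P(2) _ T(1) _ c]) (use P(5) \<open>0 < A\<close> in auto)
    ultimately show ?thesis using T(1) that by blast
  qed
  obtain xB where xB: "(xB, - \<beta> - B) \<in> S" "0 \<le> xB" "xB \<le> 1"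
  proof (cases "B = 0")
    case True
    with P show ?thesis by (intro that[of 0]) auto
  next
    case False
    with AB have "0 < B" by simp
    have c: "0 \<le> x \<and> x \<le> 1" if "(x, \<beta>) \<in> M" for x
      using bot[OF \<open>0 < B\<close>, of x] that by (simp add: M_def)
    have m: "(0, - \<alpha>) \<in> M" "(1, - \<alpha>) \<in> M" "(b, \<beta> + B) \<in> M"
      using P T by (auto simp: M_def)
    have "0 \<le> b"
      by (rule cap_in_strip(1)[OF M m(1) _ m(3) _ c]) (use P(5) \<open>0 < B\<close> in auto)
    moreover have "b \<le> 1"
      by (rule cap_in_strip(2)[OF M m(2) _ m(3) _ c]) (use P(5) \<open>0 < B\<close> in auto)
    ultimately show ?thesis using T(2) that by blast
  qed
  define g where "g = 1 - (\<alpha> + \<beta>)"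
  have g: "0 \<le> g" using \<eta> by (simp add: g_def)
  have A: "f * A \<le> g \<or> (1 - f) * A \<le> g"
    using F f g xT P AB by (intro unit_rows_chord[OF S, of \<alpha> xT]) (auto simp: g_def)
  have B: "(1 - f) * B \<le> g \<or> (1 - (1 - f)) * B \<le> g"
    using F f g xB P AB by (intro unit_rows_chord[OF M, of \<beta> xB]) (auto simp: g_def M_def)
  \<comment> \<open>The smaller of \<open>f\<close> and \<open>1 - f\<close> satisfies both cap
    bounds. It selects the direction \<open>x - f y\<close>, or after reflection
    \<open>x + (1 - f) y\<close>.\<close>
  show False
  proof (cases "f \<le> 1 / 2")
    case True
    have "f * A \<le> (1 - f) * A" "f * B \<le> (1 - f) * B"
      using True AB by (auto intro!: mult_right_mono)
    then have "f * A \<le> g" "f * B \<le> g" using A B by auto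
    then have "(px - f * py) - (qx - f * qy) < A + B + (\<alpha> + \<beta>)"
      by (intro real_core[OF S P \<eta> AB xT(1) xB(1)]) (use True f xT xB bd top bot pq in \<open>auto simp: g_def\<close>)
    with pq show False by simp
  next
    case False
    have "(1 - f) * A \<le> f * A" "(1 - f) * B \<le> f * B"
      using False AB by (auto intro!: mult_right_mono)
    then have fg: "(1 - f) * A \<le> g" "(1 - f) * B \<le> g" using A B by auto
    have inN: "(x, y) \<in> N \<longleftrightarrow> (1 - x, y) \<in> S" for x y by (simp add: N_def)
    have "((1 - qx') - (1 - f) * qy') - ((1 - px') - (1 - f) * py') < A + B + (\<alpha> + \<beta>)"
    proof (rule real_core[OF N])
      show "(1 - xT, \<alpha> + A) \<in> N" "(1 - xB, - \<beta> - B) \<in> N" "0 \<le> 1 - xT" "1 - xT \<le> 1" "0 \<le> 1 - xB" "1 - xB \<le> 1"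
        using xT xB by (auto simp: inN)
      show "0 \<le> x \<and> x \<le> 1" if "0 < A" "(x, \<alpha>) \<in> N" for x
        using top[of "1 - x"] that by (auto simp: inN)
      show "0 \<le> x \<and> x \<le> 1" if "0 < B" "(x, - \<beta>) \<in> N" for x
        using bot[of "1 - x"] that by (auto simp: inN)
      show "- \<beta> - B \<le> y \<and> y \<le> \<alpha> + A" if "(x, y) \<in> N" for x y
        using bd[of "1 - x"] that by (auto simp: inN)
      show "(1 - qx', qy') \<in> N" "(1 - px', py') \<in> N" "(0, - \<beta>) \<in> N" "(1, - \<beta>) \<in> N" "(0, \<alpha>) \<in> N" "(1, \<alpha>) \<in> N"
        using pq' P by (auto simp: inN)
      show "(1 - f) * A \<le> 1 - (\<alpha> + \<beta>)" "(1 - f) * B \<le> 1 - (\<alpha> + \<beta>)"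
        using fg by (auto simp: g_def)
    qed (use False f P(5) AB \<eta> in auto)
    with pq'(3) show False by argo
  qed
qed

section \<open>Long rows and extremal unit segments\<close>

lemma long_row:
  fixes S :: "(real \<times> real) set"
  assumes S: "convex S" "compact S" and TB: "T \<in> S" "U \<in> S" "2 < snd T - snd U"
    and bd: "\<And>P. P \<in> S \<Longrightarrow> snd U \<le> snd P \<and> snd P \<le> snd T"
    and wide: "\<And>k::int. \<exists>P\<in>S. \<exists>Q\<in>S. snd T - snd U \<le> (fst P - fst Q) + of_int k * (snd P - snd Q)"
  obtains p p' l where "(p, l) \<in> S" "(p', l) \<in> S" "1 < p' - p"
proof -
  define H where "H = snd T - snd U"
  \<comment> \<open>Any positive value with \<open>1 + e + H / 2 < H\<close> would serve; it makes
    the common row longer than one.\<close>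
  define e where "e = (H - 2) / 4"
  have e: "0 < e" "1 + e + H / 2 < H" using TB(3) unfolding e_def H_def by argo+
  define S' where "S' = (\<lambda>P. (1 + e, 0) + P) ` S"
  show ?thesis
  proof (cases "S \<inter> S' = {}")
    case False
    then obtain P where P: "P \<in> S" "(1 + e, 0) + P \<in> S" by (auto simp: S'_def)
    obtain x y where xy: "P = (x, y)" by (cases P)
    from P have "(x, y) \<in> S" "(1 + e + x, y) \<in> S" unfolding xy by auto
    then show ?thesis using e that by force
  next
    case True
    have "convex S'" unfolding S'_def using S by (intro convex_translation)
    moreover have "S \<noteq> {}" "S' \<noteq> {}" using TB by (auto simp: S'_def)
    ultimately obtain a b where ab: "a \<noteq> 0" "\<forall>x\<in>S. inner a x \<le> b" "\<forall>x\<in>S'. inner a x \<ge> b"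
      using separating_hyperplane_sets[OF S(1) _ _ _ True] by blast
    obtain a1 a2 where a: "a = (a1, a2)" by (cases a)
    have sep: "a1 * fst P + a2 * snd P \<le> a1 * (1 + e) + a1 * fst Q + a2 * snd Q" if "P \<in> S" "Q \<in> S" for P Q
    proof -
      have "inner a P \<le> b" using ab(2) that by blast
      also have "b \<le> inner a ((1 + e, 0) + Q)" using ab(3) that by (auto simp: S'_def)
      finally show ?thesis by (cases P; cases Q) (simp add: a algebra_simps)
    qed
    \<comment> \<open>A horizontal separating line is impossible: the translation is horizontal and
      \<open>S\<close> has positive height.\<close>
    have a1: "0 < a1"
    proof (rule ccontr)
      assume "\<not> 0 < a1"
      moreover have "0 \<le> a1 * (1 + e)" using sep[OF TB(1) TB(1)] by simp
      ultimately have a1: "a1 = 0" using e by (simp add: zero_le_mult_iff)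
      have "a2 * snd T \<le> a2 * snd U" "a2 * snd U \<le> a2 * snd T" using sep[OF TB(1,2)] sep[OF TB(2,1)] a1 by auto
      then have "a2 = 0" using TB(3) by simp
      with a1 ab(1) show False by (simp add: a zero_prod_def)
    qed
    define \<mu> where "\<mu> = a2 / a1"
    have sep': "(fst P - fst Q) + \<mu> * (snd P - snd Q) \<le> 1 + e" if "P \<in> S" "Q \<in> S" for P Q
    proof -
      have "a1 * ((fst P - fst Q) + \<mu> * (snd P - snd Q)) = a1 * fst P + a2 * snd P - (a1 * fst Q + a2 * snd Q)"
        using a1 by (simp add: \<mu>_def algebra_simps)
      also have "\<dots> \<le> a1 * (1 + e)" using sep[OF that] by simp
      finally show ?thesis using a1 by (rule mult_left_le_imp_le)
    qed
    \<comment> \<open>Rounding the slope costs at most half of the height, so an integral direction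
      would be narrower than \<open>H\<close>.\<close>
    define k where "k = round \<mu>"
    obtain P Q where PQ: "P \<in> S" "Q \<in> S" "H \<le> (fst P - fst Q) + of_int k * (snd P - snd Q)"
      using wide[of k] unfolding H_def by blast
    have "(of_int k - \<mu>) * (snd P - snd Q) \<le> \<bar>of_int k - \<mu>\<bar> * \<bar>snd P - snd Q\<bar>"
      by (metis abs_ge_self abs_mult)
    also have "\<dots> \<le> (1 / 2) * H"
      using of_int_round_abs_le[of \<mu>] bd[OF PQ(1)] bd[OF PQ(2)]
      by (intro mult_mono) (auto simp: k_def H_def)
    finally have "(of_int k - \<mu>) * (snd P - snd Q) \<le> H / 2" by simp
    moreover have "(fst P - fst Q) + of_int k * (snd P - snd Q) =
        ((fst P - fst Q) + \<mu> * (snd P - snd Q)) + (of_int k - \<mu>) * (snd P - snd Q)"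
      by (simp add: algebra_simps)
    ultimately have "H \<le> 1 + e + H / 2"
      using sep'[OF PQ(1,2)] PQ(3) by linarith
    with e show ?thesis by simp
  qed
qed

text \<open>Contracting the long row towards \<open>(z, y)\<close> until its length is one. A row
  longer than one therefore cannot be extremal when the body goes on beyond it.\<close>

lemma unit_row_near_long_row:
  fixes S :: "(real \<times> real) set"
  assumes S: "convex S" and "(p, l) \<in> S" "(p', l) \<in> S" "1 < p' - p" "(z, y) \<in> S"
  obtains q t where "0 < t" "t < 1" "(q, l + t * (y - l)) \<in> S" "(q + 1, l + t * (y - l)) \<in> S"
proof -
  define t where "t = 1 - 1 / (p' - p)"
  have t: "0 < t" "t < 1" using assms by (auto simp: t_def)
  have "(1 - t) * (p' - p) = 1" using assms by (simp add: t_def)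
  then have e: "(1 - t) * p' = (1 - t) * p + 1" by (simp add: algebra_simps)
  have "(1 - t) *\<^sub>R (p, l) + t *\<^sub>R (z, y) \<in> S" "(1 - t) *\<^sub>R (p', l) + t *\<^sub>R (z, y) \<in> S"
    using assms t by (intro convexD[OF S]; simp)+
  moreover have "(1 - t) * l + t * y = l + t * (y - l)" by (simp add: algebra_simps)
  ultimately have "((1 - t) * p + t * z, l + t * (y - l)) \<in> S" "((1 - t) * p + t * z + 1, l + t * (y - l)) \<in> S"
    by (auto simp: e add.commute add.left_commute)
  with t show ?thesis by (intro that)
qed

text \<open>Only the vertices are recorded; for convex \<open>S\<close> this means a real translate
  of a unimodular triangle.\<close>

definition real_triangle :: "(real \<times> real) set \<Rightarrow> bool" where
  "real_triangle S \<longleftrightarrow> (\<exists>x y. \<exists>a b c d :: int. \<bar>a * d - b * c\<bar> = 1 \<and> (x, y) \<in> S \<and>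
     (x + of_int a, y + of_int b) \<in> S \<and> (x + of_int c, y + of_int d) \<in> S)"

lemma real_triangle_minimal_width:
  fixes S :: "(real \<times> real) set"
  assumes S: "convex S" "compact S" and TB: "T \<in> S" "U \<in> S" "2 < snd T - snd U"
    and bd: "\<And>P. P \<in> S \<Longrightarrow> snd U \<le> snd P \<and> snd P \<le> snd T"
    and wide: "\<And>k::int. \<exists>P\<in>S. \<exists>Q\<in>S. snd T - snd U \<le> (fst P - fst Q) + of_int k * (snd P - snd Q)"
  shows "real_triangle S"
proof (rule ccontr)
  assume free: "\<not> real_triangle S"
  obtain p p' l where row: "(p, l) \<in> S" "(p', l) \<in> S" "1 < p' - p"
    using long_row[OF S TB bd wide] .
  \<comment> \<open>The left endpoints of the horizontal unit segments in \<open>S\<close>.\<close>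
  define Q where "Q = S \<inter> (\<lambda>P. (-1, 0) + P) ` S"
  have inQ: "(x, y) \<in> Q \<longleftrightarrow> (x, y) \<in> S \<and> (x + 1, y) \<in> S" for x y
  proof -
    have "(x, y) \<in> (\<lambda>P. (-1, 0) + P) ` S \<longleftrightarrow> (x + 1, y) \<in> S"
      by (force simp: image_iff)
    then show ?thesis by (simp add: Q_def)
  qed
  have "compact Q" unfolding Q_def
    using S compact_translation by (intro compact_Int) auto
  moreover have near: "\<exists>q t. 0 < t \<and> t < 1 \<and> (q, l + t * (snd Z - l)) \<in> Q"
    if "(p, l) \<in> S" "(p', l) \<in> S" "1 < p' - p" "Z \<in> S" for p p' l Z
    using unit_row_near_long_row[OF S(1) that(1-3), of "fst Z" "snd Z"] that(4) unfolding inQ by (metis prod.collapse)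
  then have "Q \<noteq> {}" using row TB(1) by fast
  moreover have "continuous_on Q snd" by (intro continuous_intros)
  ultimately obtain L M where L: "L \<in> Q" "\<And>P. P \<in> Q \<Longrightarrow> snd L \<le> snd P" and M: "M \<in> Q" "\<And>P. P \<in> Q \<Longrightarrow> snd P \<le> snd M"
    using continuous_attains_inf[of Q snd] continuous_attains_sup[of Q snd] by metis
  obtain P1 \<beta> where P1: "L = (P1, - \<beta>)" by (metis add.inverse_inverse surj_pair)
  obtain P2 \<alpha> where P2: "M = (P2, \<alpha>)" by (metis surj_pair)
  \<comment> \<open>The long row contains a unit segment, and contracting it towards a point
    \<open>Z\<close> at another height gives one at a second height.\<close>
  have \<eta>: "0 < \<alpha> + \<beta>"
  proof -
    have "snd T \<noteq> l \<or> snd U \<noteq> l" using TB by auto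
    then obtain Z where Z: "Z \<in> S" "snd Z \<noteq> l" using TB by blast
    obtain q t where q: "0 < t" "t < 1" "(q, l + t * (snd Z - l)) \<in> Q" using near[OF row Z(1)] by blast
    have "(p, l) \<in> Q" using row by (auto simp: inQ intro: convex_row[OF S(1) row(1,2)])
    then have "- \<beta> \<le> l" "l \<le> \<alpha>" using L M P1 P2 by force+
    moreover have "- \<beta> \<le> l + t * (snd Z - l)" "l + t * (snd Z - l) \<le> \<alpha>" using L(2)[OF q(3)] M(2)[OF q(3)] P1 P2 by auto
    moreover have "t * (snd Z - l) \<noteq> 0" using q Z by simp
    ultimately show ?thesis by linarith
  qed
  have inS: "(P1, - \<beta>) \<in> S" "(P1 + 1, - \<beta>) \<in> S" "(P2, \<alpha>) \<in> S" "(P2 + 1, \<alpha>) \<in> S"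
    using L(1) M(1) by (auto simp: P1 P2 inQ)
  define A where "A = snd T - \<alpha>"
  define B where "B = - \<beta> - snd U"
  have AB: "0 \<le> A" "0 \<le> B" "A + B + (\<alpha> + \<beta>) = snd T - snd U"
    using bd[OF inS(1)] bd[OF inS(3)] by (auto simp: A_def B_def)
  \<comment> \<open>A longer row at height \<open>\<alpha>\<close> could be contracted towards
    \<open>T\<close>, giving a higher unit segment.\<close>
  have topS: "P2 \<le> x \<and> x \<le> P2 + 1" if "0 < A" "(x, \<alpha>) \<in> S" for x
  proof (rule ccontr)
    assume "\<not> ?thesis"
    then have "\<exists>u v. (u, \<alpha>) \<in> S \<and> (v, \<alpha>) \<in> S \<and> 1 < v - u"
      using that(2) inS by (cases "x < P2") (intro exI[of _ x] exI[of _ "P2 + 1"], simp, intro exI[of _ P2] exI[of _ x], simp)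
    then obtain u v where "(u, \<alpha>) \<in> S" "(v, \<alpha>) \<in> S" "1 < v - u" by blast
    from near[OF this TB(1)] obtain q t where "0 < t" "(q, \<alpha> + t * (snd T - \<alpha>)) \<in> Q" by blast
    with M(2) have "t * A \<le> 0" unfolding P2 A_def by force
    with \<open>0 < t\<close> that show False by (simp add: mult_le_0_iff)
  qed
  have botS: "P1 \<le> x \<and> x \<le> P1 + 1" if "0 < B" "(x, - \<beta>) \<in> S" for x
  proof (rule ccontr)
    assume "\<not> ?thesis"
    then have "\<exists>u v. (u, - \<beta>) \<in> S \<and> (v, - \<beta>) \<in> S \<and> 1 < v - u"
      using that(2) inS by (cases "x < P1") (intro exI[of _ x] exI[of _ "P1 + 1"], simp, intro exI[of _ P1] exI[of _ x], simp)
    then obtain u v where "(u, - \<beta>) \<in> S" "(v, - \<beta>) \<in> S" "1 < v - u" by blast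
    from near[OF this TB(2)] obtain q t where "0 < t" "(q, - \<beta> + t * (snd U - - \<beta>)) \<in> Q" by blast
    with L(2) have "0 \<le> t * (- B)" unfolding P1 B_def by force
    with \<open>0 < t\<close> that show False by (simp add: mult_le_0_iff)
  qed
  \<comment> \<open>Shearing by \<open>\<kappa>\<close> turns the parallelogram of the two unit
    segments into a rectangle; the lattice vector \<open>(k, 1)\<close> becomes
    \<open>(f, 1)\<close>.\<close>
  define \<kappa> where "\<kappa> = (P2 - P1) / (\<alpha> + \<beta>)"
  have \<kappa>: "\<kappa> * (\<alpha> + \<beta>) = P2 - P1" using \<eta> by (simp add: \<kappa>_def)
  define k where "k = \<lceil>\<kappa>\<rceil>"
  define f where "f = of_int k - \<kappa>"
  have f: "0 \<le> f" "f \<le> 1" unfolding f_def k_def by linarith+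
  define S' where "S' = {(x, y). (1 * x + \<kappa> * y + (P1 + \<kappa> * \<beta>), 0 * x + 1 * y + 0) \<in> S}"
  have S': "convex S'" unfolding S'_def by (rule convex_affine_preimage[OF S(1)])
  have inS': "(x, y) \<in> S' \<longleftrightarrow> (x + \<kappa> * y + (P1 + \<kappa> * \<beta>), y) \<in> S" for x y
    by (simp add: S'_def)
  have sS': "(x - \<kappa> * y - (P1 + \<kappa> * \<beta>), y) \<in> S'" if "(x, y) \<in> S" for x y
    using that by (simp add: inS')
  have \<kappa>': "x + \<kappa> * \<alpha> + (P1 + \<kappa> * \<beta>) = x + P2" for x
    using \<kappa> by (simp add: algebra_simps)
  have notri: "\<not> ((x, y) \<in> S \<and> (x + of_int a, y + of_int b) \<in> S \<and> (x + of_int c, y + of_int d) \<in> S)"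
    if "\<bar>a * d - b * c\<bar> = 1" for x y and a b c d :: int
    using free that unfolding real_triangle_def by blast
  show False
  proof -
    \<comment> \<open>In the sheared coordinates the directions \<open>x - k y\<close> and
      \<open>x + (1 - k) y\<close> read \<open>x - f y\<close> and
      \<open>x + (1 - f) y\<close>.\<close>
    obtain P Q where PQ: "P \<in> S" "Q \<in> S" "snd T - snd U \<le> (fst P - fst Q) + of_int (- k) * (snd P - snd Q)"
      using wide[of "- k"] by blast
    obtain P' Q' where PQ': "P' \<in> S" "Q' \<in> S" "snd T - snd U \<le> (fst P' - fst Q') + of_int (1 - k) * (snd P' - snd Q')"
      using wide[of "1 - k"] by blast
    let ?s = "\<lambda>P. fst P - \<kappa> * snd P - (P1 + \<kappa> * \<beta>)"
    show False
    proof (rule real_sheared[OF S', where \<alpha> = \<alpha> and \<beta> = \<beta> and A = A and B = B and f = f])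
      show "(0, - \<beta>) \<in> S'" "(1, - \<beta>) \<in> S'" using inS by (auto simp: inS' add.commute)
      show "(0, \<alpha>) \<in> S'" "(1, \<alpha>) \<in> S'" using inS unfolding inS' \<kappa>' by (auto simp: add.commute)
      show "(?s T, \<alpha> + A) \<in> S'" "(?s U, - \<beta> - B) \<in> S'"
        using sS'[of "fst T" "snd T"] sS'[of "fst U" "snd U"] TB by (auto simp: A_def B_def)
      show "- \<beta> - B \<le> y \<and> y \<le> \<alpha> + A" if "(x, y) \<in> S'" for x y
        using bd that unfolding inS' A_def B_def by force
      show "0 \<le> x \<and> x \<le> 1" if "0 < A" "(x, \<alpha>) \<in> S'" for x
        using topS[OF that(1), of "x + P2"] that(2) by (simp add: inS' \<kappa>')
      show "0 \<le> x \<and> x \<le> 1" if "0 < B" "(x, - \<beta>) \<in> S'" for x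
        using botS[OF that(1), of "x + P1"] that(2) by (simp add: inS')
      show "(f, 1 - \<beta>) \<notin> S'"
        using notri[of 1 1 0 k P1 "- \<beta>"] inS by (simp add: inS' f_def algebra_simps)
      show "(1 - f, \<alpha> - 1) \<notin> S'"
      proof -
        have "1 - f + \<kappa> * (\<alpha> - 1) + (P1 + \<kappa> * \<beta>) = P2 + of_int (1 - k)"
          using \<kappa>'[of 0] by (simp add: f_def algebra_simps)
        moreover have "(P2 + of_int (1 - k), \<alpha> - 1) \<notin> S"
          using notri[where a = 1 and b = 0 and c = "1 - k" and d = "-1" and x = P2 and y = \<alpha>] inS by simp
        ultimately show ?thesis unfolding inS' by (simp only: not_False_eq_True)
      qed
      show "(?s P, snd P) \<in> S'" "(?s Q, snd Q) \<in> S'" "(?s P', snd P') \<in> S'" "(?s Q', snd Q') \<in> S'"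
        using sS'[of "fst P" "snd P"] sS'[of "fst Q" "snd Q"] sS'[of "fst P'" "snd P'"] sS'[of "fst Q'" "snd Q'"] PQ PQ' by auto
      show "A + B + (\<alpha> + \<beta>) \<le> (?s P - f * snd P) - (?s Q - f * snd Q)"
        using PQ(3) unfolding AB(3) by (simp add: f_def algebra_simps)
      show "A + B + (\<alpha> + \<beta>) \<le> (?s P' + (1 - f) * snd P') - (?s Q' + (1 - f) * snd Q')"
        using PQ'(3) unfolding AB(3) by (simp add: f_def algebra_simps)
    qed (use \<eta> AB TB(3) f in auto)
  qed
qed

section \<open>Estimates for lattice-pinched bodies\<close>

text \<open>These are the numerical estimates for the locale \<open>pinched\<close> below. \<open>\<sigma>\<close> is the slope of the right boundary line when
  one cap leans to the right; \<open>r = 1 + y\<close> for a bulge at height \<open>y\<close>.\<close>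

lemma even_lean_small:
  fixes A B m v xT xB \<sigma> :: real
  assumes "0 < A" "0 < B" "4 / 3 < A + B" "0 \<le> \<sigma>" "xT \<le> 1 + \<sigma> * A" "xB \<le> 1 - \<sigma> * (2 + B)"
    and m: "m * A \<le> xT * (1 - v)" "m * B \<le> xB * (1 + v)" "- 1 \<le> v" "v \<le> 1"
    and "\<sigma> * A \<le> 1 / 3"
  shows "1 + \<sigma> * A + m \<le> 10 / 3"
proof -
  have "0 \<le> \<sigma> * A" "0 \<le> \<sigma> * (2 + B)" using assms by simp_all
  then have "xB \<le> 1 + \<sigma> * A" using assms by linarith
  have "xT * (1 - v) \<le> (1 + \<sigma> * A) * (1 - v)" "xB * (1 + v) \<le> (1 + \<sigma> * A) * (1 + v)"
    using assms \<open>xB \<le> 1 + \<sigma> * A\<close> by (intro mult_right_mono; linarith)+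
  moreover have "(1 + \<sigma> * A) * (1 - v) + (1 + \<sigma> * A) * (1 + v) = 2 * (1 + \<sigma> * A)"
    by (simp add: algebra_simps)
  ultimately have mh: "m * (A + B) \<le> 2 * (1 + \<sigma> * A)"
    using m unfolding distrib_left by linarith
  \<comment> \<open>The width is then at most \<open>5 / 2 * (1 + \<sigma> * A)\<close>, which
    equals \<open>10 / 3\<close> at the threshold \<open>\<sigma> * A = 1 / 3\<close>.\<close>
  have "m \<le> 3 / 2 * (1 + \<sigma> * A)"
  proof (cases "0 \<le> m")
    case True
    then have "m * (4 / 3) \<le> m * (A + B)" using assms by (intro mult_left_mono) auto
    with mh show ?thesis by linarith
  next
    case False
    with \<open>0 \<le> \<sigma> * A\<close> show ?thesis by argo
  qed
  with \<open>\<sigma> * A \<le> 1 / 3\<close> show ?thesis by argo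
qed

text \<open>For the direction \<open>x - y\<close>: \<open>m + r - 1\<close> comes from the left
  bulge, \<open>(1 - \<sigma>) * (2 + B)\<close> from the right boundary line at the lowest height.
  A large lean forces \<open>\<sigma> \<ge> 1 / 4\<close>, and this makes
  \<open>(1 - \<sigma>) * B\<close> at most \<open>3 / 10\<close>.\<close>

lemma even_lean_large:
  fixes A B m r xT xB \<sigma> :: real
  assumes AB: "0 < A" "0 < B" "4 / 3 < A + B" "0 \<le> \<sigma>" "xT \<le> 1 + \<sigma> * A" "xB \<le> 1 - \<sigma> * (2 + B)"
    and m: "0 \<le> m" "0 \<le> r" "r \<le> 2" "m * A \<le> xT * (2 - r)" "m * B \<le> xB * r"
    and "A \<le> xT" "B \<le> xB" and \<sigma>A: "1 / 3 < \<sigma> * A"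
  shows "m + r - 1 + (1 - \<sigma>) * (2 + B) \<le> 10 / 3"
proof -
  define h where "h = A + B"
  define x where "x = 1 + \<sigma> * A"
  have h: "4 / 3 < h" using AB by (simp add: h_def)
  have x: "1 < x" "A \<le> x" using assms by (auto simp: x_def)
  have B1: "B + \<sigma> * B \<le> 1 - 2 * \<sigma>" using assms by (simp add: algebra_simps)
  moreover have "0 \<le> \<sigma> * B" using AB by simp
  ultimately have \<sigma>: "\<sigma> < 1 / 2" using AB by linarith
  have "\<sigma> * (A * (1 - \<sigma>)) \<le> \<sigma> * 1"
    using assms by (intro mult_left_mono) (auto simp: algebra_simps)
  moreover have "(1 / 3) * (1 - \<sigma>) \<le> (\<sigma> * A) * (1 - \<sigma>)"
    using \<sigma>A \<sigma> by (intro mult_right_mono) auto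
  ultimately have "(1 / 3) * (1 - \<sigma>) \<le> \<sigma> * 1" unfolding mult.assoc by (rule order_trans[rotated])
  then have \<sigma>': "1 \<le> 4 * \<sigma>" by argo
  have "0 \<le> (4 * \<sigma> - 1) * (7 - 5 * \<sigma>)" using \<sigma> \<sigma>' by simp
  then have q: "10 * ((1 - \<sigma>) * (1 - 2 * \<sigma>)) \<le> 3 * (1 + \<sigma>)"
    by (simp add: algebra_simps)
  have "(1 - \<sigma>) * (B * (1 + \<sigma>)) \<le> (1 - \<sigma>) * (1 - 2 * \<sigma>)"
    using B1 \<sigma> by (intro mult_left_mono) (auto simp: algebra_simps)
  with q have "10 * ((1 - \<sigma>) * (B * (1 + \<sigma>))) \<le> 3 * (1 + \<sigma>)" by linarith
  then have "(10 * ((1 - \<sigma>) * B)) * (1 + \<sigma>) \<le> 3 * (1 + \<sigma>)" by (simp only: mult.assoc)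
  then have \<sigma>B: "10 * ((1 - \<sigma>) * B) \<le> 3"
    by (rule mult_right_le_imp_le) (use AB in simp)
  have "0 \<le> \<sigma> * (2 + B)" using AB by simp
  then have "xT \<le> x" "xB \<le> x" using AB x unfolding x_def by linarith+
  then have "xT * (2 - r) \<le> x * (2 - r)" "xB * r \<le> x * r"
    using m by (intro mult_right_mono; simp)+
  then have mx: "m * A \<le> x * (2 - r)" "m * B \<le> x * r" using m by auto
  then have mh: "m * h \<le> 2 * x" by (simp add: h_def algebra_simps)
  \<comment> \<open>The bound from the top cap eliminates \<open>r\<close>, and then
    \<open>m * h \<le> 2 * x\<close> eliminates \<open>m\<close>.\<close>
  have "(m + r) * x \<le> m * (x - A) + 2 * x"
    using mx(1) by (simp add: algebra_simps)
  then have "(m + r) * x * h \<le> (m * (x - A) + 2 * x) * h"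
    using h by (intro mult_right_mono) auto
  also have "\<dots> = (m * h) * (x - A) + 2 * x * h" by (simp add: algebra_simps)
  also have "\<dots> \<le> (2 * x) * (x - A) + 2 * x * h"
    using mh x by (intro add_right_mono mult_right_mono) auto
  finally have "((m + r) * h) * x \<le> (2 * (x - A) + 2 * h) * x"
    by (simp add: algebra_simps)
  then have mr: "(m + r) * h \<le> 2 * (x - A) + 2 * h"
    by (rule mult_right_le_imp_le) (use x in simp)
  have "(m + r - 1 + (1 - \<sigma>) * (2 + B)) * h \<le> (2 + h) * (1 + (1 - \<sigma>) * B)"
    using mr by (simp add: x_def h_def algebra_simps)
  also have "\<dots> \<le> (2 + h) * (13 / 10)"
    using \<sigma>B h by (intro mult_left_mono) auto
  also have "\<dots> \<le> (10 / 3) * h" using h by simp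
  finally show ?thesis by (rule mult_right_le_imp_le) (use h in simp)
qed

text \<open>The last step of both odd lean estimates, with \<open>h = A + B\<close>. For
  \<open>h \<le> 6\<close> replacing \<open>B\<close> by \<open>h / 2\<close> leaves the quadratic
  \<open>(3 * h - 4) * (6 - h) \<ge> 0\<close>, which is tight at \<open>h = 4 / 3\<close>.\<close>

lemma odd_bound:
  fixes B h :: real
  assumes "0 < B" "4 / 3 < h" "2 * B \<le> h" "B \<le> 2"
  shows "(2 + B) * h + 4 + 2 * B \<le> (20 / 3) * h"
proof (cases "h \<le> 6")
  case True
  have "0 \<le> (3 * h - 4) * (6 - h)" using assms True by simp
  moreover have "(2 * B) * h \<le> h * h" using assms by (intro mult_right_mono) auto
  moreover have "(3 * h - 4) * (6 - h) = 22 * h - 24 - 3 * (h * h)" by (simp add: algebra_simps)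
  ultimately show ?thesis using assms unfolding distrib_right mult.assoc by argo
next
  case False
  then have "B * h \<le> 2 * h" using assms by (intro mult_right_mono) auto
  then show ?thesis using assms False unfolding distrib_right by argo
qed

text \<open>For the direction \<open>x - y / 2\<close>. After multiplication by \<open>2 * h\<close>
  the lean only contributes nonpositive terms, so the estimate reduces to
  \<open>\<sigma> = 0\<close>.\<close>

lemma odd_top_lean:
  fixes A B m r xT xB \<sigma> :: real
  assumes AB: "0 < A" "0 < B" "4 / 3 < A + B" "B \<le> A" "0 \<le> \<sigma>" "xT \<le> 1 + \<sigma> * A" "xB \<le> 1 - \<sigma> * (2 + B)"
    and m: "0 \<le> m" "0 \<le> r" "r \<le> 2" "m * A \<le> xT * (2 - r)" "m * B \<le> xB * r"
    and "A \<le> 2 * xT" "B \<le> 2 * xB"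
  shows "1 - 2 * \<sigma> + B * (1 / 2 - \<sigma>) + m + r / 2 \<le> 10 / 3"
proof -
  define h where "h = A + B"
  define x where "x = 1 + \<sigma> * A"
  have h: "4 / 3 < h" using AB by (simp add: h_def)
  have \<sigma>AB: "0 \<le> \<sigma> * A" "0 \<le> \<sigma> * B" using AB by auto
  have x: "1 \<le> x" "A \<le> 2 * x" using assms \<sigma>AB by (auto simp: x_def)
  have xB: "xB \<le> 1"
    using AB by (simp add: order_trans[OF AB(7)])
  then have B1: "B \<le> 2" using assms by simp
  have "xT \<le> x" "xB \<le> x" using AB(6) xB x(1) unfolding x_def by linarith+
  then have "xT * (2 - r) \<le> x * (2 - r)" "xB * r \<le> x * r"
    using m by (intro mult_right_mono; simp)+
  then have mx: "m * A \<le> x * (2 - r)" "m * B \<le> x * r" using m by auto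
  then have mh: "m * h \<le> 2 * x" by (simp add: h_def algebra_simps)
  have "(2 * m + r) * x \<le> m * (2 * x - A) + 2 * x"
    using mx(1) by (simp add: algebra_simps)
  then have "(2 * m + r) * x * h \<le> (m * (2 * x - A) + 2 * x) * h"
    using h by (intro mult_right_mono) auto
  also have "\<dots> = (m * h) * (2 * x - A) + 2 * x * h" by (simp add: algebra_simps)
  also have "\<dots> \<le> (2 * x) * (2 * x - A) + 2 * x * h"
    using mh x by (intro add_right_mono mult_right_mono) auto
  finally have "((2 * m + r) * h) * x \<le> (2 * (2 * x - A) + 2 * h) * x"
    by (simp add: algebra_simps)
  then have mr: "(2 * m + r) * h \<le> 2 * (2 * x - A) + 2 * h"
    by (rule mult_right_le_imp_le) (use x in simp)
  have "(2 - 4 * \<sigma> + B - 2 * \<sigma> * B + 2 * m + r) * h \<le> (2 + B) * h + 4 + 2 * B - \<sigma> * (4 * B + 2 * B * h)"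
    using mr by (simp add: x_def h_def algebra_simps)
  also have "\<dots> \<le> (2 + B) * h + 4 + 2 * B" using AB h by simp
  also have "\<dots> \<le> (20 / 3) * h"
    using AB h B1 by (intro odd_bound) (auto simp: h_def)
  finally have "2 - 4 * \<sigma> + B - 2 * \<sigma> * B + 2 * m + r \<le> 20 / 3"
    by (rule mult_right_le_imp_le) (use h in simp)
  moreover have "B * (1 / 2 - \<sigma>) = B / 2 - \<sigma> * B" by (simp add: algebra_simps)
  ultimately show ?thesis by argo
qed

text \<open>Here the lean increases the left side by \<open>\<sigma> * B\<close>. In exchange the
  upper apex moves to the left and the bulge shrinks: \<open>m * D \<le> 2\<close> with
  \<open>D = h + 2 * \<sigma> * A\<close> instead of \<open>m * h \<le> 2\<close>. This gain pays
  for the loss.\<close>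

lemma odd_bottom_lean:
  fixes A B m r xT xB \<sigma> :: real
  assumes AB: "0 < A" "0 < B" "4 / 3 < A + B" "B \<le> A" "0 \<le> \<sigma>" "xB \<le> 1 + \<sigma> * B" "xT \<le> 1 - \<sigma> * (2 + A)"
    and m: "0 \<le> m" "0 \<le> r" "r \<le> 2" "m * A \<le> xT * (2 - r)" "m * B \<le> xB * r"
    and xTB: "A \<le> 2 * xT" "B \<le> 2 * xB"
  shows "1 + B / 2 + \<sigma> * B + m + r / 2 \<le> 10 / 3"
proof -
  define h where "h = A + B"
  have h: "4 / 3 < h" "h > 0" using AB by (auto simp: h_def)
  define x where "x = 1 - \<sigma> * (2 + A)"
  define z where "z = 1 + \<sigma> * B"
  define X where "X = A / x"
  define Z where "Z = B / z"
  have x: "0 < x" "A \<le> 2 * x" using assms by (auto simp: x_def)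
  have z: "0 < z" using AB by (simp add: z_def add_pos_nonneg)
  have sA: "0 \<le> \<sigma> * (2 + A)" using AB by simp
  have A2: "A \<le> 2" using x sA unfolding x_def by argo
  have X2: "X \<le> 2" using x by (simp add: X_def divide_le_eq)
  have "xT * (2 - r) \<le> x * (2 - r)" "xB * r \<le> z * r"
    using assms by (intro mult_right_mono; simp add: x_def z_def)+
  then have mx: "m * A \<le> x * (2 - r)" "m * B \<le> z * r" using m by auto
  then have mXZ: "m * X \<le> 2 - r" "m * Z \<le> r"
    using x z by (simp_all add: X_def Z_def divide_le_eq mult.commute)
  \<comment> \<open>Replaces the reciprocals of \<open>x\<close> and \<open>z\<close> by linear
    lower bounds.\<close>
  have "(1 + w) * (1 - w) \<le> 1" for w :: real
    using zero_le_square[of w] by (simp add: algebra_simps)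
  note sq = this[of "\<sigma> * (2 + A)"] this[of "\<sigma> * B"]
  have "(1 + \<sigma> * (2 + A)) * x \<le> 1"
    using sq(1) by (simp only: x_def)
  then have "A * ((1 + \<sigma> * (2 + A)) * x) \<le> A * 1" using AB by (intro mult_left_mono) auto
  then have X: "A * (1 + \<sigma> * (2 + A)) \<le> X"
    using x by (simp add: X_def le_divide_eq mult.assoc)
  have "(1 - \<sigma> * B) * z \<le> 1" using sq(2) by (simp only: z_def mult.commute)
  then have "B * ((1 - \<sigma> * B) * z) \<le> B * 1" using AB by (intro mult_left_mono) auto
  then have Z: "B * (1 - \<sigma> * B) \<le> Z"
    using z by (simp add: Z_def le_divide_eq mult.assoc)
  define D where "D = h + 2 * \<sigma> * A"
  have D: "0 < D" "h \<le> D" using h AB by (auto simp: D_def add_pos_nonneg)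
  have "\<sigma> * (B * B) \<le> \<sigma> * (A * A)" using AB by (intro mult_left_mono mult_mono) auto
  then have XZ: "D \<le> X + Z"
    using X Z unfolding D_def h_def by (simp add: algebra_simps)
  have "(2 * m + r) \<le> 2 + m * (2 - X)"
    using mXZ(1) by (simp add: algebra_simps)
  moreover have "m * D \<le> 2"
  proof -
    have "m * D \<le> m * (X + Z)" using XZ m by (intro mult_left_mono) auto
    with mXZ show ?thesis unfolding distrib_left by linarith
  qed
  then have "(m * D) * (2 - X) \<le> 2 * (2 - X)" using X2 by (intro mult_right_mono) auto
  moreover have "2 * (2 - X) \<le> 2 * (2 - A * (1 + \<sigma> * (2 + A)))" using X by simp
  ultimately have mr: "(2 * m + r) * D \<le> 2 * D + 2 * (2 - A * (1 + \<sigma> * (2 + A)))"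
    using mult_right_mono[of "2 * m + r" "2 + m * (2 - X)" D] D
    by (simp add: algebra_simps)
  \<comment> \<open>From \<open>A \<le> 2 * x\<close> one obtains
    \<open>A * (1 + 2 * \<sigma>) \<le> 2\<close>, which bounds \<open>B * D\<close> and so the
    loss.\<close>
  have "\<sigma> * (2 + A) \<le> 1 - A / 2" using x unfolding x_def by argo
  then have "(1 + 2 * \<sigma>) * (2 + A) \<le> 4" by (simp add: algebra_simps)
  then have "A * ((1 + 2 * \<sigma>) * (2 + A)) \<le> A * 4" using AB by (intro mult_left_mono) auto
  also have "\<dots> \<le> 2 * (2 + A)" using A2 by simp
  finally have "(A * (1 + 2 * \<sigma>)) * (2 + A) \<le> 2 * (2 + A)" by (simp add: mult.assoc)
  then have "A * (1 + 2 * \<sigma>) \<le> 2" by (rule mult_right_le_imp_le) (use AB in simp)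
  moreover have "B * (1 + 2 * \<sigma>) \<le> A * (1 + 2 * \<sigma>)" using AB by (intro mult_right_mono) auto
  ultimately have "B * (1 + 2 * \<sigma>) \<le> 2" by (rule order_trans[rotated])
  then have "A * (B * (1 + 2 * \<sigma>)) \<le> A * 2" using AB by (intro mult_left_mono) auto
  moreover have "B * B \<le> A * B" using AB by (intro mult_right_mono) auto
  moreover have "A * B \<le> A * A" using AB by (intro mult_left_mono) auto
  ultimately have "B * D \<le> 2 * A + A * A"
    by (simp add: D_def h_def algebra_simps)
  then have "(B * D) * h \<le> (2 * A + A * A) * h" using h by (intro mult_right_mono) auto
  moreover have "0 \<le> 2 * A * (2 - A)" using AB A2 by simp
  ultimately have "\<sigma> * ((B * D) * h) \<le> \<sigma> * ((2 * A + A * A) * h + 2 * A * (2 - A))"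
    using AB by (intro mult_left_mono) auto
  then have "(\<sigma> * B * D + D + (2 - A * (1 + \<sigma> * (2 + A)))) * h \<le> (h + 2 - A) * D"
    by (simp add: D_def algebra_simps)
  moreover have "(\<sigma> * B + m + r / 2) * D \<le> \<sigma> * B * D + D + (2 - A * (1 + \<sigma> * (2 + A)))"
    using mr by (simp add: algebra_simps)
  then have "((\<sigma> * B + m + r / 2) * D) * h \<le> (\<sigma> * B * D + D + (2 - A * (1 + \<sigma> * (2 + A)))) * h"
    using h by (intro mult_right_mono) auto
  ultimately have "((\<sigma> * B + m + r / 2) * h) * D \<le> (h + 2 - A) * D"
    by (simp add: mult.commute mult.left_commute)
  then have "(\<sigma> * B + m + r / 2) * h \<le> h + 2 - A"
    by (rule mult_right_le_imp_le) (use D in simp)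
  then have "(2 + B + 2 * (\<sigma> * B + m + r / 2)) * h \<le> (2 + B) * h + 4 + 2 * B"
    unfolding distrib_right h_def by argo
  also have "\<dots> \<le> (20 / 3) * h"
    using AB h A2 by (intro odd_bound) (auto simp: h_def)
  finally have "2 + B + 2 * (\<sigma> * B + m + r / 2) \<le> 20 / 3"
    by (rule mult_right_le_imp_le) (use h in simp)
  then show ?thesis by argo
qed

text \<open>If \<open>r - r' \<le> 5 / 3\<close>, then \<open>m + n \<le> 3 / 2\<close> suffices.
  Otherwise the left bulge is near the top row and the right one near the bottom row, where the caps
  make them small.\<close>

lemma odd_two_bulges:
  fixes A B m n r r' xT xB :: real
  assumes AB: "0 < A" "0 < B" "4 / 3 < A + B" "B \<le> A"
    and m: "0 \<le> m" "0 \<le> r" "r \<le> 2" "m * A \<le> xT * (2 - r)" "m * B \<le> xB * r"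
    and n: "0 \<le> n" "0 \<le> r'" "r' \<le> 2" "n * A \<le> (1 - xT) * (2 - r')" "n * B \<le> (1 - xB) * r'"
    and x: "A \<le> 2 * xT" "B \<le> 2 * xB" "xT \<le> 1" "xB \<le> 1"
  shows "1 + m + n + r / 2 - r' / 2 \<le> 10 / 3"
proof (cases "r - r' \<le> 5 / 3")
  case True
  have "(m + n) * (A + B) \<le> 2"
    by (rule harmonic_bound_two[where x = xT and z = xB and s = "2 - r" and r = r and s' = "2 - r'" and r' = r'])
      (use assms in auto)
  moreover have "(m + n) * (4 / 3) \<le> (m + n) * (A + B)"
    using assms by (intro mult_left_mono) auto
  ultimately have "m + n \<le> 3 / 2" by argo
  with True show ?thesis by argo
next
  case False
  have "xT * (2 - r) \<le> 1 * (2 - r)" using m x by (intro mult_right_mono) auto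
  with m have mA: "m * A \<le> 2 - r" by simp
  show ?thesis
  proof (cases "1 \<le> A")
    case True
    have "(1 - xT) * (2 - r') \<le> (1 / 2) * 2" using n x True by (intro mult_mono) auto
    with n have "n * A \<le> 1" by simp
    moreover have "n * 1 \<le> n * A" "m * 1 \<le> m * A" using True m n by (intro mult_left_mono; simp)+
    ultimately have "n \<le> 1" "m \<le> 2 - r" using mA by auto
    with False n show ?thesis by argo
  next
    case A1: False
    have "m * (2 / 3) \<le> m * A" using AB m by (intro mult_left_mono) auto
    with mA have "m \<le> 3 / 2 * (2 - r)" by argo
    have B: "1 / 3 \<le> B" using A1 AB by argo
    have "(1 - xB) * r' \<le> (1 - B / 2) * r'" using n x by (intro mult_right_mono) auto
    with n have "n * B \<le> (1 - B / 2) * r'" by simp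
    also have "\<dots> \<le> (5 / 2 * B) * r'" using B n by (intro mult_right_mono) auto
    finally have "n * B \<le> (5 / 2 * r') * B" by (simp add: mult_ac)
    then have "n \<le> 5 / 2 * r'" by (rule mult_right_le_imp_le) (use AB in simp)
    with \<open>m \<le> 3 / 2 * (2 - r)\<close> False n m show ?thesis by argo
  qed
qed

section \<open>Bodies without lattice points in two rows\<close>

text \<open>Coefficients are real because half-integral directions occur after shearing; ordered
  pairs replace the absolute value.\<close>

definition narrow :: "real \<Rightarrow> real \<Rightarrow> (real \<times> real) set \<Rightarrow> bool" where
  "narrow p q S \<longleftrightarrow> (\<forall>P\<in>S. \<forall>Q\<in>S. p * (fst P - fst Q) + q * (snd P - snd Q) \<le> 10 / 3)"

text \<open>The reflection in \<open>x = 1 / 2\<close>, which preserves the strip over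
  \<open>[0, 1]\<close>.\<close>

definition mirror_x :: "(real \<times> real) set \<Rightarrow> (real \<times> real) set" where
  "mirror_x S = {(x, y). (1 - x, y) \<in> S}"

definition mirror_y :: "(real \<times> real) set \<Rightarrow> (real \<times> real) set" where
  "mirror_y S = {(x, y). (x, - y) \<in> S}"

lemma in_mirror_x [simp]: "(x, y) \<in> mirror_x S \<longleftrightarrow> (1 - x, y) \<in> S"
  by (simp add: mirror_x_def)

lemma in_mirror_y [simp]: "(x, y) \<in> mirror_y S \<longleftrightarrow> (x, - y) \<in> S"
  by (simp add: mirror_y_def)

lemma convex_mirror_x: "convex S \<Longrightarrow> convex (mirror_x S)"
proof -
  assume "convex S"
  moreover have "mirror_x S = {(x, y). ((-1) * x + 0 * y + 1, 0 * x + 1 * y + 0) \<in> S}"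
    by (simp add: mirror_x_def)
  ultimately show ?thesis by (simp only: convex_affine_preimage)
qed

lemma convex_mirror_y: "convex S \<Longrightarrow> convex (mirror_y S)"
proof -
  assume "convex S"
  moreover have "mirror_y S = {(x, y). (1 * x + 0 * y + 0, 0 * x + (-1) * y + 0) \<in> S}"
    by (simp add: mirror_y_def)
  ultimately show ?thesis by (simp only: convex_affine_preimage)
qed

lemma narrowI:
  assumes "\<And>px py qx qy. (px, py) \<in> S \<Longrightarrow> (qx, qy) \<in> S \<Longrightarrow> p * (px - qx) + q * (py - qy) \<le> 10 / 3"
  shows "narrow p q S"
  using assms by (auto simp: narrow_def)

lemma narrowD:
  assumes "narrow p q S" "(px, py) \<in> S" "(qx, qy) \<in> S"
  shows "p * (px - qx) + q * (py - qy) \<le> 10 / 3"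
  using assms by (force simp: narrow_def)

lemma narrow_mirror_x: "narrow p q (mirror_x S) \<Longrightarrow> narrow p (- q) S"
proof (rule narrowI)
  fix px py qx qy assume "narrow p q (mirror_x S)" "(px, py) \<in> S" "(qx, qy) \<in> S"
  then have "p * ((1 - qx) - (1 - px)) + q * (qy - py) \<le> 10 / 3" by (intro narrowD[of p q "mirror_x S"]) simp_all
  then show "p * (px - qx) + - q * (py - qy) \<le> 10 / 3" by (simp add: algebra_simps)
qed

lemma narrow_mirror_y: "narrow p q (mirror_y S) \<Longrightarrow> narrow p (- q) S"
proof (rule narrowI)
  fix px py qx qy assume "narrow p q (mirror_y S)" "(px, py) \<in> S" "(qx, qy) \<in> S"
  then have "p * (px - qx) + q * ((- py) - (- qy)) \<le> 10 / 3" by (intro narrowD[of p q "mirror_y S"]) simp_all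
  then show "p * (px - qx) + - q * (py - qy) \<le> 10 / 3" by (simp add: algebra_simps)
qed

text \<open>The coordinate \<open>x\<close> is a shear of the lattice coordinate by a multiple of \<open>1 / 2\<close>, chosen such that both rows
  at height \<open>1\<close> and \<open>-1\<close> lie over \<open>(0, 1)\<close>. In the even case the lattice points of height \<open>0\<close> have integer
  coordinates \<open>x\<close> and \<open>x\<close> is an integral direction; in the odd case they are half-integers and \<open>x + y / 2\<close> and
  \<open>x - y / 2\<close> are integral. The caps have heights \<open>A\<close> and \<open>B\<close>.\<close>

locale pinched =
  fixes S :: "(real \<times> real) set" and A B xT xB :: real
  assumes conv: "convex S" and pos: "0 < A" "0 < B" and AB: "4 / 3 < A + B"
    and top: "(xT, 1 + A) \<in> S" and bot: "(xB, - 1 - B) \<in> S"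
    and bd: "(x, y) \<in> S \<Longrightarrow> - 1 - B \<le> y \<and> y \<le> 1 + A"
    and row_top: "(x, 1) \<in> S \<Longrightarrow> 0 < x \<and> x < 1"
    and row_bot: "(x, - 1) \<in> S \<Longrightarrow> 0 < x \<and> x < 1"

text \<open>The caps stay on the right of \<open>x = 0\<close>, so that only the part between the
  two rows can bulge to the left.\<close>

definition left_confined :: "(real \<times> real) set \<Rightarrow> bool" where
  "left_confined S \<longleftrightarrow> (\<forall>x y. (x, y) \<in> S \<longrightarrow> 1 \<le> \<bar>y\<bar> \<longrightarrow> 0 \<le> x)"

definition right_confined :: "(real \<times> real) set \<Rightarrow> bool" where
  "right_confined S \<longleftrightarrow> (\<forall>x y. (x, y) \<in> S \<longrightarrow> 1 \<le> \<bar>y\<bar> \<longrightarrow> x \<le> 1)"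

lemma confined_mirror:
  "left_confined (mirror_x S) \<longleftrightarrow> right_confined S" "right_confined (mirror_x S) \<longleftrightarrow> left_confined S"
  "left_confined (mirror_y S) \<longleftrightarrow> left_confined S" "right_confined (mirror_y S) \<longleftrightarrow> right_confined S"
proof -
  show "left_confined (mirror_x S) \<longleftrightarrow> right_confined S"
    unfolding left_confined_def right_confined_def in_mirror_x
    by (metis diff_ge_0_iff_ge diff_diff_eq2 add_diff_cancel_left')
  show "right_confined (mirror_x S) \<longleftrightarrow> left_confined S"
    unfolding left_confined_def right_confined_def in_mirror_x
    by (metis diff_ge_0_iff_ge diff_diff_eq2 add_diff_cancel_left')
  show "left_confined (mirror_y S) \<longleftrightarrow> left_confined S" "right_confined (mirror_y S) \<longleftrightarrow> right_confined S"
    unfolding left_confined_def right_confined_def in_mirror_y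
    by (metis minus_minus abs_minus_cancel)+
qed

context pinched
begin

lemma pinched_mirror_x: "pinched (mirror_x S) A B (1 - xT) (1 - xB)"
proof
  show "convex (mirror_x S)" by (rule convex_mirror_x[OF conv])
qed (use pos AB top bot in \<open>auto dest: bd row_top row_bot\<close>)

lemma pinched_mirror_y: "pinched (mirror_y S) B A xB xT"
proof
  show "convex (mirror_y S)" by (rule convex_mirror_y[OF conv])
  show "- 1 - A \<le> y \<and> y \<le> 1 + B" if "(x, y) \<in> mirror_y S" for x y
    using bd[of x "- y"] that by auto
  show "0 < x \<and> x < 1" if "(x, 1) \<in> mirror_y S" for x
    using row_bot[of x] that by simp
  show "0 < x \<and> x < 1" if "(x, - 1) \<in> mirror_y S" for x
    using row_top[of x] that by simp
  show "(xB, 1 + B) \<in> mirror_y S" "(xT, - 1 - A) \<in> mirror_y S"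
    using top bot unfolding in_mirror_y by (simp_all only: minus_diff_eq minus_add_distrib diff_conv_add_uminus minus_minus add.commute)
qed (use pos AB in auto)

text \<open>The segment meets height 1 inside \<open>(0, 1)\<close>, here with denominators
  cleared.\<close>

lemma cross_top:
  assumes "(x, y) \<in> S" "(z, t) \<in> S" "y < 1" "1 < t"
  shows "0 < x * (t - 1) + z * (1 - y)" "x * (t - 1) + z * (1 - y) < t - y"
proof -
  have "((x * (t - 1) + z * (1 - y)) / (t - y), 1) \<in> S"
    using assms by (intro convex_at_level[OF conv]) auto
  from row_top[OF this] assms show "0 < x * (t - 1) + z * (1 - y)" "x * (t - 1) + z * (1 - y) < t - y"
    by (simp_all add: zero_less_divide_iff divide_less_eq)
qed

lemma bulge_top:
  assumes "(x, y) \<in> S" "y \<le> 1"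
  shows "(- x) * A \<le> xT * (1 - y)" "(x - 1) * A \<le> (1 - xT) * (1 - y)"
proof -
  have "(- x) * A \<le> xT * (1 - y) \<and> (x - 1) * A \<le> (1 - xT) * (1 - y)"
  proof (cases "y = 1")
    case True
    then show ?thesis using row_top[of x] assms pos by (auto simp: mult_le_0_iff)
  next
    case False
    then have "y < 1" using assms by simp
    then show ?thesis using cross_top[OF assms(1) top] pos by (simp add: algebra_simps)
  qed
  then show "(- x) * A \<le> xT * (1 - y)" "(x - 1) * A \<le> (1 - xT) * (1 - y)" by auto
qed

lemma bulge_bot:
  assumes "(x, y) \<in> S" "- 1 \<le> y"
  shows "(- x) * B \<le> xB * (1 + y)" "(x - 1) * B \<le> (1 - xB) * (1 + y)"
  using pinched.bulge_top[OF pinched_mirror_y, of x "- y"] assms by auto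

text \<open>Otherwise the segment from \<open>(l, 0)\<close> would meet height 1 at a nonpositive
  abscissa. The second bound is the line through \<open>(l, 0)\<close> and
  \<open>(0, 1)\<close>.\<close>

lemma left_slope_top:
  assumes "(l, 0) \<in> S" "l \<le> 0" "(x, y) \<in> S" "1 \<le> y"
  shows "0 < x" "(- l) * (y - 1) \<le> x"
proof -
  have "0 < x \<and> (- l) * (y - 1) \<le> x"
  proof (cases "y = 1")
    case True
    then show ?thesis using row_top[of x] assms(3) by (simp add: less_imp_le)
  next
    case False
    then have "0 < l * (y - 1) + x * (1 - 0)"
      using assms by (intro cross_top(1)) auto
    moreover have "l * (y - 1) \<le> 0" using assms by (simp add: mult_le_0_iff)
    ultimately show ?thesis by simp
  qed
  then show "0 < x" "(- l) * (y - 1) \<le> x" by auto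
qed

lemma left_slope_bot:
  assumes "(l, 0) \<in> S" "l \<le> 0" "(x, y) \<in> S" "y \<le> - 1"
  shows "0 < x" "(- l) * (- y - 1) \<le> x"
  using pinched.left_slope_top[OF pinched_mirror_y, of l x "- y"] assms by auto

lemma left_confinedI:
  assumes "(l, 0) \<in> S" "l \<le> 0"
  shows "left_confined S"
  unfolding left_confined_def
proof (intro allI impI)
  fix x y :: real assume "(x, y) \<in> S" "1 \<le> \<bar>y\<bar>"
  then consider "1 \<le> y" | "y \<le> - 1" by linarith
  then show "0 \<le> x"
    using left_slope_top(1)[OF assms \<open>(x, y) \<in> S\<close>] left_slope_bot(1)[OF assms \<open>(x, y) \<in> S\<close>]
    by cases auto
qed

text \<open>Every point is charged to a left bulge of size \<open>m\<close> at height
  \<open>v\<close>; points not left of the strip get the default \<open>m = 0\<close>,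
  \<open>v = 0\<close>.\<close>

lemma left_extent:
  assumes "left_confined S" "(x, y) \<in> S"
  shows "\<exists>m v. 0 \<le> m \<and> - x \<le> m \<and> - 1 \<le> v \<and> v \<le> 1 \<and> m * A \<le> xT * (1 - v) \<and> m * B \<le> xB * (1 + v)"
proof (cases "0 \<le> x")
  case True
  have "0 \<le> xT" "0 \<le> xB"
    using assms(1) top bot pos unfolding left_confined_def by force+
  with True show ?thesis by (intro exI[of _ 0]) auto
next
  case False
  then have "\<not> 1 \<le> \<bar>y\<bar>" using assms unfolding left_confined_def by blast
  then have "- 1 \<le> y" "y \<le> 1" by auto
  with False bulge_top(1)[OF assms(2)] bulge_bot(1)[OF assms(2)] show ?thesis
    by (intro exI[of _ "- x"] exI[of _ y]) auto
qed

lemma right_extent: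
  assumes "right_confined S" "(x, y) \<in> S"
  shows "\<exists>n v. 0 \<le> n \<and> x - 1 \<le> n \<and> - 1 \<le> v \<and> v \<le> 1 \<and> n * A \<le> (1 - xT) * (1 - v) \<and> n * B \<le> (1 - xB) * (1 + v)"
  using pinched.left_extent[OF pinched_mirror_x, of "1 - x" y] assms by (simp add: confined_mirror)

lemma confined_xTB:
  shows "left_confined S \<Longrightarrow> 0 \<le> xT \<and> 0 \<le> xB" "right_confined S \<Longrightarrow> xT \<le> 1 \<and> xB \<le> 1"
  using top bot pos unfolding left_confined_def right_confined_def by force+

text \<open>The bulges satisfy \<open>(m + n) * (A + B) \<le> 2\<close>, so
  \<open>A + B > 4 / 3\<close> bounds the width by \<open>1 + 3 / 2\<close>.\<close>

lemma narrow_confined: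
  assumes "left_confined S" "right_confined S"
  shows "narrow 1 0 S"
proof (rule narrowI)
  fix px py qx qy assume P: "(px, py) \<in> S" and Q: "(qx, qy) \<in> S"
  obtain m v where m: "0 \<le> m" "- qx \<le> m" "- 1 \<le> v" "v \<le> 1" "m * A \<le> xT * (1 - v)" "m * B \<le> xB * (1 + v)"
    using left_extent[OF assms(1) Q] by blast
  obtain n w where n: "0 \<le> n" "px - 1 \<le> n" "- 1 \<le> w" "w \<le> 1" "n * A \<le> (1 - xT) * (1 - w)" "n * B \<le> (1 - xB) * (1 + w)"
    using right_extent[OF assms(2) P] by blast
  have "(m + n) * (A + B) \<le> 2"
    by (rule harmonic_bound_two[where x = xT and z = xB and s = "1 - v" and r = "1 + v" and s' = "1 - w" and r' = "1 + w"])
      (use m n pos confined_xTB assms in auto)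
  moreover have "(m + n) * (4 / 3) \<le> (m + n) * (A + B)"
    using m n AB by (intro mult_left_mono) auto
  ultimately have "m + n \<le> 3 / 2" by argo
  with m n have "px - qx \<le> 5 / 2" by argo
  then show "1 * (px - qx) + 0 * (py - qy) \<le> 10 / 3" by simp
qed

text \<open>A supporting line through \<open>(1, 1)\<close>: \<open>\<sigma>\<close> is the supremum
  of the inverse slopes from there to the points above height 1, and by \<open>cross_top\<close> no
  point below lies beyond this line. The leaning point makes \<open>\<sigma>\<close>
  nonnegative.\<close>

lemma lean_top:
  assumes "(z, t) \<in> S" "1 < z" "1 < t"
  obtains \<sigma> where "0 \<le> \<sigma>" "\<And>x y. (x, y) \<in> S \<Longrightarrow> x \<le> 1 + \<sigma> * (y - 1)"
proof -
  define X where "X = {(x - 1) / (y - 1) | x y. (x, y) \<in> S \<and> 1 < y}"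
  have le: "a \<le> (1 - x) / (1 - y)" if "a \<in> X" "(x, y) \<in> S" "y < 1" for a x y
  proof -
    obtain u v where uv: "a = (u - 1) / (v - 1)" "(u, v) \<in> S" "1 < v"
      using \<open>a \<in> X\<close> by (auto simp: X_def)
    have "x * (v - 1) + u * (1 - y) < v - y" using that uv by (intro cross_top)
    then have "(u - 1) * (1 - y) \<le> (1 - x) * (v - 1)" by (simp add: algebra_simps)
    then show ?thesis using that uv by (simp add: divide_le_eq le_divide_eq)
  qed
  have zX: "(z - 1) / (t - 1) \<in> X" using assms by (auto simp: X_def)
  have bdd: "bdd_above X" using le[OF _ bot] pos by (intro bdd_aboveI) auto
  show ?thesis
  proof (rule that[of "Sup X"])
    have "(z - 1) / (t - 1) \<le> Sup X" by (rule cSup_upper[OF zX bdd])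
    moreover have "0 \<le> (z - 1) / (t - 1)" using assms by simp
    ultimately show "0 \<le> Sup X" by (rule order_trans[rotated])
    fix x y assume xy: "(x, y) \<in> S"
    consider "y < 1" | "y = 1" | "1 < y" by linarith
    then show "x \<le> 1 + Sup X * (y - 1)"
    proof cases
      case 1
      have "Sup X \<le> (1 - x) / (1 - y)" using zX le[OF _ xy 1] by (intro cSup_least) auto
      then have "Sup X * (1 - y) \<le> 1 - x" using 1 by (simp add: le_divide_eq)
      then show ?thesis by (simp add: algebra_simps)
    next
      case 2
      then show ?thesis using row_top xy by fastforce
    next
      case 3
      then have "(x - 1) / (y - 1) \<in> X" using xy by (auto simp: X_def)
      then have "(x - 1) / (y - 1) \<le> Sup X" by (rule cSup_upper[OF _ bdd])
      then have "x - 1 \<le> Sup X * (y - 1)" using 3 by (simp add: divide_le_eq)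
      then show ?thesis by simp
    qed
  qed
qed

lemma lean_bot:
  assumes "(z, t) \<in> S" "1 < z" "t < - 1"
  obtains \<sigma> where "0 \<le> \<sigma>" "\<And>x y. (x, y) \<in> S \<Longrightarrow> x \<le> 1 - \<sigma> * (y + 1)"
proof -
  obtain \<sigma> where \<sigma>: "0 \<le> \<sigma>" "\<And>x y. (x, y) \<in> mirror_y S \<Longrightarrow> x \<le> 1 + \<sigma> * (y - 1)"
    using pinched.lean_top[OF pinched_mirror_y, of z "- t"] assms by auto
  have "x \<le> 1 - \<sigma> * (y + 1)" if "(x, y) \<in> S" for x y
    using \<sigma>(2)[of x "- y"] that by (simp add: algebra_simps)
  with \<sigma>(1) that show ?thesis by blast
qed

lemma right_cases:
  obtains "right_confined S" | z t where "(z, t) \<in> S" "1 < z" "1 < t" | z t where "(z, t) \<in> S" "1 < z" "t < - 1"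
proof (cases "right_confined S")
  case False
  then obtain x y where xy: "(x, y) \<in> S" "1 \<le> \<bar>y\<bar>" "1 < x" unfolding right_confined_def by force
  then have "y \<noteq> 1" "y \<noteq> - 1" using row_top[of x] row_bot[of x] by auto
  with xy have "1 < y \<or> y < - 1" by linarith
  with xy that show ?thesis by blast
qed


section \<open>Even case: integral directions \<open>x\<close>, \<open>x + y\<close>,
  \<open>x - y\<close>\<close>

lemma even_lean_top:
  assumes left: "(- 1, 0) \<in> S" and \<sigma>: "0 \<le> \<sigma>" "\<And>x y. (x, y) \<in> S \<Longrightarrow> x \<le> 1 + \<sigma> * (y - 1)"
  shows "narrow 1 0 S \<or> narrow 1 (- 1) S"
proof -
  have xT: "A \<le> xT" "xT \<le> 1 + \<sigma> * A" and xB: "B \<le> xB" "xB \<le> 1 - \<sigma> * (2 + B)"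
    using bulge_top(1)[OF left] bulge_bot(1)[OF left] \<sigma>(2)[OF top] \<sigma>(2)[OF bot] by (simp_all add: algebra_simps)
  have conf: "left_confined S" using left_confinedI[OF left] by simp
  show ?thesis
  proof (cases "\<sigma> * A \<le> 1 / 3")
    case True
    have "narrow 1 0 S"
    proof (rule narrowI)
      fix px py qx qy assume P: "(px, py) \<in> S" and Q: "(qx, qy) \<in> S"
      obtain m v where m: "0 \<le> m" "- qx \<le> m" "- 1 \<le> v" "v \<le> 1" "m * A \<le> xT * (1 - v)" "m * B \<le> xB * (1 + v)"
        using left_extent[OF conf Q] by blast
      have "\<sigma> * (py - 1) \<le> \<sigma> * A" using \<sigma>(1) bd[OF P] by (intro mult_left_mono) auto
      moreover have "1 + \<sigma> * A + m \<le> 10 / 3"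
        by (rule even_lean_small[OF pos AB \<sigma>(1) xT(2) xB(2) m(5,6) m(3,4) True])
      ultimately show "1 * (px - qx) + 0 * (py - qy) \<le> 10 / 3"
        using \<sigma>(2)[OF P] m(2) by simp
    qed
    then show ?thesis ..
  next
    case False
    have \<sigma>1: "\<sigma> \<le> 1"
    proof -
      have "\<sigma> * 2 \<le> \<sigma> * (2 + B)" using \<sigma>(1) pos by (intro mult_left_mono) auto
      with xB pos show ?thesis by linarith
    qed
    have "narrow 1 (- 1) S"
    proof (rule narrowI)
      fix px py qx qy assume P: "(px, py) \<in> S" and Q: "(qx, qy) \<in> S"
      have "\<exists>m r. 0 \<le> m \<and> 0 \<le> r \<and> r \<le> 2 \<and> m * A \<le> xT * (2 - r) \<and> m * B \<le> xB * r \<and> qy - qx \<le> m + r - 1"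
      proof (cases "qy - qx \<le> 1")
        case True
        \<comment> \<open>The values \<open>m = r = 1\<close> describe the point
          \<open>(- 1, 0)\<close> itself.\<close>
        with xT xB show ?thesis by (intro exI[of _ 1]) auto
      next
        case False
        have "qy < 1" using left_slope_top(2)[OF left _ Q] False by fastforce
        moreover have "- 1 < qy" using left_slope_bot(1)[OF left _ Q] False by fastforce
        ultimately show ?thesis
          using bulge_top(1)[OF Q] bulge_bot(1)[OF Q] False
          by (intro exI[of _ "- qx"] exI[of _ "1 + qy"]) (simp add: algebra_simps)
      qed
      then obtain m r where m: "0 \<le> m" "0 \<le> r" "r \<le> 2" "m * A \<le> xT * (2 - r)" "m * B \<le> xB * r" "qy - qx \<le> m + r - 1"
        by blast
      have "m + r - 1 + (1 - \<sigma>) * (2 + B) \<le> 10 / 3"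
        by (rule even_lean_large[OF pos AB \<sigma>(1) xT(2) xB(2) m(1-5) xT(1) xB(1)]) (use False in simp)
      moreover have "(1 - \<sigma>) * (1 - py) \<le> (1 - \<sigma>) * (2 + B)"
        using \<sigma>1 bd[OF P] by (intro mult_left_mono) auto
      moreover have "px - py \<le> (1 - \<sigma>) * (1 - py)" using \<sigma>(2)[OF P] by (simp add: algebra_simps)
      ultimately show "1 * (px - qx) + - 1 * (py - qy) \<le> 10 / 3" using m(6) by simp
    qed
    then show ?thesis ..
  qed
qed

lemma even_left:
  assumes left: "(- 1, 0) \<in> S"
  shows "narrow 1 0 S \<or> narrow 1 1 S \<or> narrow 1 (- 1) S"
proof (rule right_cases)
  assume "right_confined S"
  then show ?thesis using narrow_confined left_confinedI[OF left] by simp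
next
  fix z t assume zt: "(z, t) \<in> S" "1 < z" "1 < t"
  obtain \<sigma> where "0 \<le> \<sigma>" "\<And>x y. (x, y) \<in> S \<Longrightarrow> x \<le> 1 + \<sigma> * (y - 1)"
    using lean_top[OF zt] by blast
  then show ?thesis using even_lean_top[OF left] by blast
next
  fix z t assume zt: "(z, t) \<in> S" "1 < z" "t < - 1"
  interpret M: pinched "mirror_y S" B A xB xT by (rule pinched_mirror_y)
  obtain \<sigma> where "0 \<le> \<sigma>" "\<And>x y. (x, y) \<in> mirror_y S \<Longrightarrow> x \<le> 1 + \<sigma> * (y - 1)"
    using M.lean_top[of z "- t"] zt by auto
  then have "narrow 1 0 (mirror_y S) \<or> narrow 1 (- 1) (mirror_y S)"
    using left by (intro M.even_lean_top) auto
  then show ?thesis using narrow_mirror_y[of 1 0 S] narrow_mirror_y[of 1 "- 1" S] by auto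
qed

lemma even_narrow:
  assumes "(- 1, 0) \<in> S \<or> (2, 0) \<in> S \<or> (0, 0) \<in> S \<and> (1, 0) \<in> S"
  shows "narrow 1 0 S \<or> narrow 1 1 S \<or> narrow 1 (- 1) S"
proof -
  interpret M: pinched "mirror_x S" A B "1 - xT" "1 - xB" by (rule pinched_mirror_x)
  consider "(- 1, 0) \<in> S" | "(2, 0) \<in> S" | "(0, 0) \<in> S" "(1, 0) \<in> S" using assms by blast
  then show ?thesis
  proof cases
    case 1
    then show ?thesis by (rule even_left)
  next
    case 2
    then have "narrow 1 0 (mirror_x S) \<or> narrow 1 1 (mirror_x S) \<or> narrow 1 (- 1) (mirror_x S)"
      by (intro M.even_left) simp
    then show ?thesis
      using narrow_mirror_x[of 1 0 S] narrow_mirror_x[of 1 1 S] narrow_mirror_x[of 1 "- 1" S] by auto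
  next
    case 3
    have "left_confined (mirror_x S)" using 3 by (intro M.left_confinedI[of 0]) auto
    then have "right_confined S" by (simp add: confined_mirror)
    moreover have "left_confined S" using 3 by (intro left_confinedI[of 0]) auto
    ultimately show ?thesis using narrow_confined by blast
  qed
qed

section \<open>Odd case: integral directions \<open>x + y / 2\<close>,
  \<open>x - y / 2\<close>\<close>

lemma odd_left_part:
  assumes left: "(- (1 / 2), 0) \<in> S" and Q: "(qx, qy) \<in> S"
  obtains m r where "0 \<le> m" "0 \<le> r" "r \<le> 2" "m * A \<le> xT * (2 - r)" "m * B \<le> xB * r" "qy / 2 - qx \<le> m + r / 2 - 1 / 2"
proof (cases "qy / 2 - qx \<le> 1 / 2")
  case True
  have "A / 2 \<le> xT" "B / 2 \<le> xB" using bulge_top(1)[OF left] bulge_bot(1)[OF left] by simp_all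
  \<comment> \<open>These values describe the point \<open>(- (1 / 2), 0)\<close> itself.\<close>
  with True show ?thesis by (intro that[of "1 / 2" 1]) auto
next
  case False
  have "qy < 1"
  proof (rule ccontr)
    assume "\<not> qy < 1"
    then have "(- (- (1 / 2))) * (qy - 1) \<le> qx" by (intro left_slope_top(2)[OF left _ Q]) auto
    with False show False by (simp add: algebra_simps)
  qed
  moreover have "- 1 < qy"
  proof (rule ccontr)
    assume "\<not> - 1 < qy"
    then have "0 < qx" by (intro left_slope_bot(1)[OF left _ Q]) auto
    with False \<open>\<not> - 1 < qy\<close> show False by argo
  qed
  moreover have "0 \<le> - qx" using False \<open>qy < 1\<close> by argo
  moreover have "qy / 2 - qx \<le> - qx + (1 + qy) / 2 - 1 / 2" by argo
  ultimately show ?thesis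
    using bulge_top(1)[OF Q] bulge_bot(1)[OF Q]
    by (intro that[of "- qx" "1 + qy"]) (simp_all add: algebra_simps)
qed

text \<open>Low points on the right make \<open>x - y / 2\<close> large, so this direction goes with
  the smaller lower cap; for \<open>A < B\<close> reflection gives \<open>x + y / 2\<close>.\<close>

lemma odd_left_high:
  assumes left: "(- (1 / 2), 0) \<in> S" and BA: "B \<le> A"
  shows "narrow 1 (- (1 / 2)) S"
proof (rule narrowI)
  fix px py qx qy assume P: "(px, py) \<in> S" and Q: "(qx, qy) \<in> S"
  have half: "A \<le> 2 * xT" "B \<le> 2 * xB" using bulge_top(1)[OF left] bulge_bot(1)[OF left] by simp_all
  obtain m r where m: "0 \<le> m" "0 \<le> r" "r \<le> 2" "m * A \<le> xT * (2 - r)" "m * B \<le> xB * r"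
    and mQ: "qy / 2 - qx \<le> m + r / 2 - 1 / 2"
    using odd_left_part[OF left Q] .
  have "px - py / 2 + (qy / 2 - qx) \<le> 10 / 3"
  proof (rule right_cases)
    assume conf: "right_confined S"
    then have x1: "xT \<le> 1" "xB \<le> 1" using confined_xTB by auto
    show ?thesis
    proof (cases "px \<le> 1")
      case True
      \<comment> \<open>Without a lean, the top lean estimate applies with
        \<open>\<sigma> = 0\<close>.\<close>
      have "1 - 2 * 0 + B * (1 / 2 - 0) + m + r / 2 \<le> 10 / 3"
        by (rule odd_top_lean[OF pos AB BA _ _ _ m half]) (use x1 in auto)
      then show ?thesis using mQ True bd[OF P] by argo
    next
      case False
      then have "\<not> 1 \<le> \<bar>py\<bar>" using conf P unfolding right_confined_def by blast
      then have py: "- 1 \<le> py" "py \<le> 1" by auto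
      have "1 + m + (px - 1) + r / 2 - (1 + py) / 2 \<le> 10 / 3"
        by (rule odd_two_bulges[OF pos AB BA m _ _ _ _ _ half x1])
          (use False py bulge_top(2)[OF P] bulge_bot(2)[OF P] in auto)
      then show ?thesis using mQ by argo
    qed
  next
    fix z t assume zt: "(z, t) \<in> S" "1 < z" "1 < t"
    obtain \<sigma> where \<sigma>: "0 \<le> \<sigma>" "\<And>x y. (x, y) \<in> S \<Longrightarrow> x \<le> 1 + \<sigma> * (y - 1)"
      using lean_top[OF zt] by blast
    have xT: "xT \<le> 1 + \<sigma> * A" and xB: "xB \<le> 1 - \<sigma> * (2 + B)"
      using \<sigma>(2)[OF top] \<sigma>(2)[OF bot] by (simp_all add: algebra_simps)
    have "\<sigma> * 2 \<le> \<sigma> * (2 + B)" using \<sigma>(1) pos by (intro mult_left_mono) auto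
    then have \<sigma>1: "\<sigma> \<le> 1 / 2" using xB half pos by linarith
    have 1: "1 - 2 * \<sigma> + B * (1 / 2 - \<sigma>) + m + r / 2 \<le> 10 / 3"
      by (rule odd_top_lean[OF pos AB BA \<sigma>(1) xT xB m half])
    have "(1 / 2 - \<sigma>) * (- py) \<le> (1 / 2 - \<sigma>) * (1 + B)"
      using \<sigma>1 bd[OF P] by (intro mult_left_mono) auto
    moreover have "(1 / 2 - \<sigma>) * (- py) = \<sigma> * py - py / 2" "\<sigma> * (py - 1) = \<sigma> * py - \<sigma>"
      by (simp_all add: algebra_simps)
    ultimately have "px - py / 2 \<le> 1 - \<sigma> + (1 / 2 - \<sigma>) * (1 + B)"
      using \<sigma>(2)[OF P] by argo
    moreover have "(1 / 2 - \<sigma>) * (1 + B) = 1 / 2 - \<sigma> + B * (1 / 2 - \<sigma>)" by (simp add: algebra_simps)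
    ultimately show ?thesis using mQ 1 by argo
  next
    fix z t assume zt: "(z, t) \<in> S" "1 < z" "t < - 1"
    obtain \<sigma> where \<sigma>: "0 \<le> \<sigma>" "\<And>x y. (x, y) \<in> S \<Longrightarrow> x \<le> 1 - \<sigma> * (y + 1)"
      using lean_bot[OF zt] by blast
    have xB: "xB \<le> 1 + \<sigma> * B" and xT: "xT \<le> 1 - \<sigma> * (2 + A)"
      using \<sigma>(2)[OF top] \<sigma>(2)[OF bot] by (simp_all add: algebra_simps)
    have "1 + B / 2 + \<sigma> * B + m + r / 2 \<le> 10 / 3"
      by (rule odd_bottom_lean[OF pos AB BA \<sigma>(1) xB xT m half])
    moreover have "(1 / 2 + \<sigma>) * (- py) \<le> (1 / 2 + \<sigma>) * (1 + B)"
      using \<sigma>(1) bd[OF P] by (intro mult_left_mono) auto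
    then have "px - py / 2 \<le> 1 - \<sigma> + (1 / 2 + \<sigma>) * (1 + B)"
      using \<sigma>(2)[OF P] by (simp add: algebra_simps)
    moreover have "(1 / 2 + \<sigma>) * (1 + B) = 1 / 2 + \<sigma> + B / 2 + \<sigma> * B" by (simp add: algebra_simps)
    ultimately show ?thesis using mQ by argo
  qed
  then show "1 * (px - qx) + - (1 / 2) * (py - qy) \<le> 10 / 3" by argo
qed

lemma odd_left:
  assumes left: "(- (1 / 2), 0) \<in> S"
  shows "narrow 1 (1 / 2) S \<or> narrow 1 (- (1 / 2)) S"
proof (cases "B \<le> A")
  case True
  then show ?thesis using odd_left_high[OF left] by blast
next
  case False
  interpret M: pinched "mirror_y S" B A xB xT by (rule pinched_mirror_y)
  have "narrow 1 (- (1 / 2)) (mirror_y S)" using left False by (intro M.odd_left_high) auto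
  then show ?thesis using narrow_mirror_y[of 1 "- (1 / 2)" S] by auto
qed

lemma odd_narrow:
  assumes "(- (1 / 2), 0) \<in> S \<or> (3 / 2, 0) \<in> S"
  shows "narrow 1 (1 / 2) S \<or> narrow 1 (- (1 / 2)) S"
  using assms
proof
  assume "(3 / 2, 0) \<in> S"
  interpret M: pinched "mirror_x S" A B "1 - xT" "1 - xB" by (rule pinched_mirror_x)
  have "narrow 1 (1 / 2) (mirror_x S) \<or> narrow 1 (- (1 / 2)) (mirror_x S)"
    using \<open>(3 / 2, 0) \<in> S\<close> by (intro M.odd_left) simp
  then show ?thesis
    using narrow_mirror_x[of 1 "1 / 2" S] narrow_mirror_x[of 1 "- (1 / 2)" S] by auto
qed (rule odd_left)

end

text \<open>Joining a point of height between \<open>- 1\<close> and 1 to the apex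
  \<open>(t, a)\<close> across height 1 shows that the bulges have sizes at most
  \<open>d * t\<close> and \<open>d * (1 - t)\<close>. Their sum is \<open>d \<le> 3 / 2\<close>, so
  the width is at most \<open>5 / 2\<close>.\<close>

lemma tall_narrow:
  fixes S :: "(real \<times> real) set"
  assumes S: "convex S" and base: "(0, 0) \<in> S" "(1, 0) \<in> S" and t: "(t, a) \<in> S" "7 / 3 < a"
    and bd: "\<And>x y. (x, y) \<in> S \<Longrightarrow> - 1 \<le> y"
    and row: "\<And>x. (x, 1) \<in> S \<Longrightarrow> 0 < x \<and> x < 1"
  shows "narrow 1 0 S"
proof -
  have cap: "0 < x \<and> x < 1" if "(x, y) \<in> S" "1 \<le> y" for x y
  proof -
    have "((0 * (y - 1) + x * (1 - 0)) / (y - 0), 1) \<in> S" "((1 * (y - 1) + x * (1 - 0)) / (y - 0), 1) \<in> S"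
      using that base by (intro convex_at_level[OF S]; simp)+
    from row[OF this(1)] row[OF this(2)] that show ?thesis
      by (simp add: zero_less_divide_iff divide_less_eq)
  qed
  have t01: "0 < t" "t < 1" using cap[OF t(1)] t(2) by auto
  define d where "d = 2 / (a - 1)"
  have d: "d * (a - 1) = 2" "0 < d" "d \<le> 3 / 2" using t(2) by (auto simp: d_def field_simps)
  have main: "- (d * t) \<le> x \<and> x \<le> 1 + d * (1 - t)" if xy: "(x, y) \<in> S" for x y
  proof (cases "1 \<le> y")
    case True
    have "0 \<le> d * t" "0 \<le> d * (1 - t)" using d t01 by auto
    with cap[OF xy True] show ?thesis by linarith
  next
    case False
    have "((x * (a - 1) + t * (1 - y)) / (a - y), 1) \<in> S"
      using False t by (intro convex_at_level[OF S xy t(1)]) auto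
    from row[OF this] False t(2) have 1: "0 < x * (a - 1) + t * (1 - y)" "x * (a - 1) + t * (1 - y) < a - y"
      by (simp_all add: zero_less_divide_iff divide_less_eq)
    have y: "1 - y \<le> 2" "0 \<le> 1 - y" using bd[OF xy] False by auto
    have du: "(d * u) * (a - 1) = u * 2" for u
    proof -
      have "(d * u) * (a - 1) = u * (d * (a - 1))" by (simp only: mult_ac)
      then show ?thesis by (simp only: d(1))
    qed
    have 2: "t * (1 - y) \<le> t * 2" "(1 - t) * (1 - y) \<le> (1 - t) * 2"
      using y t01 by (intro mult_left_mono; simp)+
    have 3: "(x - 1) * (a - 1) = x * (a - 1) - (a - 1)" "(1 - t) * (1 - y) = (1 - y) - t * (1 - y)"
      by (simp_all add: algebra_simps)
    have "(- (d * t)) * (a - 1) \<le> x * (a - 1)"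
      unfolding mult_minus_left du using 1(1) 2(1) by argo
    moreover have "(x - 1) * (a - 1) \<le> (d * (1 - t)) * (a - 1)"
      unfolding du 3(1) using 1(2) 2(2) unfolding 3(2) by argo
    moreover have "0 < a - 1" using t(2) by simp
    ultimately have "- (d * t) \<le> x" "x - 1 \<le> d * (1 - t)"
      by (blast intro: mult_right_le_imp_le)+
    then show ?thesis by simp
  qed
  show ?thesis
  proof (rule narrowI)
    fix px py qx qy assume "(px, py) \<in> S" "(qx, qy) \<in> S"
    then have "px - qx \<le> 1 + d * (1 - t) + d * t" using main[of px py] main[of qx qy] by linarith
    also have "\<dots> = 1 + d" by (simp add: algebra_simps)
    finally show "1 * (px - qx) + 0 * (py - qy) \<le> 10 / 3" using d(3) by simp
  qed
qed

section \<open>Bodies containing a unit lattice segment\<close>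

lemma row_between_integers:
  fixes S :: "(real \<times> real) set"
  assumes S: "convex S" and free: "\<And>i::int. (of_int i, y) \<notin> S" and t: "(t, y) \<in> S" and x: "(x, y) \<in> S"
  shows "of_int \<lfloor>t\<rfloor> < x \<and> x < of_int \<lfloor>t\<rfloor> + 1"
proof (rule ccontr)
  assume "\<not> ?thesis"
  then consider "x \<le> of_int \<lfloor>t\<rfloor>" | "of_int (\<lfloor>t\<rfloor> + 1) \<le> x" by fastforce
  then show False
  proof cases
    case 1
    then show False using convex_row[OF S x t, of "of_int \<lfloor>t\<rfloor>"] free by simp
  next
    case 2
    have "t \<le> of_int (\<lfloor>t\<rfloor> + 1)" by linarith
    then show False using convex_row[OF S t x _ 2] free by blast
  qed
qed

lemma narrow_unshear:
  fixes \<mu> c :: real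
  assumes S': "S' = {(x, y). (1 * x + (- \<mu>) * y + c, 0 * x + 1 * y + 0) \<in> S}" and n: "narrow 1 q S'"
  shows "narrow 1 (\<mu> + q) S"
proof (rule narrowI)
  fix px py qx qy assume "(px, py) \<in> S" "(qx, qy) \<in> S"
  then have "(px + \<mu> * py - c, py) \<in> S'" "(qx + \<mu> * qy - c, qy) \<in> S'" by (auto simp: S')
  from narrowD[OF n this] show "1 * (px - qx) + (\<mu> + q) * (py - qy) \<le> 10 / 3"
    by (simp add: algebra_simps)
qed

text \<open>Lattice width at most \<open>w\<close>, witnessed by an integral direction and stated
  for pairs of reals.\<close>

definition thin :: "real \<Rightarrow> (real \<times> real) set \<Rightarrow> bool" where
  "thin w S \<longleftrightarrow> (\<exists>p q :: int. (p \<noteq> 0 \<or> q \<noteq> 0) \<and>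
     (\<forall>P\<in>S. \<forall>Q\<in>S. of_int p * (fst P - fst Q) + of_int q * (snd P - snd Q) \<le> w))"

lemma thinI: "narrow (of_int p) (of_int q) S \<Longrightarrow> p \<noteq> 0 \<or> q \<noteq> 0 \<Longrightarrow> thin (10 / 3) S"
  unfolding thin_def narrow_def by blast

lemma thin_mono: "thin w T \<Longrightarrow> S \<subseteq> T \<Longrightarrow> thin w S"
  unfolding thin_def by (meson subsetD)

text \<open>Let the body reach \<open>a\<close> above and \<open>b\<close> below the segment. If
  \<open>a + b \<le> 10 / 3\<close>, the direction \<open>y\<close> works. If one of them is at most
  1, the other exceeds \<open>7 / 3\<close> and \<open>tall_narrow\<close> applies. Otherwise a
  shear makes the body pinched.\<close>

lemma thin_of_unit_row:
  fixes S :: "(real \<times> real) set"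
  assumes S: "convex S" "compact S" and base: "(0, 0) \<in> S" "(1, 0) \<in> S"
    and free1: "\<And>i::int. (of_int i, 1) \<notin> S" and free2: "\<And>i::int. (of_int i, - 1) \<notin> S"
  shows "thin (10 / 3) S"
proof -
  have "continuous_on S snd" "S \<noteq> {}" using base by (auto intro: continuous_intros)
  then obtain T U where T: "T \<in> S" "\<And>P. P \<in> S \<Longrightarrow> snd P \<le> snd T" and U: "U \<in> S" "\<And>P. P \<in> S \<Longrightarrow> snd U \<le> snd P"
    using continuous_attains_sup[OF S(2), of snd] continuous_attains_inf[OF S(2), of snd] by metis
  define a where "a = snd T"
  define b where "b = - snd U"
  have bd: "- b \<le> y \<and> y \<le> a" if "(x, y) \<in> S" for x y using T(2)[OF that] U(2)[OF that] by (simp add: a_def b_def)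
  have Ta: "(fst T, a) \<in> S" and Ub: "(fst U, - b) \<in> S" using T U by (simp_all add: a_def b_def)
  have ab0: "0 \<le> a" "0 \<le> b" using bd[OF base(1)] by auto
  show ?thesis
  proof (cases "a + b \<le> 10 / 3")
    case True
    have "narrow 0 1 S"
    proof (rule narrowI)
      fix px py qx qy assume "(px, py) \<in> S" "(qx, qy) \<in> S"
      with bd[of px py] bd[of qx qy] True show "0 * (px - qx) + 1 * (py - qy) \<le> 10 / 3" by simp
    qed
    then show ?thesis using thinI[of 0 1 S] by simp
  next
    case ab: False
    have tall: "\<exists>i::int. narrow 1 (of_int i) M"
      if M: "convex M" "(0, 0) \<in> M" "(1, 0) \<in> M" "(t, c) \<in> M" "7 / 3 < c" "\<And>x y. (x, y) \<in> M \<Longrightarrow> - 1 \<le> y"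
        "\<And>i::int. (of_int i, 1) \<notin> M" for M t c
    proof -
      have "((0 * (c - 1) + t * (1 - 0)) / (c - 0), 1) \<in> M"
        using M(5) by (intro convex_at_level[OF M(1,2,4)]) auto
      then obtain s where s: "(s, 1) \<in> M" by blast
      define i where "i = \<lfloor>s\<rfloor>"
      define M' where M': "M' = {(x, y). (1 * x + (- of_int (- i)) * y + 0, 0 * x + 1 * y + 0) \<in> M}"
      have inM': "(x, y) \<in> M' \<longleftrightarrow> (x + of_int i * y, y) \<in> M" for x y by (simp add: M')
      have "convex M'" unfolding M' by (rule convex_affine_preimage[OF M(1)])
      moreover have "0 < x \<and> x < 1" if "(x, 1) \<in> M'" for x
        using row_between_integers[OF M(1) M(7) s, of "x + of_int i"] that by (simp add: inM' i_def)
      ultimately have "narrow 1 0 M'"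
        using M(2-6) by (intro tall_narrow[where t = "t - of_int i * c" and a = c]) (auto simp: inM')
      from narrow_unshear[OF M' this] show ?thesis by (intro exI[of _ "- i"]) simp
    qed
    consider "b \<le> 1" | "a \<le> 1" | "1 < a" "1 < b" by linarith
    then show ?thesis
    proof cases
      case 1
      have "\<exists>i::int. narrow 1 (of_int i) S"
        by (rule tall[OF S(1) base Ta]) (use ab 1 bd free1 in \<open>force+\<close>)
      then show ?thesis using thinI[of 1 _ S] by auto
    next
      case 2
      have "\<exists>i::int. narrow 1 (of_int i) (mirror_y S)"
      proof (rule tall[OF convex_mirror_y[OF S(1)]])
        show "(0, 0) \<in> mirror_y S" "(1, 0) \<in> mirror_y S" "(fst U, b) \<in> mirror_y S" using base Ub by auto
        show "7 / 3 < b" using ab 2 by argo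
        show "- 1 \<le> y" if "(x, y) \<in> mirror_y S" for x y using bd[of x "- y"] that 2 by simp
        show "(of_int i, 1) \<notin> mirror_y S" for i using free2 by simp
      qed
      then obtain i :: int where "narrow 1 (- of_int i) S" using narrow_mirror_y by blast
      then show ?thesis using thinI[of 1 "- i" S] by simp
    next
      case 3
      have "((0 * (a - 1) + fst T * (1 - 0)) / (a - 0), 1) \<in> S"
        using 3 by (intro convex_at_level[OF S(1) base(1) Ta]) auto
      then obtain s where s: "(s, 1) \<in> S" by blast
      have "((fst U * (0 - - 1) + 0 * (- 1 - - b)) / (0 - - b), - 1) \<in> S"
        using 3 by (intro convex_at_level[OF S(1) Ub base(1)]) auto
      then obtain r where r: "(r, - 1) \<in> S" by blast
      define i where "i = \<lfloor>s\<rfloor>"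
      define j where "j = \<lfloor>r\<rfloor>"
      \<comment> \<open>Half the difference of the floors, so that one shear and a translation move
        both rows over \<open>(0, 1)\<close>.\<close>
      define \<mu> :: real where "\<mu> = (of_int j - of_int i) / 2"
      define S' where S': "S' = {(x, y). (1 * x + (- \<mu>) * y + (of_int i + \<mu>), 0 * x + 1 * y + 0) \<in> S}"
      have inS': "(x, y) \<in> S' \<longleftrightarrow> (x - \<mu> * y + (of_int i + \<mu>), y) \<in> S" for x y by (simp add: S')
      have 2: "2 * \<mu> = of_int j - of_int i" by (simp add: \<mu>_def)
      have rowt: "0 < x \<and> x < 1" if "(x, 1) \<in> S'" for x
        using row_between_integers[OF S(1) free1 s, of "x + of_int i"] that by (simp add: inS' i_def)
      have rowb: "0 < x \<and> x < 1" if "(x, - 1) \<in> S'" for x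
      proof -
        have eq: "x - \<mu> * - 1 + (of_int i + \<mu>) = x + of_int j" using 2 by simp
        have "(x + of_int j, - 1) \<in> S" using that unfolding inS' eq .
        then show ?thesis
          using row_between_integers[OF S(1) free2 r, of "x + of_int j"] by (simp add: j_def)
      qed
      interpret pinched S' "a - 1" "b - 1" "fst T + \<mu> * a - (of_int i + \<mu>)" "fst U - \<mu> * b - (of_int i + \<mu>)"
      proof
        show "convex S'" unfolding S' by (rule convex_affine_preimage[OF S(1)])
        show "4 / 3 < a - 1 + (b - 1)" using ab by argo
        show "- 1 - (b - 1) \<le> y \<and> y \<le> 1 + (a - 1)" if "(x, y) \<in> S'" for x y
          using bd that unfolding inS' by fastforce
      qed (use 3 Ta Ub rowt rowb in \<open>auto simp: inS'\<close>)
      have "(s - of_int i, 1) \<in> S'" "(r - of_int j, - 1) \<in> S'" using s r 2 by (auto simp: inS')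
      note rows = this
      \<comment> \<open>The midpoint of a point of each row: it has height 0 and abscissa in
        \<open>(0, 1)\<close>.\<close>
      define e where "e = ((r - of_int j) * (1 - 0) + (s - of_int i) * (0 - - 1)) / (1 - - 1)"
      have e: "(e, 0) \<in> S'" unfolding e_def by (rule convex_at_level[OF conv rows(2,1)]) auto
      have e01: "0 < e" "e < 1" using rowt[OF rows(1)] rowb[OF rows(2)] by (auto simp: e_def)
      \<comment> \<open>The left end of the lattice segment in the new coordinates, equal to
        \<open>- (i + j) / 2\<close>; its integrality is the parity of \<open>i + j\<close>.\<close>
      define c where "c = - (of_int i + \<mu>)"
      have c: "(c, 0) \<in> S'" "(c + 1, 0) \<in> S'" using base by (auto simp: inS' c_def)
      have c2: "2 * c = of_int (- i - j)" using 2 by (simp add: c_def algebra_simps)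
      show ?thesis
      proof (cases "even (i + j)")
        case True
        then obtain d where d: "i + j = 2 * d" by blast
        have ci: "c = of_int (- d)" using c2 d by (simp flip: of_int_add)
        have \<mu>i: "\<mu> = of_int (d - i)" using c_def ci by simp
        \<comment> \<open>If the segment is not \<open>[0, 1]\<close>, it lies beyond
          \<open>- 1\<close> or 2, and convexity with \<open>(e, 0)\<close> supplies that lattice
          point. The odd case is alike with \<open>- (1 / 2)\<close> and
          \<open>3 / 2\<close>.\<close>
        have "(- 1, 0) \<in> S' \<or> (2, 0) \<in> S' \<or> (0, 0) \<in> S' \<and> (1, 0) \<in> S'"
        proof -
          consider "- d = 0" | "- d \<le> - 1" | "1 \<le> - d" by linarith
          then show ?thesis
          proof cases
            case 1
            then show ?thesis using c ci by simp
          next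
            case 2
            then have "c \<le> - 1" unfolding ci by linarith
            then have "(- 1, 0) \<in> S'" using convex_row[OF conv c(1) e, of "- 1"] e01 by simp
            then show ?thesis ..
          next
            case 3
            then have "1 \<le> c" unfolding ci by linarith
            then have "(2, 0) \<in> S'" using convex_row[OF conv e c(2), of 2] e01 by simp
            then show ?thesis by blast
          qed
        qed
        from even_narrow[OF this] obtain q :: int where "narrow 1 (of_int q) S'"
          by (metis of_int_0 of_int_1 of_int_minus)
        from narrow_unshear[OF S' this] have "narrow (of_int 1) (of_int (d - i + q)) S" by (simp add: \<mu>i)
        then show ?thesis by (rule thinI) simp
      next
        case False
        then obtain d where d: "i + j = 2 * d + 1" using oddE by blast
        have ci: "c = of_int (- d) - 1 / 2" using c2 d by (simp flip: of_int_add)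
        have \<mu>i: "\<mu> = of_int (d - i) + 1 / 2" using c_def ci by simp
        have "(- (1 / 2), 0) \<in> S' \<or> (3 / 2, 0) \<in> S'"
        proof (cases "- d \<le> 0")
          case True
          then have "c \<le> - (1 / 2)" unfolding ci by linarith
          then show ?thesis using convex_row[OF conv c(1) e, of "- (1 / 2)"] e01 by simp
        next
          case False
          then have "1 / 2 \<le> c" unfolding ci by linarith
          then show ?thesis using convex_row[OF conv e c(2), of "3 / 2"] e01 by simp
        qed
        from odd_narrow[OF this] show ?thesis
        proof
          assume "narrow 1 (1 / 2) S'"
          from narrow_unshear[OF S' this] have "narrow (of_int 1) (of_int (d - i + 1)) S" by (simp add: \<mu>i add.commute)
          then show ?thesis by (rule thinI) simp
        next
          assume "narrow 1 (- (1 / 2)) S'"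
          from narrow_unshear[OF S' this] have "narrow (of_int 1) (of_int (d - i)) S" by (simp add: \<mu>i)
          then show ?thesis by (rule thinI) simp
        qed
      qed
    qed
  qed
qed

section \<open>Unimodular lattice triangles\<close>

definition integer_triangle :: "(real \<times> real) set \<Rightarrow> bool" where
  "integer_triangle S \<longleftrightarrow> (\<exists>x y a b c d :: int. \<bar>a * d - b * c\<bar> = 1 \<and> (of_int x, of_int y) \<in> S \<and>
     (of_int (x + a), of_int (y + b)) \<in> S \<and> (of_int (x + c), of_int (y + d)) \<in> S)"

definition lattice_points :: "(real \<times> real) set \<Rightarrow> (int \<times> int) set" where
  "lattice_points S = {(x, y). (of_int x, of_int y) \<in> S}"

text \<open>Bezout coefficients complete the primitive vector to a lattice basis in which the
  segment becomes \<open>[0, 1]\<close> at height 0. A lattice point at height 1 or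
  \<open>- 1\<close> would complete a unimodular triangle.\<close>

lemma thin_of_primitive_segment:
  fixes x y a b :: int
  assumes S: "convex S" "compact S" "\<not> integer_triangle S"
    and P: "(of_int x, of_int y) \<in> S" "(of_int (x + a), of_int (y + b)) \<in> S" and cop: "coprime a b"
  shows "thin (10 / 3) S"
proof -
  obtain u w where uw: "u * a + w * b = 1" using bezout_int[of a b] cop by auto
  have uwr: "of_int u * of_int a + of_int w * of_int b = (1::real)"
    by (metis uw of_int_1 of_int_add of_int_mult)
  define S' where S': "S' = {(X, Y). (of_int a * X + (- of_int w) * Y + of_int x, of_int b * X + of_int u * Y + of_int y) \<in> S}"
  define F :: "real \<times> real \<Rightarrow> real \<times> real" where "F = (\<lambda>P. (of_int u * (fst P - of_int x) + of_int w * (snd P - of_int y),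
      of_int a * (snd P - of_int y) - of_int b * (fst P - of_int x)))"
  have inv: "of_int a * fst (F P) + (- of_int w) * snd (F P) + of_int x = fst P"
    "of_int b * fst (F P) + of_int u * snd (F P) + of_int y = snd P" for P
  proof -
    have "of_int a * fst (F P) + (- of_int w) * snd (F P) + of_int x
        = (of_int u * of_int a + of_int w * of_int b) * (fst P - of_int x) + of_int x"
      by (simp add: F_def algebra_simps)
    then show "of_int a * fst (F P) + (- of_int w) * snd (F P) + of_int x = fst P" by (simp add: uwr)
    have "of_int b * fst (F P) + of_int u * snd (F P) + of_int y
        = (of_int u * of_int a + of_int w * of_int b) * (snd P - of_int y) + of_int y"
      by (simp add: F_def algebra_simps)
    then show "of_int b * fst (F P) + of_int u * snd (F P) + of_int y = snd P" by (simp add: uwr)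
  qed
  have FS: "F P \<in> S'" if "P \<in> S" for P
    using that inv[of P] by (simp add: S' case_prod_unfold)
  have cpt: "compact S'" unfolding S'
    by (rule compact_affine_preimage[OF S(2)]) (use uwr in \<open>simp add: algebra_simps\<close>)
  have cvx: "convex S'" unfolding S' by (rule convex_affine_preimage[OF S(1)])
  have base: "(0, 0) \<in> S'" "(1, 0) \<in> S'" using P by (simp_all add: S' add.commute)
  have free1: "(of_int i, 1) \<notin> S'" for i
  proof
    assume "(of_int i, 1) \<in> S'"
    then have "(of_int (x + (a * i - w)), of_int (y + (b * i + u))) \<in> S"
      by (simp add: S' add.commute)
    moreover have "a * (b * i + u) - b * (a * i - w) = u * a + w * b" by (simp add: algebra_simps)
    then have "\<bar>a * (b * i + u) - b * (a * i - w)\<bar> = 1" using uw by simp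
    ultimately show False using S(3) P unfolding integer_triangle_def by blast
  qed
  have free2: "(of_int i, - 1) \<notin> S'" for i
  proof
    assume "(of_int i, - 1) \<in> S'"
    then have "(of_int (x + (a * i + w)), of_int (y + (b * i - u))) \<in> S"
      by (simp add: S' add.commute)
    moreover have "a * (b * i - u) - b * (a * i + w) = - (u * a + w * b)" by (simp add: algebra_simps)
    then have "\<bar>a * (b * i - u) - b * (a * i + w)\<bar> = 1" using uw by simp
    ultimately show False using S(3) P unfolding integer_triangle_def by blast
  qed
  have "thin (10 / 3) S'" by (rule thin_of_unit_row[OF cvx cpt base free1 free2])
  then obtain p q :: int where pq: "p \<noteq> 0 \<or> q \<noteq> 0"
    and le: "\<And>P Q. P \<in> S' \<Longrightarrow> Q \<in> S' \<Longrightarrow> of_int p * (fst P - fst Q) + of_int q * (snd P - snd Q) \<le> 10 / 3"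
    unfolding thin_def by blast
  \<comment> \<open>The narrow direction pulled back to the original coordinates; it is nonzero as
    this change of directions is invertible.\<close>
  define p' q' where "p' = p * u - q * b" and "q' = p * w + q * a"
  have "a * p' + b * q' = p * (u * a + w * b)" "u * q' - w * p' = q * (u * a + w * b)"
    by (simp_all add: p'_def q'_def algebra_simps)
  then have "p' \<noteq> 0 \<or> q' \<noteq> 0" using pq uw by auto
  moreover have "of_int p' * (fst P - fst Q) + of_int q' * (snd P - snd Q) \<le> 10 / 3" if "P \<in> S" "Q \<in> S" for P Q
    using le[OF FS[OF that(1)] FS[OF that(2)]] by (simp add: F_def p'_def q'_def algebra_simps)
  ultimately show ?thesis unfolding thin_def by blast
qed

lemma thin_of_two_lattice_points:
  assumes S: "convex S" "compact S" "\<not> integer_triangle S"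
    and z: "z \<in> lattice_points S" "z' \<in> lattice_points S" "z \<noteq> z'"
  shows "thin (10 / 3) S"
proof -
  obtain x y x' y' where xy: "z = (x, y)" "z' = (x', y')" by (metis surj_pair)
  define g where "g = gcd (x' - x) (y' - y)"
  have "x' - x \<noteq> 0 \<or> y' - y \<noteq> 0" using z(3) xy by auto
  then have g: "0 < g" and cop: "coprime ((x' - x) div g) ((y' - y) div g)"
    unfolding g_def by (auto intro: div_gcd_coprime)
  define a b where "a = (x' - x) div g" and "b = (y' - y) div g"
  have ab: "x' = x + g * a" "y' = y + g * b" by (simp_all add: a_def b_def g_def)
  define t :: real where "t = 1 / of_int g"
  have t: "0 \<le> t" "t \<le> 1" "t * of_int g = 1" using g by (auto simp: t_def)
  have "(1 - t) *\<^sub>R (of_int x, of_int y) + t *\<^sub>R (of_int x', of_int y') \<in> S"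
    using z t xy by (intro convexD[OF S(1)]) (auto simp: lattice_points_def)
  moreover have "(1 - t) * of_int x + t * of_int x' = of_int x + (t * of_int g) * of_int a"
    "(1 - t) * of_int y + t * of_int y' = of_int y + (t * of_int g) * of_int b"
    by (simp_all add: ab algebra_simps)
  ultimately have "(of_int (x + a), of_int (y + b)) \<in> S" by (simp add: t(3))
  then show ?thesis
    using z xy cop by (intro thin_of_primitive_segment[OF S, of x y a b]) (auto simp: lattice_points_def a_def b_def)
qed

lemma finite_lattice_points:
  assumes "bounded S"
  shows "finite (lattice_points S)"
proof -
  obtain M where M: "\<And>P. P \<in> S \<Longrightarrow> norm P \<le> M" using assms by (auto simp: bounded_iff)
  define N where "N = \<lceil>M\<rceil>"
  have "lattice_points S \<subseteq> {- N..N} \<times> {- N..N}"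
  proof
    fix z assume z: "z \<in> lattice_points S"
    obtain x y where xy: "z = (x, y)" by (cases z)
    have "norm (of_int x :: real, of_int y :: real) \<le> M" using M z xy by (simp add: lattice_points_def)
    then have "\<bar>of_int x\<bar> \<le> M" "\<bar>of_int y\<bar> \<le> M"
      using norm_fst_le[of "of_int x :: real" "of_int y :: real"] norm_snd_le[of "of_int y :: real" "of_int x :: real"] by auto
    then have "\<bar>x\<bar> \<le> N" "\<bar>y\<bar> \<le> N" unfolding N_def by linarith+
    then show "z \<in> {- N..N} \<times> {- N..N}" by (auto simp: xy)
  qed
  then show ?thesis by (rule finite_subset) simp
qed

text \<open>The added point \<open>z\<close> minimises the number of lattice points of the hull: any other new lattice
  point of that hull would give a smaller hull.\<close>

lemma add_lattice_point:
  fixes S :: "(real \<times> real) set"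
  assumes S: "convex S" "compact S" "S \<noteq> {}"
  obtains S' z where "convex S'" "compact S'" "S \<subseteq> S'" "z \<notin> lattice_points S"
    "lattice_points S' = insert z (lattice_points S)"
proof -
  define r :: "int \<times> int \<Rightarrow> real \<times> real" where "r = (\<lambda>(x, y). (of_int x, of_int y))"
  have r: "z \<in> lattice_points T \<longleftrightarrow> r z \<in> T" for z T by (cases z) (simp add: r_def lattice_points_def)
  have rinj: "r z = r w \<longleftrightarrow> z = w" for z w by (cases z; cases w) (simp add: r_def)
  define K where "K = (\<lambda>z. convex hull (insert (r z) S))"
  have K: "convex (K z)" "compact (K z)" "S \<subseteq> K z" "r z \<in> K z" for z
    using S by (auto simp: K_def intro!: compact_convex_hull hull_inc)
  have fin: "finite (lattice_points (K z))" for z by (intro finite_lattice_points compact_imp_bounded K)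
  have Kmem: "\<exists>t p. 0 \<le> t \<and> t \<le> 1 \<and> p \<in> S \<and> x = (1 - t) *\<^sub>R p + t *\<^sub>R r z" if x: "x \<in> K z" for x z
  proof -
    obtain u v b where "0 \<le> u" "0 \<le> v" "u + v = 1" "b \<in> S" "x = u *\<^sub>R r z + v *\<^sub>R b"
      using x unfolding K_def convex_hull_insert[OF S(3)] hull_same[of convex, OF S(1)] by blast
    moreover from this have "v = 1 - u" by simp
    ultimately show ?thesis by (intro exI[of _ u] exI[of _ b]) (simp add: add.commute)
  qed
  have "lattice_points S \<noteq> UNIV"
    using finite_lattice_points[OF compact_imp_bounded[OF S(2)]] by (metis finite_prod infinite_UNIV_int)
  then obtain z0 where "z0 \<notin> lattice_points S" by blast
  then obtain z where z: "z \<notin> lattice_points S"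
    and min: "\<And>w. w \<notin> lattice_points S \<Longrightarrow> card (lattice_points (K z)) \<le> card (lattice_points (K w))"
    using ex_has_least_nat[of "\<lambda>z. z \<notin> lattice_points S" z0 "\<lambda>z. card (lattice_points (K z))"] by blast
  have "w = z" if w: "w \<in> lattice_points (K z)" "w \<notin> lattice_points S" for w
  proof (rule ccontr)
    assume "w \<noteq> z"
    have "K w \<subseteq> K z"
    proof -
      have "convex hull (insert (r w) S) \<subseteq> K z" using w K[of z] r by (intro hull_minimal) auto
      then show ?thesis by (simp add: K_def)
    qed
    then have "lattice_points (K w) \<subseteq> lattice_points (K z)" by (auto simp: lattice_points_def)
    moreover have "z \<notin> lattice_points (K w)"
    proof
      \<comment> \<open>If each of \<open>z\<close> and \<open>w\<close> lies in the other's hull,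
        substitution writes \<open>r w\<close> as a combination of \<open>p\<close>,
        \<open>q\<close> and itself with weight \<open>s * t < 1\<close>; solving for it puts
        \<open>w\<close> into \<open>S\<close>.\<close>
      assume "z \<in> lattice_points (K w)"
      then obtain t q where t: "0 \<le> t" "t \<le> 1" "q \<in> S" "r z = (1 - t) *\<^sub>R q + t *\<^sub>R r w"
        using Kmem r by blast
      obtain s p where s: "0 \<le> s" "s \<le> 1" "p \<in> S" "r w = (1 - s) *\<^sub>R p + s *\<^sub>R r z"
        using Kmem w(1) r by blast
      show False
      proof (cases "s = 1 \<and> t = 1")
        case True
        then show False using s \<open>w \<noteq> z\<close> rinj by simp
      next
        case False
        have "s * t \<le> s * 1" using s t by (intro mult_left_mono) auto
        moreover have "s * t \<le> 1 * t" using s t by (intro mult_right_mono) auto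
        moreover have "s < 1 \<or> t < 1" using False s t by linarith
        ultimately have "s * t < 1" by linarith
        have "r w = (1 - s) *\<^sub>R p + (s * (1 - t)) *\<^sub>R q + (s * t) *\<^sub>R r w"
          by (subst s(4), subst t(4)) (simp add: algebra_simps)
        then have "r w - (s * t) *\<^sub>R r w = (1 - s) *\<^sub>R p + (s * (1 - t)) *\<^sub>R q"
          by (simp only: diff_eq_eq)
        then have 1: "(1 - s * t) *\<^sub>R r w = (1 - s) *\<^sub>R p + (s * (1 - t)) *\<^sub>R q"
          by (simp only: scaleR_diff_left scaleR_one)
        have "r w = (1 / (1 - s * t)) *\<^sub>R ((1 - s * t) *\<^sub>R r w)"
          using \<open>s * t < 1\<close> by simp
        also have "\<dots> = (1 / (1 - s * t)) *\<^sub>R ((1 - s) *\<^sub>R p + (s * (1 - t)) *\<^sub>R q)"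
          by (simp only: 1)
        also have "\<dots> = ((1 - s) / (1 - s * t)) *\<^sub>R p + ((s * (1 - t)) / (1 - s * t)) *\<^sub>R q"
          by (simp add: scaleR_right_distrib)
        finally have "r w = ((1 - s) / (1 - s * t)) *\<^sub>R p + ((s * (1 - t)) / (1 - s * t)) *\<^sub>R q" .
        moreover have "((1 - s) / (1 - s * t)) *\<^sub>R p + ((s * (1 - t)) / (1 - s * t)) *\<^sub>R q \<in> S"
        proof (rule convexD[OF S(1)])
          show "(1 - s) / (1 - s * t) + (s * (1 - t)) / (1 - s * t) = 1"
            using \<open>s * t < 1\<close> by (simp add: add_divide_distrib[symmetric] algebra_simps)
        qed (use s t \<open>s * t < 1\<close> in auto)
        ultimately show False using w(2) r by simp
      qed
    qed
    ultimately have "lattice_points (K w) \<subset> lattice_points (K z)"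
      using K(4)[of z] r by blast
    then have "card (lattice_points (K w)) < card (lattice_points (K z))"
      by (rule psubset_card_mono[OF fin])
    with min[OF w(2)] show False by simp
  qed
  moreover have "lattice_points S \<subseteq> lattice_points (K z)" "z \<in> lattice_points (K z)"
    using K(3,4)[of z] r by blast+
  ultimately have "lattice_points (K z) = insert z (lattice_points S)" by blast
  with K[of z] z show ?thesis by (intro that)
qed

lemma no_integer_triangle_two_points:
  assumes "lattice_points S \<subseteq> {z, w}"
  shows "\<not> integer_triangle S"
proof
  assume "integer_triangle S"
  then obtain x y a b c d :: int where t: "\<bar>a * d - b * c\<bar> = 1"
    "(x, y) \<in> lattice_points S" "(x + a, y + b) \<in> lattice_points S" "(x + c, y + d) \<in> lattice_points S"
    by (auto simp: integer_triangle_def lattice_points_def)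
  then have "(x, y) = (x + a, y + b) \<or> (x, y) = (x + c, y + d) \<or> (x + a, y + b) = (x + c, y + d)"
    using assms by blast
  with t(1) show False by auto
qed

text \<open>The body is enlarged until it contains two lattice points. If lattice points had to be
  added, exactly two result and cannot contain a unimodular triangle; thinness passes to
  subsets.\<close>

theorem thin_of_no_integer_triangle:
  fixes S :: "(real \<times> real) set"
  assumes S: "convex S" "compact S" "\<not> integer_triangle S"
  shows "thin (10 / 3) S"
proof (cases "S = {}")
  case True
  then show ?thesis by (auto simp: thin_def intro: exI[of _ 1])
next
  case False
  consider (two) z w where "z \<in> lattice_points S" "w \<in> lattice_points S" "z \<noteq> w"
    | (one) z where "lattice_points S = {z}" | (none) "lattice_points S = {}"
    by (metis insertCI is_singletonI' is_singleton_def)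
  then show ?thesis
  proof cases
    case two
    then show ?thesis by (rule thin_of_two_lattice_points[OF S])
  next
    case one
    obtain S1 w where S1: "convex S1" "compact S1" "S \<subseteq> S1" "w \<notin> lattice_points S" "lattice_points S1 = insert w (lattice_points S)"
      using add_lattice_point[OF S(1,2) False] .
    have "thin (10 / 3) S1"
      by (rule thin_of_two_lattice_points[OF S1(1,2) no_integer_triangle_two_points[of _ w z], of z w])
        (use S1 one in auto)
    then show ?thesis using S1(3) by (rule thin_mono)
  next
    case none
    obtain S1 w where S1: "convex S1" "compact S1" "S \<subseteq> S1" "w \<notin> lattice_points S" "lattice_points S1 = insert w (lattice_points S)"
      using add_lattice_point[OF S(1,2) False] .
    have "S1 \<noteq> {}" using S1(3) False by blast
    obtain S2 v where S2: "convex S2" "compact S2" "S1 \<subseteq> S2" "v \<notin> lattice_points S1" "lattice_points S2 = insert v (lattice_points S1)"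
      using add_lattice_point[OF S1(1,2) \<open>S1 \<noteq> {}\<close>] .
    have "thin (10 / 3) S2"
      by (rule thin_of_two_lattice_points[OF S2(1,2) no_integer_triangle_two_points[of _ v w], of v w])
        (use S1 S2 none in auto)
    then show ?thesis using S1(3) S2(3) by (blast intro: thin_mono)
  qed
qed

section \<open>A direction of minimal width\<close>

text \<open>Dirichlet approximation of the slope gives an integral direction nearly orthogonal to
  the line; the width is even at most 1.\<close>

lemma thin_of_collinear:
  fixes S :: "(real \<times> real) set"
  assumes bnd: "\<And>P Q. P \<in> S \<Longrightarrow> Q \<in> S \<Longrightarrow> \<bar>fst P - fst Q\<bar> \<le> R"
    and line: "\<And>P Q. P \<in> S \<Longrightarrow> Q \<in> S \<Longrightarrow> snd P - snd Q = \<theta> * (fst P - fst Q)"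
  shows "thin 2 S"
proof -
  define N where "N = nat \<lceil>R\<rceil> + 1"
  have N: "0 < N" "R \<le> real N" unfolding N_def by linarith+
  obtain h k where hk: "0 < k" "\<bar>of_int k * \<theta> - of_int h\<bar> < 1 / real N"
    using Dirichlet_approx[OF N(1), of \<theta>] by blast
  have "of_int (- h) * (fst P - fst Q) + of_int k * (snd P - snd Q) \<le> 2" if "P \<in> S" "Q \<in> S" for P Q
  proof -
    have "of_int (- h) * (fst P - fst Q) + of_int k * (snd P - snd Q) = (of_int k * \<theta> - of_int h) * (fst P - fst Q)"
      unfolding line[OF that] by (simp add: algebra_simps)
    also have "\<dots> \<le> \<bar>of_int k * \<theta> - of_int h\<bar> * \<bar>fst P - fst Q\<bar>" by (metis abs_ge_self abs_mult)
    also have "\<dots> \<le> (1 / real N) * real N"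
      using hk(2) bnd[OF that] N by (intro mult_mono) auto
    finally show ?thesis using N by simp
  qed
  then show ?thesis using hk(1) unfolding thin_def by (intro exI[of _ "- h"] exI[of _ k]) auto
qed

text \<open>A narrow direction takes bounded values on two independent edge vectors, and Cramer's
  rule then bounds its coefficients.\<close>

lemma finite_narrow_directions:
  fixes S :: "(real \<times> real) set"
  assumes P: "P0 \<in> S" "P1 \<in> S" "P2 \<in> S"
    and det: "(fst P1 - fst P0) * (snd P2 - snd P0) \<noteq> (snd P1 - snd P0) * (fst P2 - fst P0)"
  shows "finite {(p, q). \<forall>P\<in>S. \<forall>Q\<in>S. of_int p * (fst P - fst Q) + of_int q * (snd P - snd Q) \<le> w}"
    (is "finite ?E")
proof -
  define a1 a2 b1 b2 where "a1 = fst P1 - fst P0" and "a2 = snd P1 - snd P0" and "b1 = fst P2 - fst P0" and "b2 = snd P2 - snd P0"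
  define \<delta> where "\<delta> = a1 * b2 - a2 * b1"
  have \<delta>: "\<delta> \<noteq> 0" using det by (simp add: \<delta>_def a1_def a2_def b1_def b2_def)
  define M where "M = \<lceil>w * (\<bar>a1\<bar> + \<bar>a2\<bar> + \<bar>b1\<bar> + \<bar>b2\<bar>) / \<bar>\<delta>\<bar>\<rceil>"
  have "?E \<subseteq> {- M..M} \<times> {- M..M}"
  proof clarify
    fix p q :: int assume *: "\<forall>P\<in>S. \<forall>Q\<in>S. of_int p * (fst P - fst Q) + of_int q * (snd P - snd Q) \<le> w"
    define u where "u = of_int p * a1 + of_int q * a2"
    define v where "v = of_int p * b1 + of_int q * b2"
    have "u \<le> w" "- u \<le> w" "v \<le> w" "- v \<le> w"
      using *[rule_format, OF P(2) P(1)] *[rule_format, OF P(1) P(2)] *[rule_format, OF P(3) P(1)] *[rule_format, OF P(1) P(3)]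
      by (simp_all add: u_def v_def a1_def a2_def b1_def b2_def algebra_simps)
    then have uv: "\<bar>u\<bar> \<le> w" "\<bar>v\<bar> \<le> w" by auto
    have est: "\<bar>u * s - v * t\<bar> \<le> w * (\<bar>a1\<bar> + \<bar>a2\<bar> + \<bar>b1\<bar> + \<bar>b2\<bar>)"
      if "\<bar>s\<bar> + \<bar>t\<bar> \<le> \<bar>a1\<bar> + \<bar>a2\<bar> + \<bar>b1\<bar> + \<bar>b2\<bar>" for s t
    proof -
      have "\<bar>u * s - v * t\<bar> \<le> \<bar>u\<bar> * \<bar>s\<bar> + \<bar>v\<bar> * \<bar>t\<bar>" by (metis abs_mult abs_triangle_ineq4)
      also have "\<dots> \<le> w * \<bar>s\<bar> + w * \<bar>t\<bar>" using uv by (intro add_mono mult_right_mono) auto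
      also have "\<dots> = w * (\<bar>s\<bar> + \<bar>t\<bar>)" by (simp add: algebra_simps)
      also have "\<dots> \<le> w * (\<bar>a1\<bar> + \<bar>a2\<bar> + \<bar>b1\<bar> + \<bar>b2\<bar>)" using that uv by (intro mult_left_mono) auto
      finally show ?thesis .
    qed
    have bound: "\<bar>z\<bar> \<le> M" if "of_int z * \<delta> = u * s - v * t" "\<bar>s\<bar> + \<bar>t\<bar> \<le> \<bar>a1\<bar> + \<bar>a2\<bar> + \<bar>b1\<bar> + \<bar>b2\<bar>" for z :: int and s t
    proof -
      have "\<bar>of_int z\<bar> * \<bar>\<delta>\<bar> \<le> w * (\<bar>a1\<bar> + \<bar>a2\<bar> + \<bar>b1\<bar> + \<bar>b2\<bar>)"
        using est[OF that(2)] unfolding abs_mult[symmetric] that(1) .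
      then have "\<bar>of_int z\<bar> \<le> w * (\<bar>a1\<bar> + \<bar>a2\<bar> + \<bar>b1\<bar> + \<bar>b2\<bar>) / \<bar>\<delta>\<bar>"
        using \<delta> by (simp add: pos_le_divide_eq)
      then show ?thesis unfolding M_def by linarith
    qed
    have "\<bar>p\<bar> \<le> M" by (rule bound[of p b2 a2]) (auto simp: u_def v_def \<delta>_def algebra_simps)
    moreover have "\<bar>q\<bar> \<le> M" by (rule bound[of q "- b1" "- a1"]) (auto simp: u_def v_def \<delta>_def algebra_simps)
    ultimately show "p \<in> {- M..M} \<and> q \<in> {- M..M}" by auto
  qed
  then show ?thesis by (rule finite_subset) simp
qed

theorem thin_of_no_real_triangle:
  fixes S :: "(real \<times> real) set"
  assumes S: "convex S" "compact S" and free: "\<not> real_triangle S"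
  shows "thin 2 S"
proof (rule ccontr)
  assume nthin: "\<not> thin 2 S"
  then have wide: "\<exists>P\<in>S. \<exists>Q\<in>S. 2 < of_int p * (fst P - fst Q) + of_int q * (snd P - snd Q)"
    if "p \<noteq> 0 \<or> q \<noteq> 0" for p q :: int
    using that unfolding thin_def by (meson not_le)
  then have "S \<noteq> {}" by (metis empty_iff zero_neq_one)
  define d :: "int \<times> int \<Rightarrow> (real \<times> real) \<times> (real \<times> real) \<Rightarrow> real" where
    "d = (\<lambda>(p, q) (P, Q). of_int p * (fst P - fst Q) + of_int q * (snd P - snd Q))"
  have "\<exists>Z\<in>S \<times> S. \<forall>Y\<in>S \<times> S. d u Y \<le> d u Z" for u
  proof (rule continuous_attains_sup)
    show "compact (S \<times> S)" "S \<times> S \<noteq> {}" using S \<open>S \<noteq> {}\<close> by (auto intro: compact_Times)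
    show "continuous_on (S \<times> S) (d u)"
      unfolding d_def case_prod_unfold by (intro continuous_intros)
  qed
  then obtain Z where Z: "\<And>u. Z u \<in> S \<times> S" "\<And>u Y. Y \<in> S \<times> S \<Longrightarrow> d u Y \<le> d u (Z u)" by metis
  define w where "w u = d u (Z u)" for u
  have w2: "2 < w (p, q)" if nz: "p \<noteq> 0 \<or> q \<noteq> 0" for p q
  proof -
    obtain P Q where "P \<in> S" "Q \<in> S" "2 < d (p, q) (P, Q)" using wide[OF nz] unfolding d_def case_prod_conv by blast
    then show ?thesis using Z(2)[of "(P, Q)" "(p, q)"] by (auto simp: w_def)
  qed
  have dw: "of_int p * (fst P - fst Q) + of_int q * (snd P - snd Q) \<le> w (p, q)" if "P \<in> S" "Q \<in> S" for p q P Q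
    using Z(2)[of "(P, Q)" "(p, q)"] that by (simp add: w_def d_def)
  have wd: "\<exists>P\<in>S. \<exists>Q\<in>S. w (p, q) = of_int p * (fst P - fst Q) + of_int q * (snd P - snd Q)" for p q
  proof -
    obtain P Q where PQ: "Z (p, q) = (P, Q)" by (cases "Z (p, q)")
    then have "P \<in> S" "Q \<in> S" using Z(1)[of "(p, q)"] by auto
    then show ?thesis by (intro bexI[of _ P] bexI[of _ Q]) (simp_all add: w_def d_def PQ)
  qed
  obtain P0 P1 where P01: "P0 \<in> S" "P1 \<in> S" "2 < fst P1 - fst P0"
    using wide[of 1 0] by auto
  have "\<exists>P2\<in>S. (fst P1 - fst P0) * (snd P2 - snd P0) \<noteq> (snd P1 - snd P0) * (fst P2 - fst P0)"
  proof (rule ccontr)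
    assume "\<not> ?thesis"
    then have *: "(fst P1 - fst P0) * (snd P - snd P0) = (snd P1 - snd P0) * (fst P - fst P0)" if "P \<in> S" for P
      using that by blast
    define \<theta> where "\<theta> = (snd P1 - snd P0) / (fst P1 - fst P0)"
    have **: "snd P - snd P0 = \<theta> * (fst P - fst P0)" if "P \<in> S" for P
      using *[OF that] P01 by (simp add: \<theta>_def nonzero_eq_divide_eq mult.commute)
    have "thin 2 S"
    proof (rule thin_of_collinear)
      show "\<bar>fst P - fst Q\<bar> \<le> w (1, 0)" if "P \<in> S" "Q \<in> S" for P Q
        using dw[OF that, of 1 0] dw[OF that(2,1), of 1 0] by auto
      show "snd P - snd Q = \<theta> * (fst P - fst Q)" if "P \<in> S" "Q \<in> S" for P Q
        using **[OF that(1)] **[OF that(2)] by (simp add: algebra_simps)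
    qed
    with nthin show False ..
  qed
  then obtain P2 where P2: "P2 \<in> S" "(fst P1 - fst P0) * (snd P2 - snd P0) \<noteq> (snd P1 - snd P0) * (fst P2 - fst P0)" by blast
  \<comment> \<open>The directions at most as wide as \<open>y\<close> are finitely many, so the
    minimal width over all nonzero directions is attained.\<close>
  define E where "E = {u. u \<noteq> (0, 0) \<and> w u \<le> w (0, 1)}"
  have "E \<subseteq> {(p, q). \<forall>P\<in>S. \<forall>Q\<in>S. of_int p * (fst P - fst Q) + of_int q * (snd P - snd Q) \<le> w (0, 1)}"
  proof clarify
    fix p q P Q assume "(p, q) \<in> E" "P \<in> S" "Q \<in> S"
    then show "of_int p * (fst P - fst Q) + of_int q * (snd P - snd Q) \<le> w (0, 1)"
      using dw[of P Q p q] by (simp add: E_def)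
  qed
  then have "finite E" using finite_narrow_directions[OF P01(1,2) P2] by (rule finite_subset)
  moreover have "(0, 1) \<in> E" by (simp add: E_def)
  ultimately obtain u where u: "u \<in> E" "\<And>v. v \<in> E \<Longrightarrow> w u \<le> w v"
    using ex_is_arg_min_if_finite[of E w] by (auto simp: is_arg_min_linorder)
  have wmin: "w u \<le> w v" if "v \<noteq> (0, 0)" for v
  proof (cases "v \<in> E")
    case False
    then show ?thesis using that u(1) unfolding E_def by auto
  qed (rule u(2))
  obtain p q where pq: "u = (p, q)" by (cases u)
  have pq0: "p \<noteq> 0 \<or> q \<noteq> 0" using u(1) pq by (auto simp: E_def)
  \<comment> \<open>Dividing a minimal direction by its gcd divides the positive width as
    well.\<close>
  have "gcd p q = 1"
  proof -
    define g where "g = gcd p q"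
    have g: "0 < g" using pq0 by (simp add: g_def)
    define p' q' where "p' = p div g" and "q' = q div g"
    have pq': "p = g * p'" "q = g * q'" by (simp_all add: p'_def q'_def g_def)
    have nz: "p' \<noteq> 0 \<or> q' \<noteq> 0" using pq0 pq' by auto
    obtain P Q where PQ: "P \<in> S" "Q \<in> S" "w (p', q') = of_int p' * (fst P - fst Q) + of_int q' * (snd P - snd Q)"
      using wd by blast
    have "of_int g * w (p', q') \<le> w (p, q)"
      using dw[OF PQ(1,2), of p q] unfolding PQ(3) pq' by (simp add: algebra_simps)
    also have "\<dots> \<le> 1 * w (p', q')" using wmin[of "(p', q')"] nz pq by auto
    finally have "of_int g \<le> (1 :: real)"
      by (rule mult_right_le_imp_le) (use w2[OF nz] in simp)
    with g have "g = 1" by simp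
    then show ?thesis by (simp add: g_def)
  qed
  then obtain r s where rs: "r * p + s * q = 1" using bezout_int[of p q] by metis
  have rsr: "of_int q * of_int s + of_int r * of_int p = (1::real)"
    using rs by (metis add.commute mult.commute of_int_1 of_int_add of_int_mult)
  \<comment> \<open>Lattice coordinates \<open>s x - r y\<close> and \<open>p x + q y\<close>, so
    that the second one is the minimal direction.\<close>
  define S' where "S' = {(x, y). (of_int q * x + of_int r * y + 0, (- of_int p) * x + of_int s * y + 0) \<in> S}"
  have inS': "(x, y) \<in> S' \<longleftrightarrow> (of_int q * x + of_int r * y, of_int s * y - of_int p * x) \<in> S" for x y
    by (simp add: S'_def add.commute)
  have FS: "(of_int s * fst P - of_int r * snd P, of_int p * fst P + of_int q * snd P) \<in> S'" if "P \<in> S" for P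
  proof -
    have "of_int q * (of_int s * fst P - of_int r * snd P) + of_int r * (of_int p * fst P + of_int q * snd P)
        = (of_int q * of_int s + of_int r * of_int p) * fst P"
      "of_int s * (of_int p * fst P + of_int q * snd P) - of_int p * (of_int s * fst P - of_int r * snd P)
        = (of_int q * of_int s + of_int r * of_int p) * snd P"
      by (simp_all add: algebra_simps)
    then show ?thesis unfolding inS' rsr using that by simp
  qed
  have "convex S'" unfolding S'_def by (rule convex_affine_preimage[OF S(1)])
  moreover have "compact S'" unfolding S'_def
    by (rule compact_affine_preimage[OF S(2)]) (use rsr in \<open>simp add: algebra_simps\<close>)
  moreover obtain P Q where PQ: "P \<in> S" "Q \<in> S" "w (p, q) = of_int p * (fst P - fst Q) + of_int q * (snd P - snd Q)"
    using wd by blast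
  define T where "T = (of_int s * fst P - of_int r * snd P, of_int p * fst P + of_int q * snd P)"
  define U where "U = (of_int s * fst Q - of_int r * snd Q, of_int p * fst Q + of_int q * snd Q)"
  have TU: "T \<in> S'" "U \<in> S'" "snd T - snd U = w (p, q)"
    using FS[OF PQ(1)] FS[OF PQ(2)] PQ(3) by (auto simp: T_def U_def algebra_simps)
  have bd: "snd U \<le> snd V \<and> snd V \<le> snd T" if "V \<in> S'" for V
  proof -
    obtain x y where xy: "V = (x, y)" by (cases V)
    define V' where "V' = (of_int q * x + of_int r * y, of_int s * y - of_int p * x)"
    have "V' \<in> S" using that by (simp add: xy inS' V'_def)
    have "of_int p * fst V' + of_int q * snd V' = (of_int q * of_int s + of_int r * of_int p) * y"
      by (simp add: V'_def algebra_simps)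
    then have "snd V = of_int p * fst V' + of_int q * snd V'" unfolding rsr by (simp add: xy)
    moreover have "of_int p * (fst V' - fst Q) + of_int q * (snd V' - snd Q) \<le> w (p, q)"
      "of_int p * (fst P - fst V') + of_int q * (snd P - snd V') \<le> w (p, q)"
      using dw[OF \<open>V' \<in> S\<close> PQ(2)] dw[OF PQ(1) \<open>V' \<in> S\<close>] by blast+
    ultimately show ?thesis using PQ(3) by (simp add: T_def U_def algebra_simps)
  qed
  \<comment> \<open>The direction \<open>X + k Y\<close> pulls back to
    \<open>(s + k * p, k * q - r)\<close>, whose determinant with \<open>(p, q)\<close> is 1, so it
    is nonzero.\<close>
  have wide': "\<exists>V\<in>S'. \<exists>W\<in>S'. snd T - snd U \<le> (fst V - fst W) + of_int k * (snd V - snd W)" for k :: int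
  proof -
    have "(s + k * p) * q - (k * q - r) * p = 1" using rs by (simp add: algebra_simps)
    then have "(s + k * p, k * q - r) \<noteq> (0, 0)" by auto
    then have "w (p, q) \<le> w (s + k * p, k * q - r)" using wmin pq by simp
    moreover obtain X Y where XY: "X \<in> S" "Y \<in> S" "w (s + k * p, k * q - r) =
        of_int (s + k * p) * (fst X - fst Y) + of_int (k * q - r) * (snd X - snd Y)"
      using wd by blast
    ultimately have "snd T - snd U \<le> of_int (s + k * p) * (fst X - fst Y) + of_int (k * q - r) * (snd X - snd Y)"
      by (simp add: TU(3))
    also have "\<dots> = ((of_int s * fst X - of_int r * snd X) - (of_int s * fst Y - of_int r * snd Y))
        + of_int k * ((of_int p * fst X + of_int q * snd X) - (of_int p * fst Y + of_int q * snd Y))"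
      by (simp add: algebra_simps)
    finally show ?thesis using FS[OF XY(1)] FS[OF XY(2)] by force
  qed
  ultimately have "real_triangle S'"
    using TU w2[OF pq0] bd wide' by (intro real_triangle_minimal_width[of S' T U]) auto
  then obtain x y and a b c e :: int where t: "\<bar>a * e - b * c\<bar> = 1" "(x, y) \<in> S'"
    "(x + of_int a, y + of_int b) \<in> S'" "(x + of_int c, y + of_int e) \<in> S'"
    unfolding real_triangle_def by blast
  define x' y' where "x' = of_int q * x + of_int r * y" and "y' = of_int s * y - of_int p * x"
  have shift: "(x' + of_int (q * m + r * n), y' + of_int (s * n - p * m)) \<in> S" if "(x + of_int m, y + of_int n) \<in> S'" for m n :: int
    using that unfolding inS' x'_def y'_def by (simp add: algebra_simps)
  have "(q * a + r * b) * (s * e - p * c) - (s * b - p * a) * (q * c + r * e) = (r * p + s * q) * (a * e - b * c)"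
    by (simp add: algebra_simps)
  then have "\<bar>(q * a + r * b) * (s * e - p * c) - (s * b - p * a) * (q * c + r * e)\<bar> = 1"
    using t(1) rs by simp
  moreover have "(x', y') \<in> S" using t(2) by (simp add: inS' x'_def y'_def)
  ultimately have "real_triangle S"
    using shift[OF t(3)] shift[OF t(4)] unfolding real_triangle_def by blast
  with free show False ..
qed

section \<open>The flatness constants\<close>

definition pair_of :: "real^2 \<Rightarrow> real \<times> real" where
  "pair_of v = (v $ 1, v $ 2)"

lemma convex_pair_of: "convex K \<Longrightarrow> convex (pair_of ` K)"
  by (rule convex_linear_image) (auto simp: pair_of_def intro!: linearI)

lemma compact_pair_of: "compact K \<Longrightarrow> compact (pair_of ` K)"
  by (rule compact_continuous_image[rotated]) (auto simp: pair_of_def[abs_def] intro!: continuous_intros)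

lemma pair_of_vector [simp]: "pair_of (vector [x, y]) = (x, y)"
  by (simp add: pair_of_def)

lemma pair_of_mem_iff: "(x, y) \<in> pair_of ` K \<longleftrightarrow> vector [x, y] \<in> K"
proof
  assume "(x, y) \<in> pair_of ` K"
  then obtain v where "v \<in> K" "x = v $ 1" "y = v $ 2" by (auto simp: pair_of_def)
  moreover from this have "vector [x, y] = v" by (simp add: vec_eq_iff forall_2)
  ultimately show "vector [x, y] \<in> K" by simp
qed (metis pair_of_vector image_eqI)

lemma int_functional_2: "int_functional u x = of_int (u $ 1) * x $ 1 + of_int (u $ 2) * x $ 2"
  for u :: "int^2"
  by (simp add: int_functional_def sum_2)

lemma width_dir_bdd_above:
  assumes "convex_body K"
  shows "bdd_above {\<bar>int_functional u x - int_functional u y\<bar> | x y. x \<in> K \<and> y \<in> K}"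
proof -
  have "compact (int_functional u ` K)" using assms unfolding int_functional_def convex_body_def
    by (intro compact_continuous_image continuous_intros) auto
  then obtain M where M: "\<And>x. x \<in> K \<Longrightarrow> \<bar>int_functional u x\<bar> \<le> M"
    using compact_imp_bounded[of "int_functional u ` K"] by (auto simp: bounded_iff)
  show ?thesis
  proof (rule bdd_aboveI[of _ "2 * M"], clarify)
    fix x y assume "x \<in> K" "y \<in> K"
    then show "\<bar>int_functional u x - int_functional u y\<bar> \<le> 2 * M" using M[of x] M[of y] by linarith
  qed
qed

lemma width_dir_ge:
  assumes "convex_body K" "x \<in> K" "y \<in> K"
  shows "\<bar>int_functional u x - int_functional u y\<bar> \<le> width_dir u K"
  unfolding width_dir_def by (rule cSup_upper[OF _ width_dir_bdd_above[OF assms(1)]]) (use assms in auto)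

lemma lattice_width_le_of_thin:
  fixes K :: "(real^2) set"
  assumes K: "convex_body K" and thin: "thin w (pair_of ` K)"
  shows "lattice_width K \<le> w"
proof -
  obtain p q :: int where pq: "p \<noteq> 0 \<or> q \<noteq> 0"
    and le: "\<And>P Q. P \<in> pair_of ` K \<Longrightarrow> Q \<in> pair_of ` K \<Longrightarrow> of_int p * (fst P - fst Q) + of_int q * (snd P - snd Q) \<le> w"
    using thin unfolding thin_def by blast
  define u :: "int^2" where "u = vector [p, q]"
  have "u \<noteq> 0" using pq by (auto simp: u_def vec_eq_iff forall_2)
  have ne: "K \<noteq> {}" using K by (simp add: convex_body_def)
  have "width_dir u K \<le> w"
    unfolding width_dir_def
  proof (rule cSup_least)
    show "{\<bar>int_functional u x - int_functional u y\<bar> | x y. x \<in> K \<and> y \<in> K} \<noteq> {}" using ne by auto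
    fix t assume "t \<in> {\<bar>int_functional u x - int_functional u y\<bar> | x y. x \<in> K \<and> y \<in> K}"
    then obtain x y where t: "t = \<bar>int_functional u x - int_functional u y\<bar>" "x \<in> K" "y \<in> K" by blast
    have "int_functional u x - int_functional u y \<le> w" "int_functional u y - int_functional u x \<le> w"
      using le[of "pair_of x" "pair_of y"] le[of "pair_of y" "pair_of x"] t(2,3)
      by (simp_all add: int_functional_2 u_def pair_of_def algebra_simps)
    then show "t \<le> w" using t(1) by simp
  qed
  moreover have "lattice_width K \<le> width_dir u K"
    unfolding lattice_width_def
  proof (rule cInf_lower)
    show "width_dir u K \<in> {width_dir u K | u. u \<noteq> 0}" using \<open>u \<noteq> 0\<close> by blast
    obtain x where "x \<in> K" using ne by blast
    then have "0 \<le> width_dir v K" for v using width_dir_ge[OF K, of x x v] by simp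
    then show "bdd_below {width_dir u K | u. u \<noteq> 0}" by (intro bdd_belowI[of _ 0]) auto
  qed
  ultimately show ?thesis by simp
qed

section \<open>Copies of \<open>Delta2\<close> as triples of vertices\<close>

lemma contains_copyI:
  fixes K :: "(real^2) set" and a b c d :: int
  assumes K: "convex K" and det: "\<bar>a * d - b * c\<bar> = 1" and A: "x \<in> A" "y \<in> A"
    and P: "vector [x, y] \<in> K" "vector [x + of_int a, y + of_int b] \<in> K" "vector [x + of_int c, y + of_int d] \<in> K"
  shows "contains_unimodular_copy A K Delta2"
proof -
  define M :: "int^2^2" where "M = vector [vector [a, c], vector [b, d]]"
  define t :: "real^2" where "t = vector [x, y]"
  define R :: "real^2^2" where "R = (\<chi> i j. real_of_int (M $ i $ j))"
  define T where "T = (\<lambda>v. R *v v + t)"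
  have Tv: "T v = vector [of_int a * v $ 1 + of_int c * v $ 2 + x, of_int b * v $ 1 + of_int d * v $ 2 + y]" for v
    by (simp add: T_def R_def M_def t_def vec_eq_iff forall_2 matrix_vector_mult_def sum_2)
  have "det M = a * d - c * b" by (simp add: M_def det_2)
  then have "det M = 1 \<or> det M = - 1" using det by (auto simp: mult.commute abs_if split: if_splits)
  moreover have "\<forall>i. t $ i \<in> A" using A by (simp add: t_def forall_2)
  ultimately have "unimodular_map A T"
    unfolding unimodular_map_def T_def R_def by blast
  moreover have "Delta2 \<subseteq> {v. T v \<in> K}"
    unfolding Delta2_def
  proof (rule hull_minimal)
    show "{0, axis 1 1, axis 2 1} \<subseteq> {v. T v \<in> K}"
      using P by (simp add: Tv axis_def add.commute)
    show "convex {v. T v \<in> K}"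
    proof (rule convexI, simp)
      fix v w :: "real^2" and \<alpha> \<beta> :: real
      assume *: "T v \<in> K" "T w \<in> K" "0 \<le> \<alpha>" "0 \<le> \<beta>" "\<alpha> + \<beta> = 1"
      have "T (\<alpha> *\<^sub>R v + \<beta> *\<^sub>R w) = \<alpha> *\<^sub>R (R *v v) + \<beta> *\<^sub>R (R *v w) + (\<alpha> + \<beta>) *\<^sub>R t"
        using *(5) by (simp add: T_def matrix_vector_right_distrib matrix_vector_mult_scaleR)
      also have "\<dots> = \<alpha> *\<^sub>R T v + \<beta> *\<^sub>R T w" by (simp add: T_def algebra_simps)
      finally show "T (\<alpha> *\<^sub>R v + \<beta> *\<^sub>R w) \<in> K" using convexD[OF K *(1,2) *(3-5)] by simp
    qed
  qed
  ultimately show ?thesis unfolding contains_unimodular_copy_def by blast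
qed

lemma contains_copyE:
  fixes K :: "(real^2) set"
  assumes "contains_unimodular_copy A K Delta2"
  obtains a b c d :: int and x y where "\<bar>a * d - b * c\<bar> = 1" "x \<in> A" "y \<in> A"
    "vector [x, y] \<in> K" "vector [x + of_int a, y + of_int b] \<in> K" "vector [x + of_int c, y + of_int d] \<in> K"
proof -
  obtain M :: "int^2^2" and t :: "real^2" where M: "det M = 1 \<or> det M = - 1" "\<forall>i. t $ i \<in> A"
    and sub: "(\<lambda>v. (\<chi> i j. real_of_int (M $ i $ j)) *v v + t) ` Delta2 \<subseteq> K"
    using assms unfolding contains_unimodular_copy_def unimodular_map_def by blast
  define T where "T = (\<lambda>v. (\<chi> i j. real_of_int (M $ i $ j)) *v v + t)"
  have Tv: "T v = vector [of_int (M $ 1 $ 1) * v $ 1 + of_int (M $ 1 $ 2) * v $ 2 + t $ 1, of_int (M $ 2 $ 1) * v $ 1 + of_int (M $ 2 $ 2) * v $ 2 + t $ 2]" for v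
    by (simp add: T_def vec_eq_iff forall_2 matrix_vector_mult_def sum_2)
  have "{0, axis 1 1, axis 2 1} \<subseteq> Delta2" unfolding Delta2_def by (rule hull_subset)
  then have "T 0 \<in> K" "T (axis 1 1) \<in> K" "T (axis 2 1) \<in> K" using sub unfolding T_def by auto
  then have "vector [t $ 1, t $ 2] \<in> K" "vector [t $ 1 + of_int (M $ 1 $ 1), t $ 2 + of_int (M $ 2 $ 1)] \<in> K"
    "vector [t $ 1 + of_int (M $ 1 $ 2), t $ 2 + of_int (M $ 2 $ 2)] \<in> K"
    by (simp_all add: Tv axis_def add.commute)
  moreover have "\<bar>M $ 1 $ 1 * M $ 2 $ 2 - M $ 2 $ 1 * M $ 1 $ 2\<bar> = 1"
    using M(1) by (auto simp: det_2 mult.commute)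
  ultimately show ?thesis using M(2) that by blast
qed

lemma Flt_le:
  assumes "\<And>K. convex_body K \<Longrightarrow> \<not> contains_unimodular_copy A K X \<Longrightarrow> lattice_width K \<le> w"
  shows "Flt A X \<le> ereal w"
  unfolding Flt_def using assms by (intro Sup_least) auto

lemma Flt_ge:
  fixes K X :: "(real^'n) set"
  assumes K: "convex_body K" "\<not> contains_unimodular_copy A K X"
    and w: "\<And>u. u \<noteq> 0 \<Longrightarrow> \<exists>x\<in>K. \<exists>y\<in>K. w \<le> \<bar>int_functional u x - int_functional u y\<bar>"
  shows "ereal w \<le> Flt A X"
proof -
  have "w \<le> lattice_width K"
    unfolding lattice_width_def
  proof (rule cInf_greatest)
    have "(1 :: int^'n) \<noteq> 0" by (simp add: vec_eq_iff)
    then show "{width_dir u K | u. u \<noteq> 0} \<noteq> {}" by blast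
    fix t assume "t \<in> {width_dir u K | u. u \<noteq> 0}"
    then obtain u where "t = width_dir u K" "u \<noteq> 0" by blast
    with w[of u] width_dir_ge[OF K(1)] show "w \<le> t" by (meson order_trans)
  qed
  also have "ereal (lattice_width K) \<le> Flt A X" unfolding Flt_def using K by (intro Sup_upper) auto
  finally show ?thesis by simp
qed

text \<open>Passes to the limit \<open>s = 1\<close>, where the extremal bodies themselves contain
  copies of \<open>Delta2\<close>.\<close>

lemma ereal_le_of_scaled:
  fixes w :: real and F :: ereal
  assumes "0 < w" and le: "\<And>s. 0 < s \<Longrightarrow> s < 1 \<Longrightarrow> ereal (w * s) \<le> F"
  shows "ereal w \<le> F"
proof (rule dense_le)
  fix x assume x: "x < ereal w"
  show "x \<le> F"
  proof (cases x)
    case (real t)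
    define s where "s = max (t / w) (1 / 2)"
    have "0 < s" "s < 1" using x real assms(1) by (auto simp: s_def)
    moreover have "t \<le> w * s" using assms(1) by (simp add: s_def max_def field_simps)
    ultimately show ?thesis using le[of s] real by (metis ereal_less_eq(3) order_trans)
  qed (use x in auto)
qed

lemma hull_halfspace:
  fixes V :: "(real^2) set"
  assumes "\<And>v. v \<in> V \<Longrightarrow> p * v $ 1 + q * v $ 2 \<le> c" "x \<in> convex hull V"
  shows "p * x $ 1 + q * x $ 2 \<le> c"
proof -
  have "{x :: real^2. p * x $ 1 + q * x $ 2 \<le> c} = {x. inner (vector [p, q]) x \<le> c}"
    by (simp add: inner_vec_def sum_2)
  then have "convex {x :: real^2. p * x $ 1 + q * x $ 2 \<le> c}"
    by (simp only: convex_halfspace_le)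
  then have "convex hull V \<subseteq> {x. p * x $ 1 + q * x $ 2 \<le> c}"
    using assms(1) by (intro hull_minimal) auto
  with assms(2) show ?thesis by auto
qed

lemma convex_body_finite_hull: "finite V \<Longrightarrow> V \<noteq> {} \<Longrightarrow> convex_body (convex hull V)"
  by (simp add: convex_body_def finite_imp_compact_convex_hull)

text \<open>Edges of a contained triangle are integral with sum norm at most
  \<open>2 * r < 2\<close>, hence at most 1. Two independent ones are unit vectors along different
  axes, and the third edge then has sum norm 2.\<close>

lemma Flt_real_ge:
  assumes r: "0 < r" "r < 1"
  shows "ereal (2 * r) \<le> Flt UNIV Delta2"
proof -
  define V :: "(real^2) set" where "V = {vector [r, 0], vector [- r, 0], vector [0, r], vector [0, - r]}"
  have norm1: "\<bar>x\<bar> + \<bar>y\<bar> \<le> r" if "vector [x, y] \<in> convex hull V" for x y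
  proof -
    have "p * x + q * y \<le> r" if "\<bar>p\<bar> = 1" "\<bar>q\<bar> = 1" for p q :: real
    proof -
      have "p * (vector [x, y] :: real^2) $ 1 + q * (vector [x, y] :: real^2) $ 2 \<le> r"
        by (rule hull_halfspace[OF _ \<open>vector [x, y] \<in> convex hull V\<close>]) (use r that in \<open>auto simp: V_def abs_if split: if_splits\<close>)
      then show ?thesis by simp
    qed
    from this[of 1 1] this[of 1 "- 1"] this[of "- 1" 1] this[of "- 1" "- 1"] show ?thesis by simp
  qed
  show ?thesis
  proof (rule Flt_ge)
    show "convex_body (convex hull V)" by (rule convex_body_finite_hull) (auto simp: V_def)
    show "\<not> contains_unimodular_copy UNIV (convex hull V) Delta2"
    proof
      assume "contains_unimodular_copy UNIV (convex hull V) Delta2"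
      then obtain a b c d :: int and x y where det: "\<bar>a * d - b * c\<bar> = 1"
        and P: "vector [x, y] \<in> convex hull V" "vector [x + of_int a, y + of_int b] \<in> convex hull V"
          "vector [x + of_int c, y + of_int d] \<in> convex hull V"
        by (rule contains_copyE)
      note n = norm1[OF P(1)] norm1[OF P(2)] norm1[OF P(3)]
      have "\<bar>of_int a :: real\<bar> + \<bar>of_int b\<bar> < 2" "\<bar>of_int c :: real\<bar> + \<bar>of_int d\<bar> < 2"
        "\<bar>of_int a - of_int c :: real\<bar> + \<bar>of_int b - of_int d\<bar> < 2"
        using n r by linarith+
      then have small: "\<bar>a\<bar> + \<bar>b\<bar> < 2" "\<bar>c\<bar> + \<bar>d\<bar> < 2" "\<bar>a - c\<bar> + \<bar>b - d\<bar> < 2"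
        by linarith+
      have "b = 0 \<or> c = 0" if "a = 0" "d = 0" using small(3) that by linarith
      moreover have "a = 0 \<or> d = 0" if "b = 0" "c = 0" using small(3) that by linarith
      moreover have "a = 0 \<or> b = 0" "c = 0 \<or> d = 0" using small by linarith+
      ultimately show False using det by auto
    qed
    fix u :: "int^2" assume "u \<noteq> 0"
    then have "u $ 1 \<noteq> 0 \<or> u $ 2 \<noteq> 0" by (simp add: vec_eq_iff forall_2)
    then show "\<exists>x\<in>convex hull V. \<exists>y\<in>convex hull V. 2 * r \<le> \<bar>int_functional u x - int_functional u y\<bar>"
    proof
      assume "u $ 1 \<noteq> 0"
      then have "1 \<le> \<bar>of_int (u $ 1) :: real\<bar>" by linarith
      then have "2 * r * 1 \<le> 2 * r * \<bar>of_int (u $ 1)\<bar>" using r by (intro mult_left_mono) auto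
      then show ?thesis using r
        by (intro bexI[of _ "vector [r, 0]"] bexI[of _ "vector [- r, 0]"] hull_inc)
          (auto simp: V_def int_functional_2 abs_mult)
    next
      assume "u $ 2 \<noteq> 0"
      then have "1 \<le> \<bar>of_int (u $ 2) :: real\<bar>" by linarith
      then have "2 * r * 1 \<le> 2 * r * \<bar>of_int (u $ 2)\<bar>" using r by (intro mult_left_mono) auto
      then show ?thesis using r
        by (intro bexI[of _ "vector [0, r]"] bexI[of _ "vector [0, - r]"] hull_inc)
          (auto simp: V_def int_functional_2 abs_mult)
    qed
  qed
qed

text \<open>By its three edge inequalities the shrunk triangle has lattice points only on
  \<open>y = 0\<close>, so they are collinear.\<close>

lemma Flt_int_ge:
  assumes s: "0 < s" "s < 1"
  shows "ereal (10 / 3 * s) \<le> Flt \<int> Delta2"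
proof -
  define r where "r = 5 / 3 * s"
  have r: "0 < r" "r < 5 / 3" using s by (auto simp: r_def)
  define v1 v2 v3 :: "real^2" where "v1 = vector [4 / 3 + r, 0]" and "v2 = vector [4 / 3 - r, r]" and "v3 = vector [4 / 3, - r]"
  define V where "V = {v1, v2, v3}"
  have level0: "y = 0" if xy: "vector [of_int x, of_int y] \<in> convex hull V" for x y :: int
  proof -
    let ?z = "vector [of_int x, of_int y] :: real^2"
    have "1 * ?z $ 1 + 2 * ?z $ 2 \<le> 4 / 3 + r"
      by (rule hull_halfspace[OF _ xy]) (use r in \<open>auto simp: V_def v1_def v2_def v3_def\<close>)
    moreover have "(- 2) * ?z $ 1 + (- 1) * ?z $ 2 \<le> - (8 / 3) + r"
      by (rule hull_halfspace[OF _ xy]) (use r in \<open>auto simp: V_def v1_def v2_def v3_def\<close>)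
    moreover have "1 * ?z $ 1 + (- 1) * ?z $ 2 \<le> 4 / 3 + r"
      by (rule hull_halfspace[OF _ xy]) (use r in \<open>auto simp: V_def v1_def v2_def v3_def\<close>)
    ultimately have "of_int x + 2 * of_int y < (3 :: real)" "1 < 2 * of_int x + (of_int y :: real)" "of_int x - of_int y < (3 :: real)"
      using r by simp_all
    then have "x + 2 * y < 3" "1 < 2 * x + y" "x - y < 3" by linarith+
    then show ?thesis by linarith
  qed
  show ?thesis
  proof (rule Flt_ge)
    show "convex_body (convex hull V)" by (rule convex_body_finite_hull) (auto simp: V_def)
    show "\<not> contains_unimodular_copy \<int> (convex hull V) Delta2"
    proof
      assume "contains_unimodular_copy \<int> (convex hull V) Delta2"
      then obtain a b c d :: int and x y where det: "\<bar>a * d - b * c\<bar> = 1" and xy: "x \<in> \<int>" "y \<in> \<int>"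
        and P: "vector [x, y] \<in> convex hull V" "vector [x + of_int a, y + of_int b] \<in> convex hull V"
          "vector [x + of_int c, y + of_int d] \<in> convex hull V"
        by (rule contains_copyE)
      obtain i j :: int where "x = of_int i" "y = of_int j" using xy unfolding Ints_def by blast
      then have "j = 0" "j + b = 0" "j + d = 0"
        using P level0[of i j] level0[of "i + a" "j + b"] level0[of "i + c" "j + d"] by auto
      with det show False by simp
    qed
    fix u :: "int^2" assume "u \<noteq> 0"
    then have "u $ 1 \<noteq> 0 \<or> u $ 2 \<noteq> 0" by (simp add: vec_eq_iff forall_2)
    \<comment> \<open>Both \<open>2 u1 - u2\<close> and \<open>2 u2 - u1\<close> are congruent to
      \<open>- (u1 + u2)\<close> modulo 3, and they add up to \<open>u1 + u2\<close>. If all three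
      had absolute value at most 1, they would vanish.\<close>
    then have "2 \<le> \<bar>2 * u $ 1 - u $ 2\<bar> \<or> 2 \<le> \<bar>u $ 1 + u $ 2\<bar> \<or> 2 \<le> \<bar>2 * u $ 2 - u $ 1\<bar>" by presburger
    then have *: "2 \<le> \<bar>2 * of_int (u $ 1) - of_int (u $ 2) :: real\<bar> \<or> 2 \<le> \<bar>of_int (u $ 1) + of_int (u $ 2) :: real\<bar>
        \<or> 2 \<le> \<bar>2 * of_int (u $ 2) - of_int (u $ 1) :: real\<bar>" by linarith
    have diff: "int_functional u v1 - int_functional u v2 = r * (2 * of_int (u $ 1) - of_int (u $ 2))"
      "int_functional u v1 - int_functional u v3 = r * (of_int (u $ 1) + of_int (u $ 2))"
      "int_functional u v2 - int_functional u v3 = r * (2 * of_int (u $ 2) - of_int (u $ 1))"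
      by (simp_all add: int_functional_2 v1_def v2_def v3_def algebra_simps)
    have "10 / 3 * s \<le> \<bar>r * t\<bar>" if "2 \<le> \<bar>t\<bar>" for t
    proof -
      have "r * 2 \<le> r * \<bar>t\<bar>" using that r by (intro mult_left_mono) auto
      then show ?thesis using r by (simp add: abs_mult r_def)
    qed
    with * have "10 / 3 * s \<le> \<bar>int_functional u v1 - int_functional u v2\<bar> \<or>
        10 / 3 * s \<le> \<bar>int_functional u v1 - int_functional u v3\<bar> \<or> 10 / 3 * s \<le> \<bar>int_functional u v2 - int_functional u v3\<bar>"
      unfolding diff by blast
    moreover have "v1 \<in> convex hull V" "v2 \<in> convex hull V" "v3 \<in> convex hull V"
      by (auto simp: V_def intro: hull_inc)
    ultimately show "\<exists>x\<in>convex hull V. \<exists>y\<in>convex hull V. 10 / 3 * s \<le> \<bar>int_functional u x - int_functional u y\<bar>"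
      by blast
  qed
qed

theorem theorem1p1:
  shows "Flt (UNIV :: real set) Delta2 = 2 \<and> Flt (\<int> :: real set) Delta2 = 10 / 3"
proof (intro conjI antisym)
  have "Flt (UNIV :: real set) Delta2 \<le> ereal 2"
  proof (rule Flt_le)
    fix K :: "(real^2) set" assume K: "convex_body K" "\<not> contains_unimodular_copy UNIV K Delta2"
    then have "\<not> real_triangle (pair_of ` K)"
      unfolding real_triangle_def pair_of_mem_iff convex_body_def by (meson UNIV_I contains_copyI)
    then show "lattice_width K \<le> 2"
      using K(1) by (intro lattice_width_le_of_thin thin_of_no_real_triangle)
        (auto simp: convex_body_def intro: convex_pair_of compact_pair_of)
  qed
  then show "Flt (UNIV :: real set) Delta2 \<le> 2" by simp
  have "Flt (\<int> :: real set) Delta2 \<le> ereal (10 / 3)"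
  proof (rule Flt_le)
    fix K :: "(real^2) set" assume K: "convex_body K" "\<not> contains_unimodular_copy \<int> K Delta2"
    have "\<not> integer_triangle (pair_of ` K)"
    proof
      assume "integer_triangle (pair_of ` K)"
      then obtain x y a b c d :: int where "\<bar>a * d - b * c\<bar> = 1" "vector [of_int x, of_int y] \<in> K"
        "vector [of_int x + of_int a, of_int y + of_int b] \<in> K" "vector [of_int x + of_int c, of_int y + of_int d] \<in> K"
        unfolding integer_triangle_def pair_of_mem_iff of_int_add by blast
      then show False using K contains_copyI[of K a d b c "of_int x" \<int> "of_int y"] by (auto simp: convex_body_def)
    qed
    then show "lattice_width K \<le> 10 / 3"
      using K(1) by (intro lattice_width_le_of_thin thin_of_no_integer_triangle)
        (auto simp: convex_body_def intro: convex_pair_of compact_pair_of)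
  qed
  then show "Flt (\<int> :: real set) Delta2 \<le> 10 / 3" by simp
  have "ereal 2 \<le> Flt UNIV Delta2" by (rule ereal_le_of_scaled[OF _ Flt_real_ge]) auto
  then show "2 \<le> Flt (UNIV :: real set) Delta2" by simp
  have "ereal (10 / 3) \<le> Flt \<int> Delta2" by (rule ereal_le_of_scaled[OF _ Flt_int_ge]) auto
  then show "10 / 3 \<le> Flt (\<int> :: real set) Delta2" by simp
qed

end
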